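(* Let $G$ be a complex reductive linear algebraic group, $B$ a Borel subgroup containing a maximal torus $T$, and $W$ the Weyl group. The star representation of $W$ on $H^*_T(G/B)$ (as an ungraded module) is the regular representation with $H^*_T(pt)$-coefficients. The star representation of $W$ on $H^*(G/B)$ (as an ungraded module) is the regular representation with $\mathbb{C}$-coefficients.
   Context: $G$ is connected, and $W=N(T)/T$ is generated by the reflections $s_\alpha$ for positive roots $\alpha$ (positive with respect to $B$). $H^*_T(pt)$ is the symmetric algebra over $\mathbb{C}$ on the space $\mathfrak{t}^*$ of linear functionals on $\mathrm{Lie}(T)$, and roots are regarded as elements of it. Equivariant cohomology is described by GKM theory: $H^*_T(G/B)$ is the ring (under pointwise operations) of tuples $p=(p(v))_{v\in W}$ with $p(v)\in H^*_T(pt)$ such that $p(v)-p(s_\alpha v)\in\langle\alpha\rangle$ for all $v\in W$ and all positive roots $\alpha$. It is an $H^*_T(pt)$-algebra. Ordinary cohomology is $H^*(G/B)=H^*_T(G/B)/\mathfrak{m}H^*_T(G/B)$, where $\mathfrak{m}$ is the ideal of $H^*_T(pt)$ generated by $\mathfrak{t}^*$. Star action: for $w\in W$ and $p\in H^*_T(G/B)$, the class $p*w$ is defined by $(p*w)(v)=p(vw)$ for all $v\in W$. Each map $p\mapsto p*w$ is a well-defined $H^*_T(pt)$-algebra automorphism of $H^*_T(G/B)$, hence induces a $\mathbb{C}$-algebra automorphism of $H^*(G/B)$. The star representation of $W$ on $H^*_T(G/B)$ (respectively $H^*(G/B)$) is the representation in which $w$ acts by $p\mapsto p*w$ (respectively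 by the induced map). For a commutative ring $R$, the regular representation of a finite group $\Gamma$ with $R$-coefficients is the free $R$-module with basis $\{e_g : g\in \Gamma\}$ on which $h\in\Gamma$ acts $R$-linearly by $h(e_g)=e_{hg}$. "Is the regular representation with $R$-coefficients" means: isomorphic to it by an $R$-linear $W$-equivariant isomorphism, which is not required to respect gradings. *)

theory Defs
  imports
    "HOL-Analysis.Analysis"
    "HOL-Algebra.Group_Action"
    "HOL-Algebra.Solvable_Groups"
    "HOL-Algebra.QuotRing"
    "HOL-Algebra.Module"
    "HOL-Algebra.Generated_Rings"
begin

section \<open>Algebras of functions and regular representations\<close>

text \<open>All tuples indexed by \<open>I\<close> with entries in \<open>R\<close>, with pointwise operations. As everywhere
  below, a function with domain \<open>I\<close> is represented by an extensional one.\<close>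

definition tuple_algebra :: "('a, 'b) ring_scheme \<Rightarrow> 'i set \<Rightarrow> ('a, 'i \<Rightarrow> 'a) module" where
  "tuple_algebra R I =
     \<lparr>carrier = I \<rightarrow>\<^sub>E carrier R,
      monoid.mult = (\<lambda>f g. \<lambda>i\<in>I. f i \<otimes>\<^bsub>R\<^esub> g i),
      monoid.one = (\<lambda>i\<in>I. \<one>\<^bsub>R\<^esub>),
      ring.zero = (\<lambda>i\<in>I. \<zero>\<^bsub>R\<^esub>),
      ring.add = (\<lambda>f g. \<lambda>i\<in>I. f i \<oplus>\<^bsub>R\<^esub> g i),
      module.smult = (\<lambda>r f. \<lambda>i\<in>I. r \<otimes>\<^bsub>R\<^esub> f i)\<rparr>"

text \<open>For a finite group \<open>\<Gamma>\<close>, the free module with basis \<open>(e\<^sub>g)\<close> is the module of functions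
  \<open>\<Gamma> \<rightarrow> R\<close>, with \<open>e\<^sub>g\<close> the indicator function of \<open>g\<close>; the linear extension of
  \<open>e\<^sub>g \<mapsto> e\<^bsub>hg\<^esub>\<close> then sends \<open>f\<close> to \<open>x \<mapsto> f (h\<^sup>-\<^sup>1 x)\<close>.\<close>

definition regular_action ::
    "('g, 'h) monoid_scheme \<Rightarrow> 'g \<Rightarrow> ('g \<Rightarrow> 'a) \<Rightarrow> ('g \<Rightarrow> 'a)" where
  "regular_action \<Gamma> h f = (\<lambda>x\<in>carrier \<Gamma>. f (inv\<^bsub>\<Gamma>\<^esub> h \<otimes>\<^bsub>\<Gamma>\<^esub> x))"

definition is_regular_rep ::
    "('a, 'b) ring_scheme \<Rightarrow> ('g, 'h) monoid_scheme \<Rightarrow> ('a, 'm, 'c) module_scheme \<Rightarrow>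
     ('g \<Rightarrow> 'm \<Rightarrow> 'm) \<Rightarrow> bool" where
  "is_regular_rep R \<Gamma> M act \<longleftrightarrow>
     group \<Gamma> \<and> finite (carrier \<Gamma>) \<and> Module.module R M \<and>
     (\<forall>h\<in>carrier \<Gamma>. act h \<in> carrier M \<rightarrow> carrier M) \<and>
     (\<exists>\<phi>. bij_betw \<phi> (carrier M) (carrier (tuple_algebra R (carrier \<Gamma>))) \<and>
       (\<forall>x\<in>carrier M. \<forall>y\<in>carrier M.
          \<phi> (x \<oplus>\<^bsub>M\<^esub> y) = \<phi> x \<oplus>\<^bsub>tuple_algebra R (carrier \<Gamma>)\<^esub> \<phi> y) \<and>
       (\<forall>r\<in>carrier R. \<forall>x\<in>carrier M.
          \<phi> (r \<odot>\<^bsub>M\<^esub> x) = r \<odot>\<^bsub>tuple_algebra R (carrier \<Gamma>)\<^esub> \<phi> x) \<and>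
       (\<forall>h\<in>carrier \<Gamma>. \<forall>x\<in>carrier M. \<phi> (act h x) = regular_action \<Gamma> h (\<phi> x)))"

definition complex_ring :: "complex ring" where
  "complex_ring =
     \<lparr>carrier = UNIV, monoid.mult = (*), one = 1, ring.zero = 0, ring.add = (+)\<rparr>"

text \<open>The complex algebra of functions on \<open>D\<close> generated by \<open>S\<close>.\<close>

definition generated_algebra :: "'x set \<Rightarrow> ('x \<Rightarrow> complex) set \<Rightarrow> ('x \<Rightarrow> complex) set" where
  "generated_algebra D S =
     generate_ring (tuple_algebra complex_ring D) ({\<lambda>x\<in>D. c | c. True} \<union> S)"


section \<open>Linear algebraic groups over the complex numbers\<close>

definition GL :: "(complex^'n^'n) monoid" where
  "GL = \<lparr>carrier = {A. invertible A}, monoid.mult = (**), one = mat 1\<rparr>"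

abbreviation matrix_group :: "(complex^'n^'n) set \<Rightarrow> (complex^'n^'n) monoid" where
  "matrix_group G \<equiv> GL\<lparr>carrier := G\<rparr>"

definition matrix_polynomials :: "(complex^'n^'n \<Rightarrow> complex) set" where
  "matrix_polynomials = generated_algebra UNIV {\<lambda>A. A $ i $ j | i j. True}"

definition zariski_closed :: "(complex^'n^'n) set \<Rightarrow> bool" where
  "zariski_closed S \<longleftrightarrow>
     (\<exists>P\<subseteq>matrix_polynomials. S = {A \<in> carrier GL. \<forall>f\<in>P. f A = 0})"

definition zariski_connected :: "(complex^'n^'n) set \<Rightarrow> bool" where
  "zariski_connected S \<longleftrightarrow>
     \<not> (\<exists>C D. zariski_closed C \<and> zariski_closed D \<and> S \<subseteq> C \<union> D \<and>
          C \<inter> D \<inter> S = {} \<and> C \<inter> S \<noteq> {} \<and> D \<inter> S \<noteq> {})"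

definition linear_algebraic_group :: "(complex^'n^'n) set \<Rightarrow> bool" where
  "linear_algebraic_group G \<longleftrightarrow> subgroup G GL \<and> zariski_closed G"

text \<open>The power is that of the matrix product: the operation \<open>^\<close> on \<open>complex^'n^'n\<close> would be
  the componentwise one.\<close>

definition unipotent :: "complex^'n^'n \<Rightarrow> bool" where
  "unipotent A \<longleftrightarrow> (\<exists>k::nat. (((**) (A - mat 1)) ^^ k) (mat 1) = 0)"

text \<open>Reductive: the unipotent radical, i.e. the largest connected normal unipotent closed
  subgroup, is trivial.\<close>

definition reductive_group :: "(complex^'n^'n) set \<Rightarrow> bool" where
  "reductive_group G \<longleftrightarrow>
     linear_algebraic_group G \<and>
     (\<forall>U. linear_algebraic_group U \<and> zariski_connected U \<and> U \<lhd> matrix_group G \<and>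
          (\<forall>A\<in>U. unipotent A) \<longrightarrow> U = {mat 1})"

definition connected_solvable_subgroup ::
    "(complex^'n^'n) set \<Rightarrow> (complex^'n^'n) set \<Rightarrow> bool" where
  "connected_solvable_subgroup G B \<longleftrightarrow>
     B \<subseteq> G \<and> linear_algebraic_group B \<and> zariski_connected B \<and> solvable (matrix_group B)"

definition borel_subgroup :: "(complex^'n^'n) set \<Rightarrow> (complex^'n^'n) set \<Rightarrow> bool" where
  "borel_subgroup G B \<longleftrightarrow>
     connected_solvable_subgroup G B \<and>
     (\<forall>B'. connected_solvable_subgroup G B' \<and> B \<subseteq> B' \<longrightarrow> B' = B)"

text \<open>Regular functions on a closed subset of \<open>GL\<close> are restrictions of elements of
  \<open>\<complex>[a\<^sub>i\<^sub>j, 1/det]\<close>.\<close>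

definition regular_function :: "(complex^'n^'n) set \<Rightarrow> (complex^'n^'n \<Rightarrow> complex) \<Rightarrow> bool" where
  "regular_function S f \<longleftrightarrow>
     (\<exists>g\<in>matrix_polynomials. \<exists>k::nat. \<forall>A\<in>S. f A = g A / det A ^ k)"

definition regular_map ::
    "(complex^'n^'n) set \<Rightarrow> (complex^'n^'n \<Rightarrow> complex^'m^'m) \<Rightarrow> bool" where
  "regular_map S \<phi> \<longleftrightarrow> (\<forall>i j. regular_function S (\<lambda>A. \<phi> A $ i $ j))"

definition algebraic_group_iso ::
    "(complex^'n^'n) set \<Rightarrow> (complex^'m^'m) set \<Rightarrow> (complex^'n^'n \<Rightarrow> complex^'m^'m) \<Rightarrow> bool" where
  "algebraic_group_iso G H \<phi> \<longleftrightarrow>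
     \<phi> \<in> iso (matrix_group G) (matrix_group H) \<and>
     regular_map G \<phi> \<and> regular_map H (inv_into G \<phi>)"

text \<open>The group \<open>(\<complex>\<^sup>*)\<^sup>I\<close>, as diagonal matrices. Every torus inside \<open>GL\<close> has rank at
  most \<open>n\<close>, so these groups are all that is needed to define tori.\<close>

definition coordinate_torus :: "'n set \<Rightarrow> (complex^'n^'n) set" where
  "coordinate_torus I =
     {A. (\<forall>i j. i \<noteq> j \<longrightarrow> A $ i $ j = 0) \<and>
         (\<forall>i. if i \<in> I then A $ i $ i \<noteq> 0 else A $ i $ i = 1)}"

definition torus :: "(complex^'n^'n) set \<Rightarrow> bool" where
  "torus T \<longleftrightarrow>
     linear_algebraic_group T \<and>
     (\<exists>(I :: 'n set) \<phi>. algebraic_group_iso T (coordinate_torus I) \<phi>)"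

definition maximal_torus :: "(complex^'n^'n) set \<Rightarrow> (complex^'n^'n) set \<Rightarrow> bool" where
  "maximal_torus G T \<longleftrightarrow>
     T \<subseteq> G \<and> torus T \<and> (\<forall>T'. T' \<subseteq> G \<and> torus T' \<and> T \<subseteq> T' \<longrightarrow> T' = T)"


section \<open>Roots and the Weyl group\<close>

definition matrix_scale :: "complex \<Rightarrow> complex^'n^'n \<Rightarrow> complex^'n^'n" where
  "matrix_scale c X = (\<chi> i j. c * X $ i $ j)"

text \<open>The Lie algebra as the Zariski tangent space at the identity matrix.\<close>

definition lie_algebra :: "(complex^'n^'n) set \<Rightarrow> (complex^'n^'n) set" where
  "lie_algebra G =
     {X. \<forall>f\<in>matrix_polynomials. (\<forall>A\<in>G. f A = 0) \<longrightarrow>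
           ((\<lambda>z. f (mat 1 + matrix_scale z X)) has_field_derivative 0) (at 0)}"

definition dual :: "(complex^'n^'n) set \<Rightarrow> (complex^'n^'n \<Rightarrow> complex) set" where
  "dual \<tau> =
     {l \<in> extensional \<tau>.
        (\<forall>X\<in>\<tau>. \<forall>Y\<in>\<tau>. l (X + Y) = l X + l Y) \<and>
        (\<forall>c. \<forall>X\<in>\<tau>. l (matrix_scale c X) = c * l X)}"

text \<open>The nonzero weights of \<open>Lie T\<close> on \<open>Lie G\<close>. The positive roots with respect to \<open>B\<close> are the
  roots of \<open>B\<close>, that is \<open>roots B T\<close>.\<close>

definition roots ::
    "(complex^'n^'n) set \<Rightarrow> (complex^'n^'n) set \<Rightarrow> (complex^'n^'n \<Rightarrow> complex) set" where
  "roots G T =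
     {\<alpha> \<in> dual (lie_algebra T).
        (\<exists>H\<in>lie_algebra T. \<alpha> H \<noteq> 0) \<and>
        (\<exists>X\<in>lie_algebra G. X \<noteq> 0 \<and>
           (\<forall>H\<in>lie_algebra T. H ** X - X ** H = matrix_scale (\<alpha> H) X))}"

definition weyl_group ::
    "(complex^'n^'n) set \<Rightarrow> (complex^'n^'n) set \<Rightarrow> (complex^'n^'n) set monoid" where
  "weyl_group G T = matrix_group (normalizer (matrix_group G) T) Mod T"

text \<open>The action on the dual of \<open>Lie T\<close> contragredient to conjugation. Conjugation by \<open>T\<close> is
  trivial on \<open>Lie T\<close>, so the choice of the representative \<open>n\<close> of the coset \<open>w\<close> is
  immaterial.\<close>

definition weyl_action ::
    "(complex^'n^'n) set \<Rightarrow> (complex^'n^'n) set \<Rightarrow> (complex^'n^'n \<Rightarrow> complex) \<Rightarrow>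
     (complex^'n^'n \<Rightarrow> complex)" where
  "weyl_action T w l =
     (let n = (SOME n. n \<in> w) in (\<lambda>H\<in>lie_algebra T. l (matrix_inv n ** H ** n)))"

text \<open>\<open>w\<close> acts as the reflection \<open>l \<mapsto> l - \<langle>l, h\<rangle> \<alpha>\<close> for some \<open>h\<close> (the coroot) with
  \<open>\<langle>\<alpha>, h\<rangle> = 2\<close>.\<close>

definition acts_as_reflection ::
    "(complex^'n^'n) set \<Rightarrow> (complex^'n^'n \<Rightarrow> complex) \<Rightarrow> (complex^'n^'n) set \<Rightarrow> bool" where
  "acts_as_reflection T \<alpha> w \<longleftrightarrow>
     (\<exists>h\<in>lie_algebra T. \<alpha> h = 2 \<and>
        (\<forall>l\<in>dual (lie_algebra T).
           weyl_action T w l = (\<lambda>H\<in>lie_algebra T. l H - l h * \<alpha> H)))"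

definition root_reflection ::
    "(complex^'n^'n) set \<Rightarrow> (complex^'n^'n) set \<Rightarrow> (complex^'n^'n \<Rightarrow> complex) \<Rightarrow>
     (complex^'n^'n) set" where
  "root_reflection G T \<alpha> =
     (THE w. w \<in> carrier (weyl_group G T) \<and> acts_as_reflection T \<alpha> w)"


section \<open>Equivariant and ordinary cohomology of the flag variety\<close>

text \<open>\<open>H\<^sup>*\<^sub>T(pt)\<close>: the symmetric algebra on the dual of \<open>Lie T\<close>, as the algebra of polynomial
  functions on \<open>Lie T\<close> (which it is canonically, the field being infinite).\<close>

definition HT_pt :: "(complex^'n^'n) set \<Rightarrow> (complex, complex^'n^'n \<Rightarrow> complex) module" where
  "HT_pt T =
     (tuple_algebra complex_ring (lie_algebra T))
       \<lparr>carrier := generated_algebra (lie_algebra T) (dual (lie_algebra T))\<rparr>"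

definition HT_flag ::
    "(complex^'n^'n) set \<Rightarrow> (complex^'n^'n) set \<Rightarrow> (complex^'n^'n) set \<Rightarrow>
     (complex^'n^'n \<Rightarrow> complex, (complex^'n^'n) set \<Rightarrow> complex^'n^'n \<Rightarrow> complex) module" where
  "HT_flag G B T =
     (tuple_algebra (HT_pt T) (carrier (weyl_group G T)))
       \<lparr>carrier :=
          {p \<in> carrier (weyl_group G T) \<rightarrow>\<^sub>E carrier (HT_pt T).
             \<forall>v\<in>carrier (weyl_group G T). \<forall>\<alpha>\<in>roots B T.
               p v \<ominus>\<^bsub>HT_pt T\<^esub> p (root_reflection G T \<alpha> \<otimes>\<^bsub>weyl_group G T\<^esub> v)
                 \<in> PIdl\<^bsub>HT_pt T\<^esub> \<alpha>}\<rparr>"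

text \<open>The ideal \<open>\<mm> H\<^sup>*\<^sub>T(G/B)\<close>, where \<open>\<mm>\<close> is the ideal of \<open>H\<^sup>*\<^sub>T(pt)\<close> generated by the
  linear functionals.\<close>

definition augmentation_ideal ::
    "(complex^'n^'n) set \<Rightarrow> (complex^'n^'n) set \<Rightarrow> (complex^'n^'n) set \<Rightarrow>
     ((complex^'n^'n) set \<Rightarrow> complex^'n^'n \<Rightarrow> complex) set" where
  "augmentation_ideal G B T =
     Idl\<^bsub>HT_flag G B T\<^esub>
       {f \<odot>\<^bsub>HT_flag G B T\<^esub> p | f p.
          f \<in> Idl\<^bsub>HT_pt T\<^esub> (dual (lie_algebra T)) \<and> p \<in> carrier (HT_flag G B T)}"

text \<open>The scalar multiplication is that of the algebra structure
  \<open>\<complex> \<rightarrow> H\<^sup>*\<^sub>T(pt) \<rightarrow> H\<^sup>*\<^sub>T(G/B) \<rightarrow> H\<^sup>*(G/B)\<close>.\<close>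

definition H_flag ::
    "(complex^'n^'n) set \<Rightarrow> (complex^'n^'n) set \<Rightarrow> (complex^'n^'n) set \<Rightarrow>
     (complex, ((complex^'n^'n) set \<Rightarrow> complex^'n^'n \<Rightarrow> complex) set) module" where
  "H_flag G B T =
     (let M = HT_flag G B T; J = augmentation_ideal G B T; Q = M Quot J in
      ring.extend Q
        (module.fields
          (\<lambda>c x. (J +>\<^bsub>M\<^esub> ((\<lambda>H\<in>lie_algebra T. c) \<odot>\<^bsub>M\<^esub> \<one>\<^bsub>M\<^esub>)) \<otimes>\<^bsub>Q\<^esub> x)))"

definition star ::
    "(complex^'n^'n) set \<Rightarrow> (complex^'n^'n) set \<Rightarrow> (complex^'n^'n) set \<Rightarrow>
     ((complex^'n^'n) set \<Rightarrow> complex^'n^'n \<Rightarrow> complex) \<Rightarrow>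
     ((complex^'n^'n) set \<Rightarrow> complex^'n^'n \<Rightarrow> complex)" where
  "star G T w p = (\<lambda>v\<in>carrier (weyl_group G T). p (v \<otimes>\<^bsub>weyl_group G T\<^esub> w))"

text \<open>The induced map on the quotient: the image of the coset of \<open>p\<close> under an automorphism
  preserving the ideal is the coset of the image of \<open>p\<close>.\<close>

definition induced_star ::
    "(complex^'n^'n) set \<Rightarrow> (complex^'n^'n) set \<Rightarrow> (complex^'n^'n) set \<Rightarrow>
     ((complex^'n^'n) set \<Rightarrow> complex^'n^'n \<Rightarrow> complex) set \<Rightarrow>
     ((complex^'n^'n) set \<Rightarrow> complex^'n^'n \<Rightarrow> complex) set" where
  "induced_star G T w x = star G T w ` x"

end

theory Submission
  imports Defs "HOL-Library.Function_Algebras" "HOL-Computational_Algebra.Polynomial" "HOL-Algebra.Zassenhaus"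
begin

text \<open>Let \<open>S\<close> be the ring of polynomial functions on \<open>Lie T\<close>, \<open>M\<close> the ring of tuples and \<open>\<mm>\<close> the ideal
  of functions vanishing at \<open>0\<close>. The divided differences \<open>(p(v) - p(v s\<^sub>\<alpha>)) / v\<alpha>\<close> are \<open>S\<close>-linear and
  map \<open>M\<close> to itself, and an argument of Chevalley's shows: if \<open>p\<close> vanishes at a point \<open>y\<close> off all
  root hyperplanes, then the leading homogeneous component of \<open>p\<close> lies in \<open>\<mm>M\<close>. Let \<open>H\<close> be a graded
  \<open>W\<close>-stable complement of \<open>\<mm>M\<close> in \<open>M\<close>, which exists by averaging a projection. Evaluation at \<open>y\<close> is
  then an injective equivariant map from \<open>H\<close> to the functions on \<open>W\<close>; it is onto because \<open>M = S H\<close>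
  and \<open>M\<close> contains the indicator functions times the product of the roots. If \<open>e \<in> H\<close> is mapped to the
  indicator function of \<open>1\<close>, the translates \<open>e * w\<close> form an \<open>S\<close>-basis of \<open>M\<close>, and hence a
  \<open>\<complex>\<close>-basis of \<open>M/\<mm>M\<close>.

  Finiteness of \<open>W\<close> comes from its action on the weights of \<open>T\<close>, which is diagonalizable; the action
  of \<open>W\<close> on \<open>Lie T\<close> is faithful because reflections are unique.\<close>

section \<open>Polynomial functions on a complex vector space\<close>

text \<open>The group acts on the positions of a tuple from the right, while the congruences relate
  positions from the left. Both meet in \<open>v s\<^sub>\<alpha> = s\<^sub>\<beta> v\<close> for
  \<open>v\<alpha>\<close> proportional to \<beta>, which makes the divided differences exist. At
  the origin all entries of a tuple agree, so evaluation there says nothing about \<open>W\<close>.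
  A point \<open>y\<close> off the hyperplanes serves twice: there the values of \<open>M\<close>
  exhaust the functions on \<open>W\<close>, and no \<open>v\<alpha>\<close> vanishes, so that a
  relation at \<open>y\<close> may be divided by \<open>v\<alpha>(y)\<close> and passes to divided
  differences. The price is that evaluation at \<open>y\<close> mixes degrees, hence an isomorphism
  that ignores gradings; only the leading component of a relation is controlled, which suffices
  because the complement is graded. Independence over \<open>S\<close> uses a second regular point
  \<open>z\<close>: a relation with coefficients frozen at \<open>z\<close> is a harmonic tuple
  vanishing at \<open>z\<close>, hence everywhere, and its values at \<open>y\<close> are those
  coefficients. The positive roots are replaced by one root for each reflection, a finite set once
  \<open>W\<close> is finite; this is why roots are permuted only up to scalars.\<close>

locale complex_subspace = vector_space scale
  for scale :: "complex \<Rightarrow> 'v::ab_group_add \<Rightarrow> 'v" (infixr \<open>*z\<close> 75) +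
  fixes t :: "'v set"
  assumes subspace_t: "subspace t"
begin

lemma t_closed [simp, intro]:
  "0 \<in> t" "x \<in> t \<Longrightarrow> y \<in> t \<Longrightarrow> x + y \<in> t" "x \<in> t \<Longrightarrow> c *z x \<in> t"
  "x \<in> t \<Longrightarrow> y \<in> t \<Longrightarrow> x - y \<in> t" "x \<in> t \<Longrightarrow> - x \<in> t"
  using subspace_0[OF subspace_t] subspace_add[OF subspace_t] subspace_scale[OF subspace_t]
    subspace_diff[OF subspace_t] subspace_neg[OF subspace_t] by auto

text \<open>Only the restriction to \<open>t\<close> matters, here and in \<open>hpoly\<close> and
  \<open>pol\<close>: \<open>Lie T\<close> is a subset of a type of matrices, and functions are
  never compared off it.\<close>

definition lin :: "('v \<Rightarrow> complex) \<Rightarrow> bool" where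
  "lin l \<longleftrightarrow> (\<forall>x\<in>t. \<forall>y\<in>t. l (x + y) = l x + l y) \<and> (\<forall>c. \<forall>x\<in>t. l (c *z x) = c * l x)"

lemma lin_add: "lin l \<Longrightarrow> x \<in> t \<Longrightarrow> y \<in> t \<Longrightarrow> l (x + y) = l x + l y"
  and lin_scale: "lin l \<Longrightarrow> x \<in> t \<Longrightarrow> l (c *z x) = c * l x"
  by (auto simp: lin_def)

lemma lin_diff: "lin l \<Longrightarrow> x \<in> t \<Longrightarrow> y \<in> t \<Longrightarrow> l (x - y) = l x - l y"
  using lin_add[of l "x - y" y] by auto

lemma lin_0: "lin l \<Longrightarrow> l 0 = 0"
  using lin_add[of l 0 0] by auto

text \<open>Terms \<open>l * g\<close> are added one at a time, so that no basis of \<open>t\<close>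
  is needed and rule induction treats a single term. The zero function belongs to every
  degree.\<close>

inductive hpoly :: "nat \<Rightarrow> ('v \<Rightarrow> complex) \<Rightarrow> bool" where
  hpoly_const: "(\<And>x. x \<in> t \<Longrightarrow> f x = c) \<Longrightarrow> hpoly 0 f"
| hpoly_zero: "(\<And>x. x \<in> t \<Longrightarrow> f x = 0) \<Longrightarrow> hpoly d f"
| hpoly_step: "lin l \<Longrightarrow> hpoly d g \<Longrightarrow> hpoly (Suc d) k \<Longrightarrow>
    (\<And>x. x \<in> t \<Longrightarrow> f x = l x * g x + k x) \<Longrightarrow> hpoly (Suc d) f"

lemma hpoly_cong: "hpoly d f \<Longrightarrow> (\<And>x. x \<in> t \<Longrightarrow> g x = f x) \<Longrightarrow> hpoly d g"
proof (induction rule: hpoly.induct)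
  case (hpoly_const f c)
  show ?case by (rule hpoly.hpoly_const[of g c]) (use hpoly_const in \<open>auto\<close>)
next
  case (hpoly_zero f d)
  show ?case by (rule hpoly.hpoly_zero) (use hpoly_zero in \<open>auto\<close>)
next
  case (hpoly_step l d h k f)
  show ?case by (rule hpoly.hpoly_step[of l d h k g]) (use hpoly_step in \<open>auto\<close>)
qed

lemma hpoly_scaling: "hpoly d f \<Longrightarrow> x \<in> t \<Longrightarrow> f (c *z x) = c ^ d * f x"
  by (induction rule: hpoly.induct) (auto simp: lin_scale algebra_simps)

lemma hpoly_0D:
  assumes "hpoly d f" "d = 0"
  shows "\<exists>c. \<forall>x\<in>t. f x = c"
  using assms by cases auto

lemma hpoly_add: "hpoly d f \<Longrightarrow> hpoly d g \<Longrightarrow> hpoly d (\<lambda>x. f x + g x)"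
proof (induction arbitrary: g rule: hpoly.induct)
  case (hpoly_const f c)
  then obtain c' where c': "\<forall>x\<in>t. g x = c'" using hpoly_0D by blast
  show ?case by (rule hpoly.hpoly_const[of _ "c + c'"]) (use hpoly_const c' in \<open>auto\<close>)
next
  case (hpoly_zero f d)
  then show ?case by (auto elim: hpoly_cong)
next
  case (hpoly_step l d f k h)
  show ?case
    by (rule hpoly.hpoly_step[of l d f "\<lambda>x. k x + g x"]) (use hpoly_step in \<open>auto simp: algebra_simps\<close>)
qed

lemma hpoly_mult_const: "hpoly d f \<Longrightarrow> hpoly d (\<lambda>x. c * f x)"
proof (induction rule: hpoly.induct)
  case (hpoly_const f c')
  show ?case by (rule hpoly.hpoly_const[of _ "c * c'"]) (use hpoly_const in \<open>auto\<close>)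
next
  case (hpoly_zero f d)
  then show ?case by (auto intro: hpoly.hpoly_zero)
next
  case (hpoly_step l d g k f)
  show ?case
    by (rule hpoly.hpoly_step[of l d "\<lambda>x. c * g x" "\<lambda>x. c * k x"]) (use hpoly_step in \<open>auto simp: algebra_simps\<close>)
qed

lemma hpoly_uminus: "hpoly d f \<Longrightarrow> hpoly d (\<lambda>x. - f x)"
  using hpoly_mult_const[of d f "-1"] by simp

lemma hpoly_diff: "hpoly d f \<Longrightarrow> hpoly d g \<Longrightarrow> hpoly d (\<lambda>x. f x - g x)"
  using hpoly_add[of d f "\<lambda>x. - g x"] hpoly_uminus by simp

lemma hpoly_sum: "finite I \<Longrightarrow> (\<And>i. i \<in> I \<Longrightarrow> hpoly d (f i)) \<Longrightarrow> hpoly d (\<lambda>x. \<Sum>i\<in>I. f i x)"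
  by (induction I rule: finite_induct) (auto intro: hpoly_zero hpoly_add)

lemma hpoly_lin_mult: "lin l \<Longrightarrow> hpoly d f \<Longrightarrow> hpoly (Suc d) (\<lambda>x. l x * f x)"
  by (rule hpoly_step[of l d f "\<lambda>_. 0"]) (auto intro: hpoly_zero)

lemma hpoly_lin: "lin l \<Longrightarrow> hpoly 1 l"
  using hpoly_lin_mult[of l 0 "\<lambda>_. 1"] hpoly_const[of "\<lambda>_. 1" 1] by simp

lemma hpoly_mult: "hpoly d f \<Longrightarrow> hpoly e g \<Longrightarrow> hpoly (d + e) (\<lambda>x. f x * g x)"
proof (induction rule: hpoly.induct)
  case (hpoly_const f c)
  then show ?case using hpoly_cong[OF hpoly_mult_const[of e g c]] by auto
next
  case (hpoly_zero f d)
  then show ?case by (auto intro: hpoly.hpoly_zero)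
next
  case (hpoly_step l d h k f)
  have *: "hpoly (Suc (d + e)) (\<lambda>x. l x * (h x * g x) + k x * g x)"
    using hpoly_add[OF hpoly_lin_mult[of l "d+e" "\<lambda>x. h x * g x"]] hpoly_step by simp
  show ?case using hpoly_step hpoly_cong[OF *] by (simp add: algebra_simps)
qed

lemma lin_compose:
  assumes "lin l" "\<And>x. x \<in> t \<Longrightarrow> a x \<in> t" "\<And>x y. x \<in> t \<Longrightarrow> y \<in> t \<Longrightarrow> a (x + y) = a x + a y"
    "\<And>x c. x \<in> t \<Longrightarrow> a (c *z x) = c *z a x"
  shows "lin (\<lambda>x. l (a x))"
  using assms unfolding lin_def by auto

section \<open>Polynomial functions as finite sums of homogeneous ones\<close>

definition pol :: "('v \<Rightarrow> complex) \<Rightarrow> bool" where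
  "pol f \<longleftrightarrow> (\<exists>n c. (\<forall>i. hpoly i (c i)) \<and> (\<forall>i>n. \<forall>x. c i x = 0) \<and> (\<forall>x\<in>t. f x = (\<Sum>i\<le>n. c i x)))"

lemma polI:
  assumes "\<And>i. i \<le> n \<Longrightarrow> hpoly i (c i)" "\<And>x. x \<in> t \<Longrightarrow> f x = (\<Sum>i\<le>n. c i x)"
  shows "pol f"
  unfolding pol_def
  by (rule exI[of _ n], rule exI[of _ "\<lambda>i. if i \<le> n then c i else (\<lambda>_. 0)"])
     (use assms in \<open>auto intro: hpoly_zero\<close>)

text \<open>The components vanish above \<open>n\<close>, so the upper summation bound may be
  enlarged freely; this gives two polynomials a common bound.\<close>

lemma polE:
  assumes "pol f"
  obtains n c where "\<And>i. hpoly i (c i)" "\<And>i x. i > n \<Longrightarrow> c i x = 0"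
    "\<And>m x. m \<ge> n \<Longrightarrow> x \<in> t \<Longrightarrow> f x = (\<Sum>i\<le>m. c i x)"
proof -
  from assms obtain n c where c: "\<forall>i. hpoly i (c i)" "\<forall>i>n. \<forall>x. c i x = 0" "\<forall>x\<in>t. f x = (\<Sum>i\<le>n. c i x)"
    unfolding pol_def by blast
  have *: "f x = (\<Sum>i\<le>m. c i x)" if "m \<ge> n" "x \<in> t" for m x
    using c that by (subst sum.mono_neutral_right[of "{..m}" "{..n}"]) auto
  show ?thesis by (rule that[of c n]) (use c * in auto)
qed

lemma pol_cong: "pol f \<Longrightarrow> (\<And>x. x \<in> t \<Longrightarrow> g x = f x) \<Longrightarrow> pol g"
  unfolding pol_def by (elim exE, intro exI) auto

lemma hpoly_imp_pol: "hpoly d f \<Longrightarrow> pol f"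
  by (rule polI[of d "\<lambda>i. if i = d then f else (\<lambda>_. 0)"]) (auto intro: hpoly_zero simp: if_distrib if_distribR cong: if_cong)

lemma pol_const: "pol (\<lambda>_. c)"
  by (rule hpoly_imp_pol[of 0]) (auto intro: hpoly_const)

lemma pol_lin: "lin l \<Longrightarrow> pol l"
  using hpoly_lin hpoly_imp_pol by blast

lemma pol_add:
  assumes "pol f" "pol g" shows "pol (\<lambda>x. f x + g x)"
proof -
  obtain n c where c: "\<And>i. hpoly i (c i)" "\<And>i x. i > n \<Longrightarrow> c i x = 0"
    "\<And>m x. m \<ge> n \<Longrightarrow> x \<in> t \<Longrightarrow> f x = (\<Sum>i\<le>m. c i x)" using polE[OF assms(1)] by metis
  obtain m d where d: "\<And>i. hpoly i (d i)" "\<And>i x. i > m \<Longrightarrow> d i x = 0"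
    "\<And>k x. k \<ge> m \<Longrightarrow> x \<in> t \<Longrightarrow> g x = (\<Sum>i\<le>k. d i x)" using polE[OF assms(2)] by metis
  show ?thesis
    by (rule polI[of "max n m" "\<lambda>i x. c i x + d i x"])
       (auto intro: hpoly_add c d simp: sum.distrib simp flip: c(3) d(3))
qed

lemma pol_sum: "finite I \<Longrightarrow> (\<And>i. i \<in> I \<Longrightarrow> pol (f i)) \<Longrightarrow> pol (\<lambda>x. \<Sum>i\<in>I. f i x)"
  by (induction I rule: finite_induct) (auto intro: pol_const pol_add)

lemma pol_mult:
  assumes "pol f" "pol g" shows "pol (\<lambda>x. f x * g x)"
proof -
  obtain n c where c: "\<And>i. hpoly i (c i)" "\<And>i x. i > n \<Longrightarrow> c i x = 0"
    "\<And>m x. m \<ge> n \<Longrightarrow> x \<in> t \<Longrightarrow> f x = (\<Sum>i\<le>m. c i x)" using polE[OF assms(1)] by metis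
  obtain m d where d: "\<And>i. hpoly i (d i)" "\<And>i x. i > m \<Longrightarrow> d i x = 0"
    "\<And>k x. k \<ge> m \<Longrightarrow> x \<in> t \<Longrightarrow> g x = (\<Sum>i\<le>k. d i x)" using polE[OF assms(2)] by metis
  have *: "pol (\<lambda>x. \<Sum>i\<le>n. \<Sum>j\<le>m. c i x * d j x)"
    by (intro pol_sum hpoly_imp_pol[OF hpoly_mult]) (auto intro: c d)
  show ?thesis
    by (rule pol_cong[OF *]) (simp add: c(3)[of n] d(3)[of m] sum_product)
qed

lemma pol_uminus: "pol f \<Longrightarrow> pol (\<lambda>x. - f x)"
  using pol_mult[OF pol_const[of "-1"]] by simp

lemma pol_diff: "pol f \<Longrightarrow> pol g \<Longrightarrow> pol (\<lambda>x. f x - g x)"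
  using pol_add[of f "\<lambda>x. - g x"] pol_uminus by simp

lemma pol_prod: "finite I \<Longrightarrow> (\<And>i. i \<in> I \<Longrightarrow> pol (f i)) \<Longrightarrow> pol (\<lambda>x. \<Prod>i\<in>I. f i x)"
  by (induction I rule: finite_induct) (auto intro: pol_const pol_mult)

text \<open>Along the line through \<open>x\<close> the sum is a polynomial in \<open>z\<close>
  whose coefficients are the values \<open>c i x\<close>, and coefficients of polynomials in one
  variable are unique.\<close>

lemma hpoly_components_unique:
  assumes "\<And>i. i \<le> n \<Longrightarrow> hpoly i (c i)" "\<And>i. i \<le> n \<Longrightarrow> hpoly i (c' i)"
    and "x \<in> t" "x' \<in> t" "\<And>z. (\<Sum>i\<le>n. c i (z *z x)) = (\<Sum>i\<le>n. c' i (z *z x'))" "i \<le> n"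
  shows "c i x = c' i x'"
proof -
  have "(\<Sum>i\<le>n. c i x * z ^ i) = (\<Sum>i\<le>n. c' i x' * z ^ i)" for z
    using assms(5)[of z] assms(3,4)
    by (simp add: hpoly_scaling[OF assms(1)] hpoly_scaling[OF assms(2)] mult.commute cong: sum.cong_simp)
  then show ?thesis using assms(6) polyfun_eq_coeffs[of "\<lambda>i. c i x" n "\<lambda>i. c' i x'"] by blast
qed

section \<open>Restriction to lines and cancellation of factors\<close>

lemma hpoly_line: "hpoly d f \<Longrightarrow> x \<in> t \<Longrightarrow> y \<in> t \<Longrightarrow> \<exists>q. \<forall>z. f (x + z *z y) = poly q z"
proof (induction rule: hpoly.induct)
  case (hpoly_const f c)
  then show ?case by (intro exI[of _ "[:c:]"]) auto
next
  case (hpoly_zero f d)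
  then show ?case by (intro exI[of _ 0]) auto
next
  case (hpoly_step l d g k f)
  then obtain q r where "\<And>z. g (x + z *z y) = poly q z" "\<And>z. k (x + z *z y) = poly r z" by blast
  then show ?case using hpoly_step.hyps hpoly_step.prems
    by (intro exI[of _ "[:l x, l y:] * q + r"]) (simp add: lin_add lin_scale algebra_simps)
qed

lemma pol_line:
  assumes "pol f" "x \<in> t" "y \<in> t"
  shows "\<exists>q. \<forall>z. f (x + z *z y) = poly q z"
proof -
  obtain n c where c: "\<And>i. hpoly i (c i)" "\<And>i x. i > n \<Longrightarrow> c i x = 0"
    "\<And>m x. m \<ge> n \<Longrightarrow> x \<in> t \<Longrightarrow> f x = (\<Sum>i\<le>m. c i x)" using polE[OF assms(1)] by metis
  obtain q where q: "\<And>i z. c i (x + z *z y) = poly (q i) z"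
    using hpoly_line[OF c(1) assms(2,3)] by metis
  have "f (x + z *z y) = poly (\<Sum>i\<le>n. q i) z" for z
    using assms c(3)[of n "x + z *z y"] by (simp add: q poly_sum)
  then show ?thesis by blast
qed

text \<open>On the line joining \<open>x\<close> to a point where \<open>g\<close> is nonzero both
  functions are polynomials in one variable, which form an integral domain. Besides \<open>t\<close>
  itself, \<open>K\<close> will be a root hyperplane.\<close>

lemma pol_zero_product:
  assumes "pol f" "pol g" and K: "K \<subseteq> t" "\<And>x y z. x \<in> K \<Longrightarrow> y \<in> K \<Longrightarrow> x + z *z (y - x) \<in> K"
    and fg: "\<And>x. x \<in> K \<Longrightarrow> f x * g x = 0" and y: "y \<in> K" "g y \<noteq> 0" and x: "x \<in> K"
  shows "f x = 0"
proof -
  have xy: "x \<in> t" "y - x \<in> t" using x y K(1) by auto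
  obtain q where q: "\<And>z. f (x + z *z (y - x)) = poly q z" using pol_line[OF assms(1) xy] by metis
  obtain r where r: "\<And>z. g (x + z *z (y - x)) = poly r z" using pol_line[OF assms(2) xy] by metis
  have "poly (q * r) z = 0" for z
    using fg[OF K(2)[OF x y(1), of z]] by (simp add: q r)
  then have "q * r = 0" using poly_all_0_iff_0[of "q * r"] by blast
  moreover have "r \<noteq> 0" using r[of 1] y by auto
  ultimately show ?thesis using q[of 0] by auto
qed

lemma pol_zero_product_t:
  assumes "pol f" "pol g" "\<And>x. x \<in> t \<Longrightarrow> f x * g x = 0" "y \<in> t" "g y \<noteq> 0" "x \<in> t"
  shows "f x = 0"
  by (rule pol_zero_product[OF assms(1,2) order_refl _ assms(3-6)]) auto

lemma pol_prod_nonzero: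
  assumes "finite I" "\<And>i. i \<in> I \<Longrightarrow> pol (f i)" "\<And>i. i \<in> I \<Longrightarrow> \<exists>x\<in>t. f i x \<noteq> 0"
  shows "\<exists>x\<in>t. (\<Prod>i\<in>I. f i x) \<noteq> 0"
  using assms
proof (induction I rule: finite_induct)
  case empty
  then show ?case using t_closed(1) by auto
next
  case (insert i I)
  then obtain x where x: "x \<in> t" "(\<Prod>i\<in>I. f i x) \<noteq> 0" by auto
  obtain y where y: "y \<in> t" "f i y \<noteq> 0" using insert(5)[of i] by auto
  have p: "pol (f i)" "pol (\<lambda>x. \<Prod>i\<in>I. f i x)" using insert(1,4) by (auto intro!: pol_prod)
  show ?case
  proof (rule ccontr)
    assume "\<not> ?thesis"
    then have "f i z * (\<Prod>i\<in>I. f i z) = 0" if "z \<in> t" for z using that insert(1,2) by auto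
    from pol_zero_product_t[OF p this x y(1)] y(2) show False by simp
  qed
qed

text \<open>A discrete product rule: for \<open>x' = x - \<beta>(x) h\<close> one has \<open>l(x)
  g(x) - l(x') g(x') = (l(x) - l(x')) g(x) + l(x') (g(x) - g(x'))\<close>, and
  \<open>l(x) - l(x') = l(h) \<beta>(x)\<close>. The value of \<beta> at \<open>h\<close> is left
  open: for 2 the map is a reflection, for 1 the projection onto the kernel of \<beta>.\<close>

lemma hpoly_difference_divisible:
  assumes "hpoly d g" "lin \<beta>" "h \<in> t"
  shows "\<exists>r. hpoly (d - 1) r \<and> (d = 0 \<longrightarrow> (\<forall>x\<in>t. r x = 0)) \<and> (\<forall>x\<in>t. g x - g (x - \<beta> x *z h) = \<beta> x * r x)"
  using assms(1)
proof (induction rule: hpoly.induct)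
  case (hpoly_const f c)
  show ?case
    by (rule exI[of _ "\<lambda>_. 0"]) (use hpoly_const t_closed assms(3) in \<open>simp add: hpoly.hpoly_zero\<close>)
next
  case (hpoly_zero f d)
  show ?case
    by (rule exI[of _ "\<lambda>_. 0"]) (use hpoly_zero t_closed assms(3) in \<open>simp add: hpoly.hpoly_zero\<close>)
next
  case (hpoly_step l d g k f)
  from hpoly_step.IH(1) obtain r where r: "hpoly (d - 1) r" "d = 0 \<longrightarrow> (\<forall>x\<in>t. r x = 0)" "\<forall>x\<in>t. g x - g (x - \<beta> x *z h) = \<beta> x * r x" by blast
  from hpoly_step.IH(2) obtain r' where r': "hpoly d r'" "\<forall>x\<in>t. k x - k (x - \<beta> x *z h) = \<beta> x * r' x"
    unfolding diff_Suc_1 by blast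
  define l' where "l' = (\<lambda>x. l x - l h * \<beta> x)"
  have l': "lin l'" using hpoly_step.hyps(1) assms(2) by (auto simp: lin_def l'_def algebra_simps)
  \<comment> \<open>For \<open>d = 0\<close> the truncated degree \<open>d - 1\<close> of
    \<open>r\<close> is 0, and the product with \<open>l'\<close> has degree 0 only because
    \<open>r\<close> is then zero; hence the extra clause in the statement.\<close>
  have "hpoly d (\<lambda>x. l' x * r x)"
  proof (cases d)
    case 0
    then show ?thesis using r(2) by (auto intro: hpoly.hpoly_zero)
  next
    case (Suc n)
    then show ?thesis using hpoly_lin_mult[OF l' r(1)] by simp
  qed
  then have "hpoly (Suc d - 1) (\<lambda>x. l h * g x + l' x * r x + r' x)"
    using hpoly_add[OF hpoly_add[OF hpoly_mult_const[OF hpoly_step.hyps(2)]] r'(1)] by simp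
  moreover have "f x - f (x - \<beta> x *z h) = \<beta> x * (l h * g x + l' x * r x + r' x)" if x: "x \<in> t" for x
  proof -
    define x' where "x' = x - \<beta> x *z h"
    have x': "x' \<in> t" using x assms by (auto simp: x'_def)
    have l: "l x' = l' x" using x assms hpoly_step.hyps(1) by (simp add: x'_def l'_def lin_diff lin_scale)
    have "g x' = g x - \<beta> x * r x" "k x' = k x - \<beta> x * r' x" using bspec[OF r(3) x] bspec[OF r'(2) x]
      by (simp_all add: x'_def diff_eq_eq)
    then have "f x - f x' = l x * g x + k x - (l x' * (g x - \<beta> x * r x) + (k x - \<beta> x * r' x))"
      using hpoly_step.hyps(4)[OF x] hpoly_step.hyps(4)[OF x'] by simp
    also have "\<dots> = \<beta> x * (l h * g x + l' x * r x + r' x)"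
      by (simp add: l l'_def algebra_simps)
    finally show ?thesis by (simp add: x'_def)
  qed
  ultimately show ?case
    by (intro exI[of _ "\<lambda>x. l h * g x + l' x * r x + r' x"] conjI ballI) auto
qed

text \<open>As \<beta> takes the value 1 at \<open>h\<close>, the point
  \<open>x - \<beta> x *z h\<close> lies in the kernel of \<beta>, where \<open>g\<close> vanishes.
  The difference that was just factored is therefore \<open>g\<close> itself.\<close>

lemma hpoly_divisible:
  assumes "hpoly (Suc d) g" "lin \<beta>" "h \<in> t" "\<beta> h = 1"
    and ker: "\<And>x. x \<in> t \<Longrightarrow> \<beta> x = 0 \<Longrightarrow> g x = 0"
  shows "\<exists>r. hpoly d r \<and> (\<forall>x\<in>t. g x = \<beta> x * r x)"
proof -
  obtain r where r: "hpoly d r" "\<forall>x\<in>t. g x - g (x - \<beta> x *z h) = \<beta> x * r x"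
    using hpoly_difference_divisible[OF assms(1-3)] by auto
  have "g (x - \<beta> x *z h) = 0" if "x \<in> t" for x
    using that assms by (intro ker) (auto simp: lin_diff lin_scale)
  with r show ?thesis by auto
qed

lemma pol_divisible:
  assumes "pol g" "lin \<beta>" "h \<in> t" "\<beta> h = 1"
    and ker: "\<And>x. x \<in> t \<Longrightarrow> \<beta> x = 0 \<Longrightarrow> g x = 0"
  shows "\<exists>r. pol r \<and> (\<forall>x\<in>t. g x = \<beta> x * r x)"
proof -
  obtain n c where c: "\<And>i. hpoly i (c i)" "\<And>i x. i > n \<Longrightarrow> c i x = 0"
    "\<And>m x. m \<ge> n \<Longrightarrow> x \<in> t \<Longrightarrow> g x = (\<Sum>i\<le>m. c i x)" using polE[OF assms(1)] by metis
  have "\<exists>r. pol r \<and> (\<forall>x\<in>t. c i x - c i (x - \<beta> x *z h) = \<beta> x * r x)" for i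
    using hpoly_difference_divisible[OF c(1) assms(2,3)] hpoly_imp_pol by blast
  then obtain r where r: "\<And>i. pol (r i)" "\<And>i x. x \<in> t \<Longrightarrow> c i x - c i (x - \<beta> x *z h) = \<beta> x * r i x"
    by metis
  have "g x = \<beta> x * (\<Sum>i\<le>n. r i x)" if x: "x \<in> t" for x
  proof -
    have x': "x - \<beta> x *z h \<in> t" using x assms by auto
    have "g (x - \<beta> x *z h) = 0"
      using x assms by (intro ker) (auto simp: lin_diff lin_scale)
    then have "g x = g x - g (x - \<beta> x *z h)" by simp
    also have "\<dots> = (\<Sum>i\<le>n. c i x - c i (x - \<beta> x *z h))"
      using c(3)[OF order_refl x] c(3)[OF order_refl x'] by (simp add: sum_subtractf)
    also have "\<dots> = \<beta> x * (\<Sum>i\<le>n. r i x)" by (simp add: r(2)[OF x] sum_distrib_left)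
    finally show ?thesis .
  qed
  then show ?thesis using pol_sum[of "{..n}" r] r(1) by auto
qed

end

section \<open>Reflection groups and tuples of polynomials\<close>

text \<open>Elements of \<open>W\<close> are recognized through \<open>reflection_unique\<close>
  instead of through a faithful action. In \<open>R_stable\<close> a root is carried to a multiple
  of a root, because \<open>R\<close> will hold one positive root for each reflection, so that signs
  and proportional roots are absorbed by the scalar.\<close>

locale reflection_group = complex_subspace scale t + group W
  for scale :: "complex \<Rightarrow> 'v::ab_group_add \<Rightarrow> 'v" (infixr \<open>*z\<close> 75)
    and t :: "'v set" and W :: "('g, 'b) monoid_scheme" (structure) +
  fixes a :: "'g \<Rightarrow> 'v \<Rightarrow> 'v" and R :: "('v \<Rightarrow> complex) set"
    and s :: "('v \<Rightarrow> complex) \<Rightarrow> 'g" and h :: "('v \<Rightarrow> complex) \<Rightarrow> 'v"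
  assumes finite_W: "finite (carrier W)"
    and a_closed: "w \<in> carrier W \<Longrightarrow> x \<in> t \<Longrightarrow> a w x \<in> t"
    and a_add: "w \<in> carrier W \<Longrightarrow> x \<in> t \<Longrightarrow> y \<in> t \<Longrightarrow> a w (x + y) = a w x + a w y"
    and a_scale: "w \<in> carrier W \<Longrightarrow> x \<in> t \<Longrightarrow> a w (c *z x) = c *z a w x"
    and a_mult: "v \<in> carrier W \<Longrightarrow> w \<in> carrier W \<Longrightarrow> x \<in> t \<Longrightarrow> a (v \<otimes> w) x = a v (a w x)"
    and a_one: "x \<in> t \<Longrightarrow> a \<one> x = x"
    and finite_R: "finite R"
    and R_lin: "\<alpha> \<in> R \<Longrightarrow> lin \<alpha>"
    and s_closed: "\<alpha> \<in> R \<Longrightarrow> s \<alpha> \<in> carrier W"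
    and h_closed: "\<alpha> \<in> R \<Longrightarrow> h \<alpha> \<in> t"
    and root_coroot: "\<alpha> \<in> R \<Longrightarrow> \<alpha> (h \<alpha>) = 2"
    and a_s: "\<alpha> \<in> R \<Longrightarrow> x \<in> t \<Longrightarrow> a (s \<alpha>) x = x - \<alpha> x *z h \<alpha>"
    and reflection_unique: "\<alpha> \<in> R \<Longrightarrow> w \<in> carrier W \<Longrightarrow> k \<in> t \<Longrightarrow> \<alpha> k = 2 \<Longrightarrow>
          (\<And>x. x \<in> t \<Longrightarrow> a w x = x - \<alpha> x *z k) \<Longrightarrow> w = s \<alpha>"
    and generated: "generate W (s ` R) = carrier W"
    and R_stable: "\<alpha> \<in> R \<Longrightarrow> v \<in> carrier W \<Longrightarrow>
          \<exists>\<beta>\<in>R. \<exists>c. \<forall>x\<in>t. \<alpha> (a (inv v) x) = c * \<beta> x"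
begin

lemma a_inv_cancel:
  assumes "w \<in> carrier W" "x \<in> t"
  shows "a (inv w) (a w x) = x" "a w (a (inv w) x) = x"
  using assms a_mult[of "inv w" w x] a_mult[of w "inv w" x] a_one by auto

text \<open>Solving the reflection formula shows that the inverse acts by the same formula;
  uniqueness turns this into an equality in \<open>W\<close>.\<close>

lemma s_inv: assumes "\<alpha> \<in> R" shows "inv (s \<alpha>) = s \<alpha>"
proof (rule reflection_unique)
  show "a (inv (s \<alpha>)) x = x - \<alpha> x *z h \<alpha>" if x: "x \<in> t" for x
  proof -
    define y where "y = a (inv (s \<alpha>)) x"
    have y: "y \<in> t" unfolding y_def using x s_closed[OF assms] by (intro a_closed) auto
    have "x = y - \<alpha> y *z h \<alpha>"
      using a_inv_cancel(2)[OF s_closed[OF assms] x] a_s[OF assms y] by (simp add: y_def)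
    moreover from this have "\<alpha> x = - \<alpha> y"
      using lin_diff[OF R_lin[OF assms] y, of "\<alpha> y *z h \<alpha>"] lin_scale[OF R_lin[OF assms] h_closed[OF assms]]
        root_coroot[OF assms] h_closed[OF assms] by auto
    ultimately have "y = x - \<alpha> x *z h \<alpha>" by simp
    then show ?thesis by (simp add: y_def)
  qed
qed (use assms s_closed h_closed root_coroot in auto)

lemma s_s: "\<alpha> \<in> R \<Longrightarrow> s \<alpha> \<otimes> s \<alpha> = \<one>"
  using s_inv[of \<alpha>] r_inv[OF s_closed[of \<alpha>]] by simp

lemma lin_root_a:
  assumes "\<alpha> \<in> R" "v \<in> carrier W" shows "lin (\<lambda>x. \<alpha> (a v x))"
  by (rule lin_compose) (use assms in \<open>auto intro: R_lin a_closed a_add a_scale\<close>)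

lemma a_s_fix: "\<alpha> \<in> R \<Longrightarrow> x \<in> t \<Longrightarrow> \<alpha> x = 0 \<Longrightarrow> a (s \<alpha>) x = x"
  by (simp add: a_s)

text \<open>The conjugate of \<open>s \<alpha>\<close> by \<open>v\<close> acts as a reflection with
  functional \<open>v\<alpha>\<close>, a multiple of \<beta>, and coroot
  \<open>a v (h \<alpha>)\<close>. Moving the factor \<open>c\<close> to the coroot gives the shape
  demanded by \<open>reflection_unique\<close> for \<beta>. The factor is nonzero because
  \<open>v\<alpha>\<close> takes the value 2 at that coroot.\<close>

lemma s_conjugate:
  assumes "\<alpha> \<in> R" "v \<in> carrier W"
  obtains \<beta> c where "\<beta> \<in> R" "c \<noteq> 0" "\<And>x. x \<in> t \<Longrightarrow> \<alpha> (a (inv v) x) = c * \<beta> x" "v \<otimes> s \<alpha> = s \<beta> \<otimes> v"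
proof -
  obtain \<beta> c where b: "\<beta> \<in> R" "\<forall>x\<in>t. \<alpha> (a (inv v) x) = c * \<beta> x" using R_stable[OF assms] by blast
  have hv: "a v (h \<alpha>) \<in> t" using assms h_closed a_closed by blast
  have "c * \<beta> (a v (h \<alpha>)) = 2"
    using b(2) hv a_inv_cancel(1)[OF assms(2) h_closed[OF assms(1)]] root_coroot[OF assms(1)] by force
  then have c: "c \<noteq> 0" and b2: "\<beta> (c *z a v (h \<alpha>)) = 2"
    using lin_scale[OF R_lin[OF b(1)] hv] by auto
  have "v \<otimes> s \<alpha> \<otimes> inv v = s \<beta>"
  proof (rule reflection_unique[OF b(1) _ _ b2])
    fix x assume x: "x \<in> t"
    have ax: "a (inv v) x \<in> t" using assms x a_closed by auto
    have "a (v \<otimes> s \<alpha> \<otimes> inv v) x = a v (a (s \<alpha>) (a (inv v) x))"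
      using assms s_closed x ax by (simp add: a_mult)
    also have "\<dots> = a v (a (inv v) x + (- \<alpha> (a (inv v) x)) *z h \<alpha>)" using a_s[OF assms(1) ax] by simp
    also have "\<dots> = x + (- \<alpha> (a (inv v) x)) *z a v (h \<alpha>)"
      using assms ax h_closed[OF assms(1)] a_inv_cancel(2)[OF assms(2) x] t_closed(3) by (simp only: a_add a_scale)
    also have "\<dots> = x - \<beta> x *z (c *z a v (h \<alpha>))" using b(2) x by (simp add: mult.commute)
    finally show "a (v \<otimes> s \<alpha> \<otimes> inv v) x = x - \<beta> x *z (c *z a v (h \<alpha>))" .
  qed (use assms s_closed hv in auto)
  then have "s \<beta> \<otimes> v = v \<otimes> s \<alpha>"
    using assms s_closed by (metis inv_closed inv_solve_right m_closed)
  with b c that show ?thesis by metis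
qed

lemma root_half:
  assumes "\<alpha> \<in> R" shows "(1/2) *z h \<alpha> \<in> t \<and> \<alpha> ((1/2) *z h \<alpha>) = 1"
  using lin_scale[OF R_lin[OF assms] h_closed[OF assms], of "1/2"] h_closed[OF assms] root_coroot[OF assms]
  by auto

text \<open>The generators are involutions, so inverses contribute nothing new. What is proved along
  \<open>generate\<close> is that left multiplication by \<open>w\<close> preserves
  \<open>P\<close>, a property closed under products.\<close>

lemma generate_induct [consumes 1, case_names one step]:
  assumes "w \<in> carrier W" "P \<one>"
    "\<And>\<alpha> w. \<alpha> \<in> R \<Longrightarrow> w \<in> carrier W \<Longrightarrow> P w \<Longrightarrow> P (s \<alpha> \<otimes> w)"
  shows "P w"
proof -
  have "w \<in> generate W (s ` R)" using assms(1) generated by simp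
  then have "w \<in> carrier W \<and> (\<forall>u\<in>carrier W. P u \<longrightarrow> P (w \<otimes> u))"
  proof induction
    case one
    then show ?case by simp
  next
    case (incl k)
    then show ?case using assms(3) s_closed by auto
  next
    case (inv k)
    then show ?case using assms(3) s_closed s_inv by auto
  next
    case (eng k1 k2)
    then show ?case by (simp add: m_assoc)
  qed
  then show ?thesis using assms(2) by force
qed

section \<open>Tuples subject to the GKM congruences\<close>

definition gkm :: "('g \<Rightarrow> 'v \<Rightarrow> complex) \<Rightarrow> bool" where
  "gkm p \<longleftrightarrow> (\<forall>v\<in>carrier W. pol (p v) \<and>
     (\<forall>\<alpha>\<in>R. \<forall>x\<in>t. \<alpha> x = 0 \<longrightarrow> p (s \<alpha> \<otimes> v) x = p v x))"

text \<open>As in \<open>gkm\<close>, a congruence modulo a root is stated as equality on its zero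
  set, which is the same by divisibility by linear forms. Zero sets of roots are stable under
  scaling, and this makes the condition compatible with degrees.\<close>

definition gkm_hom :: "nat \<Rightarrow> ('g \<Rightarrow> 'v \<Rightarrow> complex) \<Rightarrow> bool" where
  "gkm_hom d p \<longleftrightarrow> (\<forall>v\<in>carrier W. hpoly d (p v) \<and>
     (\<forall>\<alpha>\<in>R. \<forall>x\<in>t. \<alpha> x = 0 \<longrightarrow> p (s \<alpha> \<otimes> v) x = p v x))"

lemma gkm_hom_imp_gkm: "gkm_hom d p \<Longrightarrow> gkm p"
  unfolding gkm_hom_def gkm_def using hpoly_imp_pol by blast

lemma gkm_hom_cong:
  assumes "gkm_hom d p" "\<And>v x. v \<in> carrier W \<Longrightarrow> x \<in> t \<Longrightarrow> q v x = p v x"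
  shows "gkm_hom d q"
  using assms s_closed unfolding gkm_hom_def by (auto elim!: hpoly_cong)

lemma gkm_cong:
  assumes "gkm p" "\<And>v x. v \<in> carrier W \<Longrightarrow> x \<in> t \<Longrightarrow> q v x = p v x"
  shows "gkm q"
  using assms s_closed unfolding gkm_def by (auto elim!: pol_cong)

lemma gkm_hom_zero: "gkm_hom d (\<lambda>v x. 0)"
  by (auto simp: gkm_hom_def intro: hpoly_zero)

lemma gkm_hom_add: "gkm_hom d p \<Longrightarrow> gkm_hom d q \<Longrightarrow> gkm_hom d (\<lambda>v x. p v x + q v x)"
  unfolding gkm_hom_def by (auto intro: hpoly_add)

lemma gkm_hom_mult_const: "gkm_hom d p \<Longrightarrow> gkm_hom d (\<lambda>v x. c * p v x)"
  unfolding gkm_hom_def by (auto intro: hpoly_mult_const)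

lemma gkm_hom_lin: "lin l \<Longrightarrow> gkm_hom d p \<Longrightarrow> gkm_hom (Suc d) (\<lambda>v x. l x * p v x)"
  unfolding gkm_hom_def by (auto intro: hpoly_lin_mult)

lemma gkm_hom_const: "hpoly d f \<Longrightarrow> gkm_hom d (\<lambda>v. f)"
  unfolding gkm_hom_def by auto

lemma gkm_add: "gkm p \<Longrightarrow> gkm q \<Longrightarrow> gkm (\<lambda>v x. p v x + q v x)"
  unfolding gkm_def by (auto intro: pol_add)

lemma gkm_pol_mult: "pol f \<Longrightarrow> gkm p \<Longrightarrow> gkm (\<lambda>v x. f x * p v x)"
  unfolding gkm_def by (auto intro: pol_mult)

lemma gkm_mult: "gkm p \<Longrightarrow> gkm q \<Longrightarrow> gkm (\<lambda>v x. p v x * q v x)"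
  unfolding gkm_def by (auto intro: pol_mult)

lemma gkm_const: "pol f \<Longrightarrow> gkm (\<lambda>v. f)"
  unfolding gkm_def by auto

lemma gkm_sum: "finite I \<Longrightarrow> (\<And>i. i \<in> I \<Longrightarrow> gkm (p i)) \<Longrightarrow> gkm (\<lambda>v x. \<Sum>i\<in>I. p i v x)"
  by (induction I rule: finite_induct) (auto intro: gkm_add gkm_const pol_const)

lemma gkm_hom_star:
  assumes "gkm_hom d p" "w \<in> carrier W" shows "gkm_hom d (\<lambda>v. p (v \<otimes> w))"
  using assms s_closed unfolding gkm_hom_def by (auto simp: m_assoc)

lemma gkm_star:
  assumes "gkm p" "w \<in> carrier W" shows "gkm (\<lambda>v. p (v \<otimes> w))"
  using assms s_closed unfolding gkm_def by (auto simp: m_assoc)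

text \<open>A root hyperplane is a cone, so on it the congruence can be compared along each line
  through the origin, degree by degree.\<close>

lemma gkm_components:
  assumes "gkm p"
  obtains n c where "\<And>i. gkm_hom i (c i)"
    "\<And>v x. v \<in> carrier W \<Longrightarrow> x \<in> t \<Longrightarrow> p v x = (\<Sum>i\<le>n. c i v x)"
proof -
  have "\<forall>v\<in>carrier W. \<exists>n c. (\<forall>i. hpoly i (c i)) \<and> (\<forall>m\<ge>n. \<forall>x\<in>t. p v x = (\<Sum>i\<le>m. c i x))"
  proof
    fix v assume "v \<in> carrier W"
    then have "pol (p v)" using assms by (auto simp: gkm_def)
    from polE[OF this] show "\<exists>n c. (\<forall>i. hpoly i (c i)) \<and> (\<forall>m\<ge>n. \<forall>x\<in>t. p v x = (\<Sum>i\<le>m. c i x))"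
      by metis
  qed
  then obtain n c where c: "\<And>v i. v \<in> carrier W \<Longrightarrow> hpoly i (c v i)"
    "\<And>v m x. v \<in> carrier W \<Longrightarrow> m \<ge> n v \<Longrightarrow> x \<in> t \<Longrightarrow> p v x = (\<Sum>i\<le>m. c v i x)"
    unfolding bchoice_iff by blast
  define m where "m = Max (n ` carrier W)"
  have m: "v \<in> carrier W \<Longrightarrow> m \<ge> n v" for v using finite_W by (auto simp: m_def)
  \<comment> \<open>Above the common bound \<open>m\<close> nothing relates the components at
    different \<open>v\<close>, and they are replaced by 0.\<close>
  define c' where "c' = (\<lambda>i v x. if i \<le> m then c v i x else 0)"
  have h: "v \<in> carrier W \<Longrightarrow> hpoly i (c' i v)" for i v
    using c(1) by (cases "i \<le> m") (auto simp: c'_def intro: hpoly_zero)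
  have "gkm_hom i (c' i)" for i
    unfolding gkm_hom_def
  proof (intro ballI conjI impI)
    fix v \<alpha> x assume vax: "v \<in> carrier W" "\<alpha> \<in> R" "x \<in> t" "\<alpha> x = 0"
    then have sv: "s \<alpha> \<otimes> v \<in> carrier W" using s_closed by auto
    show "c' i (s \<alpha> \<otimes> v) x = c' i v x"
    proof (cases "i \<le> m")
      case True
      have "c (s \<alpha> \<otimes> v) i x = c v i x"
      proof (rule hpoly_components_unique[OF _ _ vax(3,3) _ True])
        fix z
        have "z *z x \<in> t" "\<alpha> (z *z x) = 0" using vax lin_scale[OF R_lin[OF vax(2)] vax(3)] by auto
        then have "p (s \<alpha> \<otimes> v) (z *z x) = p v (z *z x)" using assms vax by (auto simp: gkm_def)
        then show "(\<Sum>i\<le>m. c (s \<alpha> \<otimes> v) i (z *z x)) = (\<Sum>i\<le>m. c v i (z *z x))"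
          using c(2)[OF sv m[OF sv] \<open>z *z x \<in> t\<close>] c(2)[OF vax(1) m[OF vax(1)] \<open>z *z x \<in> t\<close>] by simp
      qed (use c(1) sv vax in auto)
      then show ?thesis by (simp add: c'_def)
    qed (simp add: c'_def)
  qed (use h in auto)
  then show ?thesis
    using c(2) m by (intro that[of c' m]) (auto simp: c'_def)
qed

text \<open>Every root vanishes at the origin, so the congruences force equal values there along the
  generators of \<open>W\<close>.\<close>

lemma gkm_hom_0_constant:
  assumes "gkm_hom 0 p"
  shows "\<exists>c. \<forall>v\<in>carrier W. \<forall>x\<in>t. p v x = c"
proof -
  have 0: "p v x = p v 0" if "v \<in> carrier W" "x \<in> t" for v x
    using hpoly_0D[of 0 "p v"] assms that by (force simp: gkm_hom_def)
  have "p w 0 = p \<one> 0" if "w \<in> carrier W" for w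
    using that
  proof (induction rule: generate_induct)
    case (step \<alpha> w)
    then show ?case using assms lin_0[OF R_lin, of \<alpha>] by (auto simp: gkm_hom_def)
  qed simp
  with 0 show ?thesis by metis
qed

text \<open>By \<open>s_conjugate\<close> the position \<open>v \<otimes> s \<alpha>\<close> is
  \<open>s \<beta> \<otimes> v\<close> with \<open>v\<alpha>\<close> proportional to \<beta>, so the
  difference vanishes where \<open>v\<alpha>\<close> does and can be divided. The work is to see
  that the quotients satisfy the congruences again, and it depends on whether the root of the
  congruence is proportional to \<open>v\<alpha>\<close>.\<close>

lemma divided_difference:
  assumes p: "gkm_hom (Suc d) p" and \<alpha>: "\<alpha> \<in> R"
  shows "\<exists>q. gkm_hom d q \<and>
    (\<forall>v\<in>carrier W. \<forall>x\<in>t. p v x - p (v \<otimes> s \<alpha>) x = \<alpha> (a (inv v) x) * q v x)"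
proof -
  have "\<exists>r. hpoly d r \<and> (\<forall>x\<in>t. p v x - p (v \<otimes> s \<alpha>) x = \<alpha> (a (inv v) x) * r x)"
    if v: "v \<in> carrier W" for v
  proof -
    obtain \<beta> c where b: "\<beta> \<in> R" "c \<noteq> 0" "\<And>x. x \<in> t \<Longrightarrow> \<alpha> (a (inv v) x) = c * \<beta> x" "v \<otimes> s \<alpha> = s \<beta> \<otimes> v"
      using s_conjugate[OF \<alpha> v] by metis
    have hp: "hpoly (Suc d) (\<lambda>x. p v x - p (s \<beta> \<otimes> v) x)"
      using p v b s_closed by (auto simp: gkm_hom_def intro: hpoly_diff)
    obtain k where k: "k \<in> t" "\<beta> k = 1" using root_half[OF b(1)] by blast
    obtain r where r: "hpoly d r" "\<forall>x\<in>t. p v x - p (s \<beta> \<otimes> v) x = \<beta> x * r x"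
      using hpoly_divisible[OF hp R_lin[OF b(1)] k] p v b(1) by (auto simp: gkm_hom_def)
    have "hpoly d (\<lambda>x. (1 / c) * r x)" using r hpoly_mult_const by blast
    then show ?thesis
      by (rule exI[of _ "\<lambda>x. (1 / c) * r x", OF conjI]) (use r b in auto)
  qed
  then have "\<forall>v\<in>carrier W. \<exists>r. hpoly d r \<and> (\<forall>x\<in>t. p v x - p (v \<otimes> s \<alpha>) x = \<alpha> (a (inv v) x) * r x)"
    by blast
  then obtain q where q: "\<And>v. v \<in> carrier W \<Longrightarrow> hpoly d (q v)"
    "\<And>v x. v \<in> carrier W \<Longrightarrow> x \<in> t \<Longrightarrow> p v x - p (v \<otimes> s \<alpha>) x = \<alpha> (a (inv v) x) * q v x"
    unfolding bchoice_iff by blast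
  have "q (s \<beta> \<otimes> v) x = q v x" if v: "v \<in> carrier W" and \<beta>: "\<beta> \<in> R" and x: "x \<in> t" "\<beta> x = 0" for v \<beta> x
  proof -
    have sv: "s \<beta> \<otimes> v \<in> carrier W" using s_closed \<beta> v by auto
    define va where "va = (\<lambda>x. \<alpha> (a (inv v) x))"
    have va: "lin va" unfolding va_def using lin_root_a[OF \<alpha>, of "inv v"] v by auto
    obtain \<beta>' c' where b': "\<beta>' \<in> R" "c' \<noteq> 0" "\<And>x. x \<in> t \<Longrightarrow> va x = c' * \<beta>' x" "v \<otimes> s \<alpha> = s \<beta>' \<otimes> v"
      unfolding va_def using s_conjugate[OF \<alpha> v] by metis
    show ?thesis
    proof (cases "\<exists>y\<in>t. \<beta> y = 0 \<and> va y \<noteq> 0")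
      case True
      then obtain y where y: "y \<in> t" "\<beta> y = 0" "va y \<noteq> 0" by blast
      \<comment> \<open>On the hyperplane of \<beta> both the divisors and the differences of
        \<open>p\<close> agree for \<open>v\<close> and \<open>s \<beta> \<otimes> v\<close>. As
        \<open>va\<close> is not identically zero on this hyperplane, it cancels there.\<close>
      have "(\<lambda>x. q (s \<beta> \<otimes> v) x - q v x) x = 0"
      proof (rule pol_zero_product[of _ va "{x\<in>t. \<beta> x = 0}" y])
        show "pol (\<lambda>x. q (s \<beta> \<otimes> v) x - q v x)"
          by (intro pol_diff hpoly_imp_pol[OF q(1)] sv v)
        show "x + z *z (y - x) \<in> {x \<in> t. \<beta> x = 0}" if "x \<in> {x \<in> t. \<beta> x = 0}" "y \<in> {x \<in> t. \<beta> x = 0}" for x y z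
          using that R_lin[OF \<beta>] by (auto simp: lin_add lin_diff lin_scale)
        show "(q (s \<beta> \<otimes> v) x - q v x) * va x = 0" if "x \<in> {x \<in> t. \<beta> x = 0}" for x
        proof -
          have x: "x \<in> t" "\<beta> x = 0" using that by auto
          have "a (inv (s \<beta> \<otimes> v)) x = a (inv v) (a (s \<beta>) x)"
            using v \<beta> s_closed x by (simp add: inv_mult_group s_inv a_mult)
          then have "\<alpha> (a (inv (s \<beta> \<otimes> v)) x) = va x" using x \<beta> by (simp add: a_s_fix va_def)
          moreover have "p (s \<beta> \<otimes> v) x = p v x" "p (s \<beta> \<otimes> v \<otimes> s \<alpha>) x = p (v \<otimes> s \<alpha>) x"
            using p x \<beta> v \<alpha> s_closed by (auto simp: gkm_hom_def m_assoc)
          ultimately have "va x * q (s \<beta> \<otimes> v) x = va x * q v x"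
            using q(2)[OF v x(1)] q(2)[OF sv x(1)] by (auto simp: va_def)
          then show ?thesis by (auto simp: algebra_simps)
        qed
      qed (use x y pol_lin va in auto)
      then show ?thesis by simp
    next
      case False
      \<comment> \<open>Now \<open>va\<close> vanishes on the kernel of \<beta> and is a multiple of
        it. Half the coroot has \<beta>-value 1 and reads off the factor.\<close>
      define k where "k = (1/2) *z h \<beta>"
      have k: "k \<in> t" "\<beta> k = 1" using root_half[OF \<beta>] by (auto simp: k_def)
      have vab: "va x = va k * \<beta> x" if "x \<in> t" for x
      proof -
        have "x - \<beta> x *z k \<in> t" "\<beta> (x - \<beta> x *z k) = 0"
          using that k R_lin[OF \<beta>] by (auto simp: lin_diff lin_scale)
        then have "va (x - \<beta> x *z k) = 0" using False by auto
        then show ?thesis using lin_diff[OF va that, of "\<beta> x *z k"] lin_scale[OF va k(1)] k by (auto simp: mult.commute)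
      qed
      have b'b: "\<beta>' x = (va k / c') * \<beta> x" if "x \<in> t" for x
        using vab[OF that] b'(3)[OF that] b'(2) by (simp add: field_simps)
      \<comment> \<open>Proportional roots have the same reflection: a multiple of the coroot of
        \<open>\<beta>'\<close> is a coroot of \<beta>.\<close>
      have "s \<beta>' = s \<beta>"
      proof (rule reflection_unique[OF \<beta>])
        show "a (s \<beta>') x = x - \<beta> x *z ((va k / c') *z h \<beta>')" if "x \<in> t" for x
          using a_s[OF b'(1) that] b'b[OF that] by (simp add: mult.commute)
        show "\<beta> ((va k / c') *z h \<beta>') = 2"
          using b'b[OF h_closed[OF b'(1)]] root_coroot[OF b'(1)] lin_scale[OF R_lin[OF \<beta>] h_closed[OF b'(1)]] by simp
      qed (use s_closed h_closed b' in auto)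
      then have eq: "s \<beta> \<otimes> v = v \<otimes> s \<alpha>" using b' by simp
      \<comment> \<open>Passing from \<open>v\<close> to \<open>v \<otimes> s \<alpha>\<close>
        changes the sign of \<open>va\<close> and of the difference of \<open>p\<close>, so the
        quotients agree on all of \<open>t\<close>.\<close>
      have "(\<lambda>x. q (s \<beta> \<otimes> v) x - q v x) x = 0"
      proof (rule pol_zero_product_t[of _ va])
        show "pol (\<lambda>x. q (s \<beta> \<otimes> v) x - q v x)"
          by (intro pol_diff hpoly_imp_pol[OF q(1)] sv v)
        show "(q (s \<beta> \<otimes> v) x - q v x) * va x = 0" if x: "x \<in> t" for x
        proof -
          have ax: "a (inv v) x \<in> t" using v x a_closed by auto
          have "a (inv (v \<otimes> s \<alpha>)) x = a (s \<alpha>) (a (inv v) x)"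
            using v \<alpha> s_closed x by (simp add: inv_mult_group s_inv a_mult)
          then have "\<alpha> (a (inv (v \<otimes> s \<alpha>)) x) = - va x"
            using a_s[OF \<alpha> ax] lin_diff[OF R_lin[OF \<alpha>] ax] lin_scale[OF R_lin[OF \<alpha>] h_closed[OF \<alpha>]]
              root_coroot[OF \<alpha>] h_closed[OF \<alpha>] by (simp add: va_def)
          moreover have "v \<otimes> s \<alpha> \<otimes> s \<alpha> = v" using v \<alpha> s_closed s_s by (simp add: m_assoc)
          ultimately have "p (v \<otimes> s \<alpha>) x - p v x = - va x * q (v \<otimes> s \<alpha>) x"
            using q(2)[of "v \<otimes> s \<alpha>" x] v \<alpha> s_closed x by auto
          moreover have "p v x - p (v \<otimes> s \<alpha>) x = va x * q v x"
            using q(2)[OF v x] by (simp add: va_def)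
          ultimately have "va x * q v x = va x * q (v \<otimes> s \<alpha>) x" by (auto simp: algebra_simps)
          then show ?thesis by (auto simp: eq algebra_simps)
        qed
        show "a v (h \<alpha>) \<in> t" using v \<alpha> h_closed a_closed by auto
        show "va (a v (h \<alpha>)) \<noteq> 0"
          using a_inv_cancel(1)[OF v h_closed[OF \<alpha>]] root_coroot[OF \<alpha>] by (simp add: va_def)
      qed (use x pol_lin va in auto)
      then show ?thesis by simp
    qed
  qed
  with q have "gkm_hom d q" by (auto simp: gkm_hom_def)
  with q(2) show ?thesis by blast
qed


text \<open>The degree \<open>d\<close> part of the ideal generated by the linear functionals.\<close>

inductive decomp :: "nat \<Rightarrow> ('g \<Rightarrow> 'v \<Rightarrow> complex) \<Rightarrow> bool" where
  decomp_zero: "(\<And>v x. v \<in> carrier W \<Longrightarrow> x \<in> t \<Longrightarrow> p v x = 0) \<Longrightarrow> decomp d p"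
| decomp_step: "lin l \<Longrightarrow> gkm_hom d p \<Longrightarrow> decomp (Suc d) q \<Longrightarrow>
    (\<And>v x. v \<in> carrier W \<Longrightarrow> x \<in> t \<Longrightarrow> r v x = l x * p v x + q v x) \<Longrightarrow> decomp (Suc d) r"

lemma decomp_gkm_hom: "decomp d p \<Longrightarrow> gkm_hom d p"
proof (induction rule: decomp.induct)
  case (decomp_zero p d)
  show ?case by (rule gkm_hom_cong[OF gkm_hom_zero decomp_zero])
next
  case (decomp_step l d p q r)
  show ?case
    by (rule gkm_hom_cong[OF gkm_hom_add[OF gkm_hom_lin[OF decomp_step.hyps(1,2)] decomp_step.IH]
          decomp_step.hyps(4)])
qed

text \<open>An operation that is additive, commutes with multiplication by linear forms and raises
  degrees by \<open>k\<close> carries multiples of linear forms to such multiples. It is used for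
  scalars and translations with \<open>k = 0\<close> and for multiplication by
  \<open>v\<alpha>\<close> with \<open>k = 1\<close>.\<close>

lemma decomp_map:
  assumes "decomp d p"
    and zero: "\<And>q v x. (\<And>v x. v \<in> carrier W \<Longrightarrow> x \<in> t \<Longrightarrow> q v x = 0) \<Longrightarrow> v \<in> carrier W \<Longrightarrow> x \<in> t \<Longrightarrow> F q v x = 0"
    and step: "\<And>r l p q v x. (\<And>v x. v \<in> carrier W \<Longrightarrow> x \<in> t \<Longrightarrow> r v x = l x * p v x + q v x) \<Longrightarrow>
      v \<in> carrier W \<Longrightarrow> x \<in> t \<Longrightarrow> F r v x = l x * F p v x + F q v x"
    and hom: "\<And>d p. gkm_hom d p \<Longrightarrow> gkm_hom (d + k) (F p)"
  shows "decomp (d + k) (F p)"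
  using assms(1)
proof (induction rule: decomp.induct)
  case (decomp_zero p d)
  show ?case by (rule decomp.decomp_zero, rule zero[OF decomp_zero])
next
  case (decomp_step l d p q r)
  from decomp.decomp_step[OF decomp_step.hyps(1) hom[OF decomp_step.hyps(2)] _ step[OF decomp_step.hyps(4)]]
    decomp_step.IH
  show ?case by simp
qed

lemma decomp_cong:
  assumes "decomp d p" "\<And>v x. v \<in> carrier W \<Longrightarrow> x \<in> t \<Longrightarrow> q v x = p v x"
  shows "decomp d q"
  using assms
proof (cases rule: decomp.cases)
  case decomp_zero
  then show ?thesis using assms(2) by (auto intro: decomp.decomp_zero)
next
  case (decomp_step l d p' q' )
  have "decomp (Suc d) q"
    by (rule decomp.decomp_step[OF decomp_step(2-4)]) (use decomp_step(5) assms(2) in auto)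
  then show ?thesis by (simp only: decomp_step(1))
qed

lemma decomp_add: "decomp d p \<Longrightarrow> decomp d q \<Longrightarrow> decomp d (\<lambda>v x. p v x + q v x)"
proof (induction arbitrary: q rule: decomp.induct)
  case (decomp_zero p d)
  show ?case by (rule decomp_cong[OF decomp_zero.prems]) (use decomp_zero in auto)
next
  case (decomp_step l d p q r q')
  show ?case
    by (rule decomp.decomp_step[OF decomp_step.hyps(1,2) decomp_step.IH[OF decomp_step.prems]])
       (simp add: decomp_step.hyps(4))
qed

lemma decomp_mult_const: "decomp d p \<Longrightarrow> decomp d (\<lambda>v x. c * p v x)"
  using decomp_map[of d p "\<lambda>p v x. c * p v x" 0] gkm_hom_mult_const[of _ _ c]
  by (simp add: algebra_simps)

lemma decomp_star:
  assumes "w \<in> carrier W" "decomp d p" shows "decomp d (\<lambda>v. p (v \<otimes> w))"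
  using decomp_map[OF assms(2), of "\<lambda>p v. p (v \<otimes> w)" 0] gkm_hom_star[OF _ assms(1)] assms(1) by simp

lemma decomp_sum:
  "finite I \<Longrightarrow> (\<And>i. i \<in> I \<Longrightarrow> decomp d (p i)) \<Longrightarrow> decomp d (\<lambda>v x. \<Sum>i\<in>I. p i v x)"
  by (induction I rule: finite_induct) (auto intro: decomp_zero decomp_add)

text \<open>A reflection fixes its hyperplane pointwise, so the tuple of the functionals
  \<open>v\<alpha>\<close> itself satisfies the congruences, and multiplication by it preserves
  them.\<close>

lemma gkm_hom_root:
  assumes "gkm_hom d p" "\<alpha> \<in> R"
  shows "gkm_hom (Suc d) (\<lambda>v x. \<alpha> (a (inv v) x) * p v x)"
  unfolding gkm_hom_def
proof (intro ballI conjI impI)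
  fix v assume v: "v \<in> carrier W"
  show "hpoly (Suc d) (\<lambda>x. \<alpha> (a (inv v) x) * p v x)"
    using assms v lin_root_a[OF assms(2), of "inv v"] by (auto intro: hpoly_lin_mult simp: gkm_hom_def)
  fix \<beta> x assume bx: "\<beta> \<in> R" "x \<in> t" "\<beta> x = 0"
  have "a (inv (s \<beta> \<otimes> v)) x = a (inv v) (a (s \<beta>) x)"
    using v bx s_closed by (simp add: inv_mult_group s_inv a_mult)
  then show "\<alpha> (a (inv (s \<beta> \<otimes> v)) x) * p (s \<beta> \<otimes> v) x = \<alpha> (a (inv v) x) * p v x"
    using bx v assms by (simp add: a_s_fix gkm_hom_def)
qed

lemma decomp_root:
  assumes "\<alpha> \<in> R" "decomp d p"
  shows "decomp (Suc d) (\<lambda>v x. \<alpha> (a (inv v) x) * p v x)"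
  using decomp_map[OF assms(2), of "\<lambda>p v x. \<alpha> (a (inv v) x) * p v x" 1] gkm_hom_root[OF _ assms(1)]
  by (simp add: algebra_simps)

lemma decomp_const:
  assumes "hpoly d f" "d > 0"
  shows "decomp d (\<lambda>v. f)"
  using assms
proof (induction rule: hpoly.induct)
  case (hpoly_step l d g k f)
  show ?case
    by (rule decomp_step[OF hpoly_step.hyps(1) gkm_hom_const[OF hpoly_step.hyps(2)] hpoly_step.IH(2)])
       (use hpoly_step.hyps(4) in auto)
qed (auto intro: decomp_zero)

lemma sum_translate:
  fixes f :: "'g \<Rightarrow> complex"
  assumes "v \<in> carrier W"
  shows "(\<Sum>w\<in>carrier W. f (v \<otimes> w)) = (\<Sum>w\<in>carrier W. f w)"
  by (rule sum.reindex_bij_witness[of _ "\<lambda>w. inv v \<otimes> w" "\<lambda>w. v \<otimes> w"])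
     (use assms in \<open>auto simp flip: m_assoc\<close>)

lemma card_W: "of_nat (card (carrier W)) \<noteq> (0 :: complex)"
  using finite_W one_closed by (simp add: card_eq_0_iff) blast

text \<open>Modulo decomposable elements, \<open>p\<close> equals its average over \<open>W\<close>, which is a constant tuple
  of positive degree.\<close>

lemma decomp_if_invariant:
  assumes p: "gkm_hom d p" "d > 0"
    and inv: "\<And>\<alpha>. \<alpha> \<in> R \<Longrightarrow> decomp d (\<lambda>v x. p v x - p (v \<otimes> s \<alpha>) x)"
  shows "decomp d p"
proof -
  have "decomp d (\<lambda>v x. p v x - p (v \<otimes> w) x)" if "w \<in> carrier W" for w
    using that
  proof (induction rule: generate_induct)
    case one
    show ?case by (rule decomp_zero) simp
  next
    case (step \<alpha> w)
    \<comment> \<open>Telescoping: this difference is the translate by \<open>s \<alpha>\<close> of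
      the one for \<open>w\<close>, and decomposable tuples are stable under translation.\<close>
    have "decomp d (\<lambda>v x. p (v \<otimes> s \<alpha>) x - p (v \<otimes> s \<alpha> \<otimes> w) x)"
      using decomp_star[OF s_closed[OF step(1)] step(3)] .
    from decomp_add[OF inv[OF step(1)] this] show ?case
      by (rule decomp_cong) (use step s_closed in \<open>simp add: m_assoc\<close>)
  qed
  then have 1: "decomp d (\<lambda>v x. \<Sum>w\<in>carrier W. p v x - p (v \<otimes> w) x)"
    by (intro decomp_sum finite_W)
  have "hpoly d (\<lambda>x. \<Sum>w\<in>carrier W. p w x)"
    by (intro hpoly_sum finite_W) (use p in \<open>auto simp: gkm_hom_def\<close>)
  then have 2: "decomp d (\<lambda>v x. \<Sum>w\<in>carrier W. p w x)" using p(2) by (rule decomp_const)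
  have "decomp d (\<lambda>v x. of_nat (card (carrier W)) * p v x)"
    by (rule decomp_cong[OF decomp_add[OF 1 2]])
       (simp add: sum_subtractf sum_translate[of _ "\<lambda>w. p w _"])
  from decomp_mult_const[OF this, of "1 / of_nat (card (carrier W))"] show ?thesis
    using card_W by simp
qed

text \<open>A variant of Chevalley's lemma on homogeneous relations.\<close>

lemma leading_term_decomp:
  assumes y: "y \<in> t" "\<And>\<alpha>. \<alpha> \<in> R \<Longrightarrow> \<alpha> y \<noteq> 0"
  shows "(\<And>i. i \<le> d \<Longrightarrow> gkm_hom i (p i)) \<Longrightarrow> (\<And>v. v \<in> carrier W \<Longrightarrow> (\<Sum>i\<le>d. p i v y) = 0) \<Longrightarrow>
    decomp d (p d)"
proof (induction d arbitrary: p)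
  case 0
  obtain c where c: "\<forall>v\<in>carrier W. \<forall>x\<in>t. p 0 v x = c" using gkm_hom_0_constant[OF 0(1)[OF order_refl]] by blast
  then have "c = 0" using 0(2)[of \<one>] y by auto
  with c show ?case by (auto intro: decomp_zero)
next
  case (Suc d)
  show ?case
  proof (rule decomp_if_invariant)
    fix \<alpha> assume \<alpha>: "\<alpha> \<in> R"
    have "\<forall>i\<in>{..d}. \<exists>q. gkm_hom i q \<and> (\<forall>v\<in>carrier W. \<forall>x\<in>t.
        p (Suc i) v x - p (Suc i) (v \<otimes> s \<alpha>) x = \<alpha> (a (inv v) x) * q v x)"
      using divided_difference[OF Suc.prems(1) \<alpha>] by auto
    then obtain q where q: "\<And>i. i \<le> d \<Longrightarrow> gkm_hom i (q i)" "\<And>i v x. i \<le> d \<Longrightarrow> v \<in> carrier W \<Longrightarrow> x \<in> t \<Longrightarrow>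
        p (Suc i) v x - p (Suc i) (v \<otimes> s \<alpha>) x = \<alpha> (a (inv v) x) * q i v x"
      unfolding bchoice_iff by auto
    \<comment> \<open>The quotients have degree one less, so the induction hypothesis applies once
      their sum vanishes at \<open>y\<close>.\<close>
    have "decomp d (q d)"
    proof (rule Suc.IH[OF q(1)])
      fix v assume v: "v \<in> carrier W"
      have vs: "v \<otimes> s \<alpha> \<in> carrier W" using v \<alpha> s_closed by auto
      obtain c where c: "\<forall>v\<in>carrier W. \<forall>x\<in>t. p 0 v x = c" using gkm_hom_0_constant[OF Suc.prems(1)] by blast
      \<comment> \<open>The degree 0 component is constant and drops out of the difference, which
        makes the shifted sum a difference of two relations at \<open>y\<close>. The factor in front
        is a nonzero multiple of a root at \<open>y\<close> and cancels.\<close>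
      have "\<alpha> (a (inv v) y) * (\<Sum>i\<le>d. q i v y) = (\<Sum>i\<le>d. p (Suc i) v y - p (Suc i) (v \<otimes> s \<alpha>) y)"
        using q(2)[OF _ v y(1)] by (simp add: sum_distrib_left)
      also have "\<dots> = (\<Sum>i\<le>Suc d. p i v y - p i (v \<otimes> s \<alpha>) y)"
        unfolding sum.atMost_Suc_shift using c v vs y by simp
      also have "\<dots> = 0" using Suc.prems(2)[OF v] Suc.prems(2)[OF vs] by (simp only: sum_subtractf) simp
      finally have "\<alpha> (a (inv v) y) * (\<Sum>i\<le>d. q i v y) = 0" .
      moreover obtain \<beta> c where "\<beta> \<in> R" "c \<noteq> 0" "\<And>x. x \<in> t \<Longrightarrow> \<alpha> (a (inv v) x) = c * \<beta> x"
        using s_conjugate[OF \<alpha> v] by metis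
      ultimately show "(\<Sum>i\<le>d. q i v y) = 0" using y by auto
    qed
    from decomp_root[OF \<alpha> this] show "decomp (Suc d) (\<lambda>v x. p (Suc d) v x - p (Suc d) (v \<otimes> s \<alpha>) x)"
      by (rule decomp_cong) (use q(2) in auto)
  qed (use Suc.prems in auto)
qed

section \<open>A graded stable complement of the decomposable tuples\<close>

definition complementary :: "nat \<Rightarrow> (('g \<Rightarrow> 'v \<Rightarrow> complex) \<Rightarrow> bool) \<Rightarrow> bool" where
  "complementary d H \<longleftrightarrow>
     (\<forall>p. H p \<longrightarrow> gkm_hom d p) \<and>
     (\<forall>p q. H p \<longrightarrow> H q \<longrightarrow> H (\<lambda>v x. p v x + q v x)) \<and>
     (\<forall>c p. H p \<longrightarrow> H (\<lambda>v x. c * p v x)) \<and>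
     (\<forall>w\<in>carrier W. \<forall>p. H p \<longrightarrow> H (\<lambda>v. p (v \<otimes> w))) \<and>
     (\<forall>p. H p \<longrightarrow> decomp d p \<longrightarrow> (\<forall>v\<in>carrier W. \<forall>x\<in>t. p v x = 0)) \<and>
     (\<forall>p. gkm_hom d p \<longrightarrow> (\<exists>k q. H k \<and> decomp d q \<and> (\<forall>v\<in>carrier W. \<forall>x\<in>t. p v x = k v x + q v x)))"

text \<open>Any linear projection will do, since equivariance is restored later by averaging. It is
  defined on the space of all tuples of functions, and no finiteness of dimension enters.\<close>

lemma decomp_projection:
  "\<exists>\<pi>. (\<forall>p. decomp d (\<pi> p)) \<and> (\<forall>p. decomp d p \<longrightarrow> \<pi> p = p) \<and>
    (\<forall>p q. \<pi> (\<lambda>v x. p v x + q v x) = (\<lambda>v x. \<pi> p v x + \<pi> q v x)) \<and>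
    (\<forall>c p. \<pi> (\<lambda>v x. c * p v x) = (\<lambda>v x. c * \<pi> p v x))"
proof -
  define sc where "sc = (\<lambda>c (p :: 'g \<Rightarrow> 'v \<Rightarrow> complex) v x. c * p v x)"
  interpret F: vector_space sc
    by unfold_locales (auto simp: sc_def algebra_simps plus_fun_def)
  interpret FF: vector_space_pair sc sc ..
  have "F.subspace {p. decomp d p}"
    unfolding F.subspace_def
    using decomp_zero[of "\<lambda>v x. 0"] decomp_add[of d] decomp_mult_const[of d]
    by (auto simp: sc_def plus_fun_def zero_fun_def)
  from FF.linear_exists_left_inverse_on[OF F.linear_id this]
  obtain \<pi> where "range \<pi> \<subseteq> {p. decomp d p}" "Vector_Spaces.linear sc sc \<pi>" "\<forall>p. decomp d p \<longrightarrow> \<pi> p = p"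
    by auto
  then show ?thesis
    using FF.linear_add[of \<pi>] FF.linear_scale[of \<pi>]
    by (intro exI[of _ \<pi>]) (auto simp: sc_def plus_fun_def)
qed

text \<open>Maschke's argument, with the division by the group order postponed: \<open>av\<close>
  multiplies decomposable tuples by the order of \<open>W\<close>, and the complement is its kernel
  in degree \<open>d\<close>.\<close>

lemma complementary_exists: "\<exists>H. complementary d H"
proof -
  obtain \<pi> where \<pi>: "\<And>p. decomp d (\<pi> p)" "\<And>p. decomp d p \<Longrightarrow> \<pi> p = p"
    "\<And>p q. \<pi> (\<lambda>v x. p v x + q v x) = (\<lambda>v x. \<pi> p v x + \<pi> q v x)"
    "\<And>c p. \<pi> (\<lambda>v x. c * p v x) = (\<lambda>v x. c * \<pi> p v x)"
    using decomp_projection[of d] by (elim exE conjE) (rule that, blast+)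
  have \<pi>_diff: "\<pi> (\<lambda>v x. p v x - q v x) = (\<lambda>v x. \<pi> p v x - \<pi> q v x)" for p q
    using \<pi>(3)[of p "\<lambda>v x. (-1) * q v x"] \<pi>(4)[of "-1" q] by simp
  \<comment> \<open>The projection sees values outside the group and outside \<open>t\<close>, which
    do not count. Tuples that agree where it matters differ by a decomposable one, and this is fixed
    by \<open>\<pi>\<close>.\<close>
  have \<pi>_cong: "\<pi> p v x = \<pi> q v x"
    if "\<And>v x. v \<in> carrier W \<Longrightarrow> x \<in> t \<Longrightarrow> p v x = q v x" "v \<in> carrier W" "x \<in> t" for p q v x
  proof -
    have "decomp d (\<lambda>v x. p v x - q v x)" by (rule decomp_zero) (simp add: that(1))
    from \<pi>(2)[OF this] have "\<pi> p v x - \<pi> q v x = p v x - q v x" by (simp add: \<pi>_diff fun_eq_iff)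
    then show ?thesis using that by simp
  qed
  define av where "av = (\<lambda>p v x. \<Sum>w\<in>carrier W. \<pi> (\<lambda>u. p (u \<otimes> inv w)) (v \<otimes> w) x)"
  have av_add: "av (\<lambda>v x. p v x + q v x) v x = av p v x + av q v x" for p q v x
    by (simp add: av_def \<pi>(3) sum.distrib)
  have av_diff: "av (\<lambda>v x. p v x - q v x) v x = av p v x - av q v x" for p q v x
    by (simp add: av_def \<pi>_diff sum_subtractf)
  have av_scale: "av (\<lambda>v x. c * p v x) v x = c * av p v x" for c p v x
    by (simp add: av_def \<pi>(4) sum_distrib_left)
  have av_dec: "decomp d (av p)" for p
    unfolding av_def by (intro decomp_sum finite_W decomp_star \<pi>(1))
  have av_id: "av p v x = of_nat (card (carrier W)) * p v x" if "decomp d p" "v \<in> carrier W" "x \<in> t" for p v x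
  proof -
    have "av p v x = (\<Sum>w\<in>carrier W. p (v \<otimes> w \<otimes> inv w) x)"
      unfolding av_def by (intro sum.cong refl) (simp add: \<pi>(2)[OF decomp_star[OF _ that(1)]])
    then show ?thesis using that by (simp add: m_assoc)
  qed
  have av_star: "av (\<lambda>v. p (v \<otimes> u)) v x = av p (v \<otimes> u) x"
    if uv: "u \<in> carrier W" "v \<in> carrier W" and x: "x \<in> t" for p u v x
  proof -
    have "av (\<lambda>v. p (v \<otimes> u)) v x = (\<Sum>w\<in>carrier W. \<pi> (\<lambda>v. p (v \<otimes> inv w \<otimes> u)) (v \<otimes> w) x)"
      by (simp add: av_def)
    \<comment> \<open>Replacing the summation index \<open>w\<close> by \<open>u \<otimes> w\<close>
      moves the translation past the average.\<close>
    also have "\<dots> = (\<Sum>w\<in>carrier W. \<pi> (\<lambda>v. p (v \<otimes> inv (u \<otimes> w) \<otimes> u)) (v \<otimes> (u \<otimes> w)) x)"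
      using sum_translate[OF uv(1), of "\<lambda>w. \<pi> (\<lambda>v. p (v \<otimes> inv w \<otimes> u)) (v \<otimes> w) x"] by simp
    also have "\<dots> = (\<Sum>w\<in>carrier W. \<pi> (\<lambda>v. p (v \<otimes> inv w)) (v \<otimes> u \<otimes> w) x)"
    proof (rule sum.cong[OF refl])
      fix w assume w: "w \<in> carrier W"
      show "\<pi> (\<lambda>v. p (v \<otimes> inv (u \<otimes> w) \<otimes> u)) (v \<otimes> (u \<otimes> w)) x = \<pi> (\<lambda>v. p (v \<otimes> inv w)) (v \<otimes> u \<otimes> w) x"
        using uv w x by (subst \<pi>_cong[of _ "\<lambda>v. p (v \<otimes> inv w)"]) (auto simp: inv_mult_group m_assoc)
    qed
    finally show ?thesis by (simp add: av_def)
  qed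
  define H where "H = (\<lambda>p. gkm_hom d p \<and> (\<forall>v\<in>carrier W. \<forall>x\<in>t. av p v x = 0))"
  have "complementary d H"
    unfolding complementary_def
  proof (intro conjI allI impI ballI)
    show "gkm_hom d p" if "H p" for p using that by (simp add: H_def)
    show "H (\<lambda>v x. p v x + q v x)" if "H p" "H q" for p q
      using that by (simp add: H_def gkm_hom_add av_add)
    show "H (\<lambda>v x. c * p v x)" if "H p" for c p
      using that by (simp add: H_def gkm_hom_mult_const av_scale)
    show "H (\<lambda>v. p (v \<otimes> w))" if "H p" "w \<in> carrier W" for p w
      using that by (simp add: H_def gkm_hom_star av_star)
    show "p v x = 0" if "H p" "decomp d p" "v \<in> carrier W" "x \<in> t" for p v x
      using that av_id[OF that(2-4)] card_W by (simp add: H_def)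
    fix p assume p: "gkm_hom d p"
    \<comment> \<open>Here the postponed division takes place: \<open>q\<close> is the image of
      \<open>p\<close> under the equivariant projection.\<close>
    define q where "q = (\<lambda>v x. (1 / of_nat (card (carrier W))) * av p v x)"
    have q: "decomp d q" unfolding q_def by (intro decomp_mult_const av_dec)
    have "av (\<lambda>v x. p v x - q v x) v x = 0" if "v \<in> carrier W" "x \<in> t" for v x
      using that av_id[OF q that] card_W by (simp add: av_diff q_def)
    moreover have "gkm_hom d (\<lambda>v x. p v x - q v x)"
      using gkm_hom_add[OF p gkm_hom_mult_const[OF decomp_gkm_hom[OF q], of "-1"]] by simp
    ultimately have "H (\<lambda>v x. p v x - q v x)" by (simp add: H_def)
    with q show "\<exists>k q. H k \<and> decomp d q \<and> (\<forall>v\<in>carrier W. \<forall>x\<in>t. p v x = k v x + q v x)"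
      by (intro exI[of _ "\<lambda>v x. p v x - q v x"] exI[of _ q]) auto
  qed
  then show ?thesis by (rule exI[of "complementary d" H])
qed


section \<open>Points off the root hyperplanes\<close>

lemma regular_point_exists: "\<exists>y\<in>t. \<forall>\<alpha>\<in>R. \<alpha> y \<noteq> 0"
proof -
  have "\<exists>y\<in>t. (\<Prod>\<alpha>\<in>R. \<alpha> y) \<noteq> 0"
  proof (rule pol_prod_nonzero[OF finite_R])
    show "pol \<alpha>" if "\<alpha> \<in> R" for \<alpha> using that R_lin pol_lin by blast
    show "\<exists>x\<in>t. \<alpha> x \<noteq> 0" if "\<alpha> \<in> R" for \<alpha>
      using h_closed[OF that] root_coroot[OF that] by (intro bexI[of _ "h \<alpha>"]) auto
  qed
  then show ?thesis using finite_R by auto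
qed

text \<open>Multiplied by the product of the roots, \<open>f\<close> vanishes everywhere, and the
  product cancels because it is not identically zero. This is the algebraic form of density of the
  regular points.\<close>

lemma pol_zero_if_zero_on_regular:
  assumes "pol f" "\<And>y. y \<in> t \<Longrightarrow> (\<And>\<alpha>. \<alpha> \<in> R \<Longrightarrow> \<alpha> y \<noteq> 0) \<Longrightarrow> f y = 0" "x \<in> t"
  shows "f x = 0"
proof -
  obtain y where y: "y \<in> t" "\<forall>\<alpha>\<in>R. \<alpha> y \<noteq> 0" using regular_point_exists by blast
  show ?thesis
  proof (rule pol_zero_product_t[OF assms(1) _ _ y(1) _ assms(3)])
    show "pol (\<lambda>x. \<Prod>\<alpha>\<in>R. \<alpha> x)" using finite_R R_lin pol_lin by (intro pol_prod) auto
    show "f x * (\<Prod>\<alpha>\<in>R. \<alpha> x) = 0" if "x \<in> t" for x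
      using assms(2)[OF that] finite_R by auto
    show "(\<Prod>\<alpha>\<in>R. \<alpha> y) \<noteq> 0" using y finite_R by auto
  qed
qed

text \<open>The product of the roots vanishes on every root hyperplane, so the congruences hold
  trivially. At a regular point the product is nonzero, which is how every function on
  \<open>W\<close> occurs as a value there.\<close>

lemma delta_gkm:
  assumes "u \<in> carrier W"
  shows "gkm (\<lambda>v x. if v = u then \<Prod>\<alpha>\<in>R. \<alpha> x else 0)"
  unfolding gkm_def
proof (intro ballI conjI impI)
  fix v
  have "pol (\<lambda>x. \<Prod>\<alpha>\<in>R. \<alpha> x)" using finite_R R_lin pol_lin by (intro pol_prod) auto
  then show "pol (\<lambda>x. if v = u then \<Prod>\<alpha>\<in>R. \<alpha> x else 0)" using pol_const[of 0] by (cases "v = u") auto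
  fix \<alpha> x assume "\<alpha> \<in> R" "x \<in> t" "\<alpha> x = 0"
  then have "(\<Prod>\<alpha>\<in>R. \<alpha> x) = 0" using finite_R by auto
  then show "(if s \<alpha> \<otimes> v = u then \<Prod>\<alpha>\<in>R. \<alpha> x else 0) = (if v = u then \<Prod>\<alpha>\<in>R. \<alpha> x else 0)" by simp
qed

section \<open>Harmonic tuples\<close>

definition gr_compl :: "nat \<Rightarrow> ('g \<Rightarrow> 'v \<Rightarrow> complex) \<Rightarrow> bool" where
  "gr_compl d = (SOME H. complementary d H)"

lemma complementary_gr_compl: "complementary d (gr_compl d)"
  unfolding gr_compl_def by (rule someI_ex[OF complementary_exists])

lemma gr_compl:
  shows gr_compl_gkm_hom: "gr_compl d p \<Longrightarrow> gkm_hom d p"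
    and gr_compl_add: "gr_compl d p \<Longrightarrow> gr_compl d q \<Longrightarrow> gr_compl d (\<lambda>v x. p v x + q v x)"
    and gr_compl_scale: "gr_compl d p \<Longrightarrow> gr_compl d (\<lambda>v x. c * p v x)"
    and gr_compl_star: "w \<in> carrier W \<Longrightarrow> gr_compl d p \<Longrightarrow> gr_compl d (\<lambda>v. p (v \<otimes> w))"
    and gr_compl_disjoint: "gr_compl d p \<Longrightarrow> decomp d p \<Longrightarrow> v \<in> carrier W \<Longrightarrow> x \<in> t \<Longrightarrow> p v x = 0"
    and gr_compl_sum: "gkm_hom d r \<Longrightarrow>
      \<exists>k q. gr_compl d k \<and> decomp d q \<and> (\<forall>v\<in>carrier W. \<forall>x\<in>t. r v x = k v x + q v x)"
proof -
  note c = complementary_gr_compl[of d, unfolded complementary_def]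
  note c1 = conjunct1[OF c] conjunct2[OF c]
  note c2 = conjunct1[OF c1(2)] conjunct2[OF c1(2)]
  note c3 = conjunct1[OF c2(2)] conjunct2[OF c2(2)]
  note c4 = conjunct1[OF c3(2)] conjunct2[OF c3(2)]
  note c5 = conjunct1[OF c4(2)] conjunct2[OF c4(2)]
  show "gr_compl d p \<Longrightarrow> gkm_hom d p" using c1(1) by blast
  show "gr_compl d p \<Longrightarrow> gr_compl d q \<Longrightarrow> gr_compl d (\<lambda>v x. p v x + q v x)"
    using c2(1) by blast
  show "gr_compl d p \<Longrightarrow> gr_compl d (\<lambda>v x. c * p v x)" using c3(1) by blast
  show "w \<in> carrier W \<Longrightarrow> gr_compl d p \<Longrightarrow> gr_compl d (\<lambda>v. p (v \<otimes> w))" using c4(1) by blast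
  show "gr_compl d p \<Longrightarrow> decomp d p \<Longrightarrow> v \<in> carrier W \<Longrightarrow> x \<in> t \<Longrightarrow> p v x = 0"
    using c5(1) by blast
  show "gkm_hom d r \<Longrightarrow> \<exists>k q. gr_compl d k \<and> decomp d q \<and>
      (\<forall>v\<in>carrier W. \<forall>x\<in>t. r v x = k v x + q v x)"
    using c5(2) by blast
qed

lemma gr_compl_zero: "gr_compl d (\<lambda>v x. 0)"
proof -
  obtain k where "gr_compl d k" using gr_compl_sum[OF gkm_hom_zero] by blast
  from gr_compl_scale[OF this, of 0] show ?thesis by simp
qed

text \<open>The sum of the chosen complements over all degrees. The name recalls the harmonic
  polynomials of a reflection group, which span a complement of the ideal generated by the
  invariants of positive degree.\<close>

definition harmonic :: "('g \<Rightarrow> 'v \<Rightarrow> complex) \<Rightarrow> bool" where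
  "harmonic p \<longleftrightarrow> (\<exists>n c. (\<forall>i. gr_compl i (c i)) \<and>
      (\<forall>v\<in>carrier W. \<forall>x\<in>t. p v x = (\<Sum>i\<le>n. c i v x)))"

lemma harmonic_gkm:
  assumes "harmonic p" shows "gkm p"
proof -
  obtain n c where c: "\<forall>i. gr_compl i (c i)" "\<forall>v\<in>carrier W. \<forall>x\<in>t. p v x = (\<Sum>i\<le>n. c i v x)"
    using assms unfolding harmonic_def by blast
  have "gkm (\<lambda>v x. \<Sum>i\<le>n. c i v x)"
    by (intro gkm_sum finite_atMost gkm_hom_imp_gkm[OF gr_compl_gkm_hom]) (rule c(1)[rule_format])
  then show ?thesis by (rule gkm_cong) (use c(2) in auto)
qed

lemma gr_compl_harmonic: "gr_compl d p \<Longrightarrow> harmonic p"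
  unfolding harmonic_def
  by (intro exI[of _ d] exI[of _ "\<lambda>i. if i = d then p else (\<lambda>v x. 0)"])
     (auto simp: gr_compl_zero if_distrib if_distribR cong: if_cong)

lemma harmonic_scale:
  assumes "harmonic p" shows "harmonic (\<lambda>v x. c * p v x)"
proof -
  obtain n k where "\<forall>i. gr_compl i (k i)" "\<forall>v\<in>carrier W. \<forall>x\<in>t. p v x = (\<Sum>i\<le>n. k i v x)"
    using assms unfolding harmonic_def by blast
  then show ?thesis unfolding harmonic_def
    by (intro exI[of _ n] exI[of _ "\<lambda>i v x. c * k i v x"]) (simp add: gr_compl_scale sum_distrib_left)
qed

lemma harmonic_star:
  assumes "w \<in> carrier W" "harmonic p" shows "harmonic (\<lambda>v. p (v \<otimes> w))"
proof -
  obtain n k where "\<forall>i. gr_compl i (k i)" "\<forall>v\<in>carrier W. \<forall>x\<in>t. p v x = (\<Sum>i\<le>n. k i v x)"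
    using assms unfolding harmonic_def by blast
  then show ?thesis using assms(1) unfolding harmonic_def
    by (intro exI[of _ n] exI[of _ "\<lambda>i v. k i (v \<otimes> w)"]) (simp add: gr_compl_star)
qed

lemma harmonic_add:
  assumes "harmonic p" "harmonic q" shows "harmonic (\<lambda>v x. p v x + q v x)"
proof -
  obtain n k where k: "\<And>i. gr_compl i (k i)" "\<And>v x. v \<in> carrier W \<Longrightarrow> x \<in> t \<Longrightarrow> p v x = (\<Sum>i\<le>n. k i v x)"
    using assms unfolding harmonic_def by blast
  obtain m l where l: "\<And>i. gr_compl i (l i)" "\<And>v x. v \<in> carrier W \<Longrightarrow> x \<in> t \<Longrightarrow> q v x = (\<Sum>i\<le>m. l i v x)"
    using assms unfolding harmonic_def by blast
  define k' where "k' = (\<lambda>i v x. if i \<le> n then k i v x else 0)"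
  define l' where "l' = (\<lambda>i v x. if i \<le> m then l i v x else 0)"
  have "gr_compl i (k' i)" for i
    using k gr_compl_zero by (cases "i \<le> n") (auto simp: k'_def)
  moreover have "gr_compl i (l' i)" for i
    using l gr_compl_zero by (cases "i \<le> m") (auto simp: l'_def)
  moreover have "(\<Sum>i\<le>n. k i v x) = (\<Sum>i\<le>max n m. k' i v x)" for v x
    unfolding k'_def by (rule sum.mono_neutral_cong_left) auto
  moreover have "(\<Sum>i\<le>m. l i v x) = (\<Sum>i\<le>max n m. l' i v x)" for v x
    unfolding l'_def by (rule sum.mono_neutral_cong_left) auto
  ultimately show ?thesis unfolding harmonic_def
    by (intro exI[of _ "max n m"] exI[of _ "\<lambda>i v x. k' i v x + l' i v x"])
       (simp add: gr_compl_add sum.distrib k(2) l(2))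
qed

lemma harmonic_zero: "harmonic (\<lambda>v x. 0)"
  using gr_compl_harmonic[OF gr_compl_zero] .

lemma harmonic_sum: "finite I \<Longrightarrow> (\<And>i. i \<in> I \<Longrightarrow> harmonic (p i)) \<Longrightarrow> harmonic (\<lambda>v x. \<Sum>i\<in>I. p i v x)"
  by (induction I rule: finite_induct) (auto intro: harmonic_zero harmonic_add)

text \<open>Components are removed from the top: the leading one is decomposable and lies in the
  complement, hence is zero, and the remaining sum still vanishes at \<open>y\<close>.\<close>

lemma harmonic_zero_if_zero_at_regular:
  assumes y: "y \<in> t" "\<And>\<alpha>. \<alpha> \<in> R \<Longrightarrow> \<alpha> y \<noteq> 0"
    and p: "harmonic p" "\<And>v. v \<in> carrier W \<Longrightarrow> p v y = 0" and v: "v \<in> carrier W" "x \<in> t"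
  shows "p v x = 0"
proof -
  have *: "(\<forall>v\<in>carrier W. (\<Sum>i\<le>n. c i v y) = 0) \<Longrightarrow> (\<Sum>i\<le>n. c i v x) = 0"
    if c: "\<And>i. gr_compl i (c i)" for n c
  proof (induction n)
    case 0
    have "decomp 0 (c 0)"
      by (rule leading_term_decomp[where y = y and d = 0 and p = c])
         (use y gr_compl_gkm_hom[OF c] 0 in auto)
    then show ?case using gr_compl_disjoint[OF c _ v] by simp
  next
    case (Suc n)
    have "decomp (Suc n) (c (Suc n))"
      by (rule leading_term_decomp[where y = y and d = "Suc n" and p = c])
         (use y gr_compl_gkm_hom[OF c] Suc.prems in auto)
    then have 0: "c (Suc n) v x = 0" if "v \<in> carrier W" "x \<in> t" for v x
      using gr_compl_disjoint[OF c _ that] by blast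
    with Suc y v show ?case by simp
  qed
  obtain n c where c: "\<And>i. gr_compl i (c i)" "\<And>v x. v \<in> carrier W \<Longrightarrow> x \<in> t \<Longrightarrow> p v x = (\<Sum>i\<le>n. c i v x)"
    using p(1) unfolding harmonic_def by blast
  show ?thesis using *[OF c(1), of n] c(2) y v p(2) by simp
qed

inductive harmonic_span :: "('g \<Rightarrow> 'v \<Rightarrow> complex) \<Rightarrow> bool" where
  harmonic_span_zero: "(\<And>v x. v \<in> carrier W \<Longrightarrow> x \<in> t \<Longrightarrow> p v x = 0) \<Longrightarrow> harmonic_span p"
| harmonic_span_step: "pol f \<Longrightarrow> harmonic p \<Longrightarrow> harmonic_span q \<Longrightarrow>
    (\<And>v x. v \<in> carrier W \<Longrightarrow> x \<in> t \<Longrightarrow> r v x = f x * p v x + q v x) \<Longrightarrow> harmonic_span r"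

lemma harmonic_span_lincomb:
  assumes "harmonic_span p" "pol f" "harmonic_span q"
    "\<And>v x. v \<in> carrier W \<Longrightarrow> x \<in> t \<Longrightarrow> r v x = f x * p v x + q v x"
  shows "harmonic_span r"
  using assms
proof (induction arbitrary: q r rule: harmonic_span.induct)
  case (harmonic_span_zero p q r)
  from harmonic_span_zero.prems(2) show ?case
  proof cases
    case z: harmonic_span_zero
    show ?thesis by (rule harmonic_span.harmonic_span_zero) (use harmonic_span_zero z in auto)
  next
    case h: (harmonic_span_step f' p' q')
    show ?thesis
      by (rule harmonic_span.harmonic_span_step[OF h(1-3)]) (use harmonic_span_zero h(4) in auto)
  qed
next
  case (harmonic_span_step g p' q' r' q r)
  have "harmonic_span (\<lambda>v x. f x * q' v x + q v x)"
    by (rule harmonic_span_step.IH[OF harmonic_span_step.prems(1,2)]) simp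
  from harmonic_span.harmonic_span_step[OF pol_mult[OF harmonic_span_step.prems(1) harmonic_span_step.hyps(1)]
      harmonic_span_step.hyps(2) this]
  show ?case using harmonic_span_step.hyps(4) harmonic_span_step.prems(3) by (simp add: algebra_simps)
qed

text \<open>Graded Nakayama: once the part in the complement is subtracted, what is left is built
  from multiples of tuples of smaller degree by linear forms.\<close>

lemma gkm_hom_harmonic_span: "gkm_hom d p \<Longrightarrow> harmonic_span p"
proof (induction d arbitrary: p rule: less_induct)
  case (less d)
  obtain k q where kq: "gr_compl d k" "decomp d q" "\<forall>v\<in>carrier W. \<forall>x\<in>t. p v x = k v x + q v x"
    using gr_compl_sum[OF less.prems] by blast
  have "harmonic_span q"
    using kq(2) less.IH
  proof (induction rule: decomp.induct)
    case (decomp_zero p d)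
    then show ?case by (auto intro: harmonic_span_zero)
  next
    case (decomp_step l d p q r)
    have "harmonic_span p" "harmonic_span q" using decomp_step by auto
    from harmonic_span_lincomb[OF this(1) pol_lin[OF decomp_step.hyps(1)] this(2)]
    show ?case using decomp_step.hyps(4) by blast
  qed
  then show ?case
    by (rule harmonic_span_step[OF pol_const[of 1] gr_compl_harmonic[OF kq(1)]]) (use kq(3) in auto)
qed

lemma gkm_harmonic_span:
  assumes "gkm p" shows "harmonic_span p"
proof -
  obtain n c where c: "\<And>i. gkm_hom i (c i)"
    "\<And>v x. v \<in> carrier W \<Longrightarrow> x \<in> t \<Longrightarrow> p v x = (\<Sum>i\<le>n. c i v x)"
    using gkm_components[OF assms] by metis
  have "harmonic_span (\<lambda>v x. \<Sum>i\<le>m. c i v x)" for m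
  proof (induction m)
    case 0
    show ?case using gkm_hom_harmonic_span[OF c(1)[of 0]] by simp
  next
    case (Suc m)
    show ?case
      by (rule harmonic_span_lincomb[OF gkm_hom_harmonic_span[OF c(1)[of "Suc m"]] pol_const[of 1] Suc]) simp
  qed
  from harmonic_span_lincomb[OF this[of n] pol_const[of 1] harmonic_span_zero[of "\<lambda>v x. 0"], of p] c(2)
  show ?thesis by simp
qed

text \<open>Freezing the polynomial coefficients of a combination of harmonic tuples at
  \<open>y\<close> does not change its values at \<open>y\<close> and makes it harmonic.\<close>

lemma harmonic_with_values:
  assumes "gkm p" "y \<in> t"
  shows "\<exists>k. harmonic k \<and> (\<forall>v\<in>carrier W. k v y = p v y)"
  using gkm_harmonic_span[OF assms(1)]
proof induction
  case (harmonic_span_zero p)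
  then show ?case using harmonic_zero assms by force
next
  case (harmonic_span_step f p q r)
  then obtain k where "harmonic k" "\<forall>v\<in>carrier W. k v y = q v y" by blast
  then show ?case
    using harmonic_add[OF harmonic_scale[OF harmonic_span_step(2), of "f y"]] harmonic_span_step.hyps(4) assms
    by (intro exI[of _ "\<lambda>v x. f y * p v x + k v x"]) auto
qed

definition is_generator :: "('g \<Rightarrow> 'v \<Rightarrow> complex) \<Rightarrow> bool" where
  "is_generator e \<longleftrightarrow> gkm e \<and>
    (\<forall>p. gkm p \<longrightarrow> (\<exists>f. (\<forall>w\<in>carrier W. pol (f w)) \<and>
       (\<forall>v\<in>carrier W. \<forall>x\<in>t. p v x = (\<Sum>w\<in>carrier W. f w x * e (v \<otimes> w) x)))) \<and>
    (\<forall>f. (\<forall>w\<in>carrier W. pol (f w)) \<longrightarrow>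
       (\<forall>v\<in>carrier W. \<forall>x\<in>t. (\<Sum>w\<in>carrier W. f w x * e (v \<otimes> w) x) = 0) \<longrightarrow>
       (\<forall>w\<in>carrier W. \<forall>x\<in>t. f w x = 0))"

text \<open>At a regular point \<open>y\<close> evaluation identifies the harmonic tuples, \<open>W\<close>-equivariantly, with the
  functions on \<open>W\<close>; the preimage of the indicator function of \<open>1\<close> generates everything.\<close>

theorem is_generator_exists: "\<exists>e. is_generator e"
proof -
  obtain y where y: "y \<in> t" "\<And>\<alpha>. \<alpha> \<in> R \<Longrightarrow> \<alpha> y \<noteq> 0" using regular_point_exists by blast
  define \<Delta> where "\<Delta> = (\<Prod>\<alpha>\<in>R. \<alpha> y)"
  have \<Delta>: "\<Delta> \<noteq> 0" using y finite_R by (simp add: \<Delta>_def)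
  obtain k where k: "harmonic k" "\<And>v. v \<in> carrier W \<Longrightarrow> k v y = (if v = \<one> then \<Delta> else 0)"
    using harmonic_with_values[OF delta_gkm[OF one_closed] y(1)] by (auto simp: \<Delta>_def)
  \<comment> \<open>The tuple imitated by \<open>k\<close> has the product of the roots at the
    identity; dividing by its value at \<open>y\<close> normalizes this to 1.\<close>
  define e where "e = (\<lambda>v x. (1 / \<Delta>) * k v x)"
  have e: "harmonic e" unfolding e_def by (rule harmonic_scale[OF k(1)])
  have e_y: "e v y = (if v = \<one> then 1 else 0)" if "v \<in> carrier W" for v
    using k(2)[OF that] \<Delta> by (simp add: e_def)
  \<comment> \<open>At \<open>y\<close> only the term with \<open>v \<otimes> w = \<one>\<close>
    survives, so the values of a combination list its coefficients at inverted positions.\<close>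
  have ev: "(\<Sum>w\<in>carrier W. c w * e (v \<otimes> w) y) = c (inv v)" if v: "v \<in> carrier W" for c v
  proof -
    have "(\<Sum>w\<in>carrier W. c w * e (v \<otimes> w) y) = (\<Sum>w\<in>carrier W. if w = inv v then c w else 0)"
    proof (rule sum.cong[OF refl])
      fix w assume w: "w \<in> carrier W"
      have "v \<otimes> w = \<one> \<longleftrightarrow> w = inv v" using inv_equality[of v w] v w by auto
      then show "c w * e (v \<otimes> w) y = (if w = inv v then c w else 0)" using e_y v w by simp
    qed
    then show ?thesis using v finite_W by simp
  qed
  have hcomb: "harmonic (\<lambda>v x. \<Sum>w\<in>carrier W. c w * e (v \<otimes> w) x)" for c :: "'g \<Rightarrow> complex"
    by (intro harmonic_sum finite_W harmonic_scale harmonic_star e)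
  \<comment> \<open>Both sides are harmonic with equal values at \<open>y\<close>, and these values
    determine a harmonic tuple.\<close>
  have basis: "p v x = (\<Sum>w\<in>carrier W. p (inv w) y * e (v \<otimes> w) x)"
    if p: "harmonic p" and v: "v \<in> carrier W" "x \<in> t" for p v x
  proof -
    have "p v x + (-1) * (\<Sum>w\<in>carrier W. p (inv w) y * e (v \<otimes> w) x) = 0"
      by (rule harmonic_zero_if_zero_at_regular[where y = y and x = x and v = v and
            p = "\<lambda>v x. p v x + (-1) * (\<Sum>w\<in>carrier W. p (inv w) y * e (v \<otimes> w) x)"])
         (use y v ev harmonic_add[OF p harmonic_scale[OF hcomb[of "\<lambda>w. p (inv w) y"], of "-1"]] in auto)
    then show ?thesis by simp
  qed
  have "is_generator e"
    unfolding is_generator_def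
  proof (intro conjI allI impI)
    show "gkm e" using e harmonic_gkm by blast
    show "\<exists>f. (\<forall>w\<in>carrier W. pol (f w)) \<and>
       (\<forall>v\<in>carrier W. \<forall>x\<in>t. p v x = (\<Sum>w\<in>carrier W. f w x * e (v \<otimes> w) x))" if "gkm p" for p
      using gkm_harmonic_span[OF that]
    proof induction
      case (harmonic_span_zero p)
      then show ?case by (intro exI[of _ "\<lambda>w x. 0"]) (auto intro: pol_const)
    next
      case (harmonic_span_step g p q r)
      then obtain f where f: "\<forall>w\<in>carrier W. pol (f w)"
        "\<And>v x. v \<in> carrier W \<Longrightarrow> x \<in> t \<Longrightarrow> q v x = (\<Sum>w\<in>carrier W. f w x * e (v \<otimes> w) x)" by blast
      \<comment> \<open>The harmonic factor has constant coordinates, namely its values at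
        \<open>y\<close>; multiplied by \<open>g\<close> they are added to the coordinates of
        \<open>q\<close>.\<close>
      have "r v x = (\<Sum>w\<in>carrier W. (g x * p (inv w) y + f w x) * e (v \<otimes> w) x)"
        if "v \<in> carrier W" "x \<in> t" for v x
        using harmonic_span_step.hyps(4)[OF that] f(2)[OF that] basis[OF harmonic_span_step.hyps(2) that]
        by (simp add: sum_distrib_left sum.distrib algebra_simps)
      then show ?case
        using f(1) harmonic_span_step.hyps(1)
        by (intro exI[of _ "\<lambda>w x. g x * p (inv w) y + f w x"]) (auto intro!: pol_add pol_mult pol_const)
    qed
  next
    fix f
    assume "\<forall>w\<in>carrier W. pol (f w)" "\<forall>v\<in>carrier W. \<forall>x\<in>t. (\<Sum>w\<in>carrier W. f w x * e (v \<otimes> w) x) = 0"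
    then have f: "\<And>w. w \<in> carrier W \<Longrightarrow> pol (f w)"
      "\<And>v x. v \<in> carrier W \<Longrightarrow> x \<in> t \<Longrightarrow> (\<Sum>w\<in>carrier W. f w x * e (v \<otimes> w) x) = 0" by blast+
    show "\<forall>w\<in>carrier W. \<forall>x\<in>t. f w x = 0"
    proof (intro ballI)
      fix w x assume w: "w \<in> carrier W" "x \<in> t"
      show "f w x = 0"
      proof (rule pol_zero_if_zero_on_regular[OF f(1)[OF w(1)] _ w(2)])
        fix z assume z: "z \<in> t" "\<And>\<alpha>. \<alpha> \<in> R \<Longrightarrow> \<alpha> z \<noteq> 0"
        \<comment> \<open>With coefficients frozen at \<open>z\<close> the combination is harmonic
          and vanishes at the regular point \<open>z\<close>, hence also at \<open>y\<close>, where
          it shows a single coefficient.\<close>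
        have "(\<Sum>u\<in>carrier W. f u z * e (inv w \<otimes> u) y) = 0"
          by (rule harmonic_zero_if_zero_at_regular[where y = z and x = y and v = "inv w" and
                p = "\<lambda>v x. \<Sum>u\<in>carrier W. f u z * e (v \<otimes> u) x"])
             (use hcomb f(2) z w(1) y in auto)
        then show "f w z = 0" using ev[of "inv w" "\<lambda>u. f u z"] w(1) by simp
      qed
    qed
  qed
  then show ?thesis by (rule exI[of is_generator])
qed

end

section \<open>Rings of functions\<close>

lemma cring_complex_ring: "cring complex_ring"
proof (rule cringI)
  show "abelian_group complex_ring"
    by (rule abelian_groupI)
       (auto simp: complex_ring_def algebra_simps intro!: bexI[of _ "- x" for x] exI[of _ "- x" for x] add.right_inverse)
  show "comm_monoid complex_ring" by (rule comm_monoidI) (auto simp: complex_ring_def)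
qed (auto simp: complex_ring_def algebra_simps)

lemma complex_ring_simps [simp]:
  "carrier complex_ring = UNIV" "x \<otimes>\<^bsub>complex_ring\<^esub> y = x * y" "x \<oplus>\<^bsub>complex_ring\<^esub> y = x + y"
  "\<one>\<^bsub>complex_ring\<^esub> = 1" "\<zero>\<^bsub>complex_ring\<^esub> = 0"
  by (simp_all add: complex_ring_def)

lemma complex_ring_a_inv [simp]: "\<ominus>\<^bsub>complex_ring\<^esub> x = - x"
  using abelian_group.minus_equality[OF ring.is_abelian_group[OF cring.axioms(1)[OF cring_complex_ring]], of "- x" x]
  by simp

lemma tuple_algebra_simps [simp]:
  "carrier (tuple_algebra R I) = I \<rightarrow>\<^sub>E carrier R"
  "f \<otimes>\<^bsub>tuple_algebra R I\<^esub> g = (\<lambda>i\<in>I. f i \<otimes>\<^bsub>R\<^esub> g i)"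
  "f \<oplus>\<^bsub>tuple_algebra R I\<^esub> g = (\<lambda>i\<in>I. f i \<oplus>\<^bsub>R\<^esub> g i)"
  "\<one>\<^bsub>tuple_algebra R I\<^esub> = (\<lambda>i\<in>I. \<one>\<^bsub>R\<^esub>)" "\<zero>\<^bsub>tuple_algebra R I\<^esub> = (\<lambda>i\<in>I. \<zero>\<^bsub>R\<^esub>)"
  "r \<odot>\<^bsub>tuple_algebra R I\<^esub> f = (\<lambda>i\<in>I. r \<otimes>\<^bsub>R\<^esub> f i)"
  by (simp_all add: tuple_algebra_def)

lemma cring_tuple_algebra:
  assumes "cring R" shows "cring (tuple_algebra R I)"
proof -
  interpret cring R by fact
  show ?thesis
  proof (rule cringI)
    show "abelian_group (tuple_algebra R I)"
    proof (rule abelian_groupI)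
      show "\<exists>y\<in>carrier (tuple_algebra R I). y \<oplus>\<^bsub>tuple_algebra R I\<^esub> x = \<zero>\<^bsub>tuple_algebra R I\<^esub>"
        if "x \<in> carrier (tuple_algebra R I)" for x
        using that by (intro bexI[of _ "\<lambda>i\<in>I. \<ominus>\<^bsub>R\<^esub> x i"]) (auto simp: fun_eq_iff l_neg PiE_iff)
    qed (auto simp: fun_eq_iff PiE_iff a_ac restrict_def extensional_def)
    show "comm_monoid (tuple_algebra R I)"
      by (rule comm_monoidI) (auto simp: fun_eq_iff PiE_iff m_ac restrict_def extensional_def)
  qed (auto simp: fun_eq_iff PiE_iff l_distr restrict_def)
qed

lemma tuple_algebra_a_inv:
  assumes "cring R" "f \<in> I \<rightarrow>\<^sub>E carrier R"
  shows "\<ominus>\<^bsub>tuple_algebra R I\<^esub> f = (\<lambda>i\<in>I. \<ominus>\<^bsub>R\<^esub> f i)"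
proof -
  interpret R: cring R by fact
  interpret A: cring "tuple_algebra R I" by (rule cring_tuple_algebra) fact
  show ?thesis
    by (rule A.minus_equality) (use assms(2) in \<open>auto simp: PiE_iff fun_eq_iff R.l_neg\<close>)
qed

text \<open>Serves twice, for polynomial functions among all functions and for GKM tuples among all
  tuples. Negatives must be identified too, since \<open>\<ominus>\<close> of a record depends on
  its carrier.\<close>

lemma cring_tuple_subalgebra:
  assumes "cring R" "C \<subseteq> I \<rightarrow>\<^sub>E carrier R" "(\<lambda>i\<in>I. \<one>\<^bsub>R\<^esub>) \<in> C"
    "\<And>f. f \<in> C \<Longrightarrow> (\<lambda>i\<in>I. \<ominus>\<^bsub>R\<^esub> f i) \<in> C"
    "\<And>f g. f \<in> C \<Longrightarrow> g \<in> C \<Longrightarrow> (\<lambda>i\<in>I. f i \<oplus>\<^bsub>R\<^esub> g i) \<in> C"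
    "\<And>f g. f \<in> C \<Longrightarrow> g \<in> C \<Longrightarrow> (\<lambda>i\<in>I. f i \<otimes>\<^bsub>R\<^esub> g i) \<in> C"
  shows "cring (tuple_algebra R I\<lparr>carrier := C\<rparr>)"
    and "f \<in> C \<Longrightarrow> \<ominus>\<^bsub>tuple_algebra R I\<lparr>carrier := C\<rparr>\<^esub> f = (\<lambda>i\<in>I. \<ominus>\<^bsub>R\<^esub> f i)"
proof -
  interpret R: cring R by fact
  interpret A: cring "tuple_algebra R I" by (rule cring_tuple_algebra) fact
  have "subring C (tuple_algebra R I)"
  proof (rule A.subringI)
    show "\<ominus>\<^bsub>tuple_algebra R I\<^esub> f \<in> C" if "f \<in> C" for f
      using that assms(2,4) by (subst tuple_algebra_a_inv[OF assms(1)]) auto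
  qed (use assms in auto)
  then have *: "subcring C (tuple_algebra R I)" by (rule A.subcringI')
  have "C \<subseteq> carrier (tuple_algebra R I)" using assms(2) by simp
  from A.subcring_iff[OF this] * show "cring (tuple_algebra R I\<lparr>carrier := C\<rparr>)" by blast
  then interpret C: cring "tuple_algebra R I\<lparr>carrier := C\<rparr>" .
  show "\<ominus>\<^bsub>tuple_algebra R I\<lparr>carrier := C\<rparr>\<^esub> f = (\<lambda>i\<in>I. \<ominus>\<^bsub>R\<^esub> f i)" if f: "f \<in> C"
  proof (rule C.minus_equality)
    have "f i \<in> carrier R" if "i \<in> I" for i using assms(2) f that by (auto simp: PiE_iff)
    then show "(\<lambda>i\<in>I. \<ominus>\<^bsub>R\<^esub> f i) \<oplus>\<^bsub>tuple_algebra R I\<lparr>carrier := C\<rparr>\<^esub> f = \<zero>\<^bsub>tuple_algebra R I\<lparr>carrier := C\<rparr>\<^esub>"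
      by (simp add: fun_eq_iff R.l_neg)
  qed (use assms(4) f in auto)
qed

context complex_subspace
begin

definition polynomial_ring :: "(complex, 'v \<Rightarrow> complex) module" where
  "polynomial_ring = tuple_algebra complex_ring t\<lparr>carrier := {f \<in> extensional t. pol f}\<rparr>"

lemma polynomial_ring_simps [simp]:
  "carrier polynomial_ring = {f \<in> extensional t. pol f}"
  "f \<otimes>\<^bsub>polynomial_ring\<^esub> g = (\<lambda>x\<in>t. f x * g x)"
  "f \<oplus>\<^bsub>polynomial_ring\<^esub> g = (\<lambda>x\<in>t. f x + g x)"
  "\<one>\<^bsub>polynomial_ring\<^esub> = (\<lambda>x\<in>t. 1)" "\<zero>\<^bsub>polynomial_ring\<^esub> = (\<lambda>x\<in>t. 0)"
  by (simp_all add: polynomial_ring_def)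

lemma pol_restrict [simp]: "pol (\<lambda>x\<in>t. f x) \<longleftrightarrow> pol f"
  using pol_cong[of f "\<lambda>x\<in>t. f x"] pol_cong[of "\<lambda>x\<in>t. f x" f] by auto

lemma cring_polynomial_ring: "cring polynomial_ring"
  and polynomial_ring_a_inv: "f \<in> extensional t \<Longrightarrow> pol f \<Longrightarrow> \<ominus>\<^bsub>polynomial_ring\<^esub> f = (\<lambda>x\<in>t. - f x)"
proof -
  have *: "{f \<in> extensional t. pol f} \<subseteq> t \<rightarrow>\<^sub>E carrier complex_ring"
    "(\<lambda>i\<in>t. \<one>\<^bsub>complex_ring\<^esub>) \<in> {f \<in> extensional t. pol f}"
    "\<And>f. f \<in> {f \<in> extensional t. pol f} \<Longrightarrow> (\<lambda>i\<in>t. \<ominus>\<^bsub>complex_ring\<^esub> f i) \<in> {f \<in> extensional t. pol f}"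
    "\<And>f g. f \<in> {f \<in> extensional t. pol f} \<Longrightarrow> g \<in> {f \<in> extensional t. pol f} \<Longrightarrow>
        (\<lambda>i\<in>t. f i \<oplus>\<^bsub>complex_ring\<^esub> g i) \<in> {f \<in> extensional t. pol f}"
    "\<And>f g. f \<in> {f \<in> extensional t. pol f} \<Longrightarrow> g \<in> {f \<in> extensional t. pol f} \<Longrightarrow>
        (\<lambda>i\<in>t. f i \<otimes>\<^bsub>complex_ring\<^esub> g i) \<in> {f \<in> extensional t. pol f}"
    by (force simp: PiE_def) (simp_all add: pol_const pol_uminus pol_add pol_mult)
  show "cring polynomial_ring"
    unfolding polynomial_ring_def by (rule cring_tuple_subalgebra[OF cring_complex_ring *])
  show "f \<in> extensional t \<Longrightarrow> pol f \<Longrightarrow> \<ominus>\<^bsub>polynomial_ring\<^esub> f = (\<lambda>x\<in>t. - f x)"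
    unfolding polynomial_ring_def
    using cring_tuple_subalgebra(2)[OF cring_complex_ring *, of f] by simp
qed

text \<open>The link between \<open>HT_pt\<close> and \<open>pol\<close>: being polynomial is
  preserved by the ring operations, and conversely the rules of \<open>hpoly\<close> rebuild each
  homogeneous part from constants and linear forms.\<close>

lemma generated_algebra_eq: "generated_algebra t {l \<in> extensional t. lin l} = {f \<in> extensional t. pol f}"
proof (intro equalityI subsetI)
  have pol_mem: "(\<lambda>x\<in>t. g x) \<in> {f \<in> extensional t. pol f}" if "pol g" for g
    using that by (intro CollectI conjI restrict_extensional) simp
  fix f assume "f \<in> generated_algebra t {l \<in> extensional t. lin l}"
  then show "f \<in> {f \<in> extensional t. pol f}"
    unfolding generated_algebra_def
  proof induction
    case one
    show ?case unfolding tuple_algebra_simps by (rule pol_mem) (simp add: pol_const)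
  next
    case (incl f)
    then show ?case using pol_const pol_lin by auto
  next
    case (a_inv f)
    then have "\<ominus>\<^bsub>tuple_algebra complex_ring t\<^esub> f = (\<lambda>x\<in>t. \<ominus>\<^bsub>complex_ring\<^esub> f x)"
      by (intro tuple_algebra_a_inv[OF cring_complex_ring]) (simp add: PiE_def)
    with pol_mem[OF pol_uminus, of f] a_inv show ?case by (simp only: complex_ring_a_inv mem_Collect_eq)
  next
    case (eng_add f g)
    with pol_mem[OF pol_add, of f g] show ?case by (simp only: tuple_algebra_simps complex_ring_simps mem_Collect_eq)
  next
    case (eng_mult f g)
    with pol_mem[OF pol_mult, of f g] show ?case by (simp only: tuple_algebra_simps complex_ring_simps mem_Collect_eq)
  qed
next
  let ?A = "tuple_algebra complex_ring t" and ?D = "{l \<in> extensional t. lin l}"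
  let ?G = "generated_algebra t ?D"
  have add: "(\<lambda>x\<in>t. f x + g x) \<in> ?G" if "(\<lambda>x\<in>t. f x) \<in> ?G" "(\<lambda>x\<in>t. g x) \<in> ?G" for f g
    using generate_ring.eng_add[OF that[unfolded generated_algebra_def]]
    by (simp add: generated_algebra_def cong: restrict_cong)
  have mult: "(\<lambda>x\<in>t. f x * g x) \<in> ?G" if "(\<lambda>x\<in>t. f x) \<in> ?G" "(\<lambda>x\<in>t. g x) \<in> ?G" for f g
    using generate_ring.eng_mult[OF that[unfolded generated_algebra_def]]
    by (simp add: generated_algebra_def cong: restrict_cong)
  have const: "(\<lambda>x\<in>t. c) \<in> ?G" for c
    unfolding generated_algebra_def by (rule generate_ring.incl) auto
  have lin: "(\<lambda>x\<in>t. l x) \<in> ?G" if "lin l" for l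
    unfolding generated_algebra_def using that by (intro generate_ring.incl) (auto simp: lin_def)
  have hom: "(\<lambda>x\<in>t. f x) \<in> ?G" if "hpoly d f" for d f
    using that
  proof induction
    case (hpoly_const f c)
    then have "(\<lambda>x\<in>t. f x) = (\<lambda>x\<in>t. c)" by (intro restrict_ext) simp
    then show ?case by (simp only: const)
  next
    case (hpoly_zero f d)
    then have "(\<lambda>x\<in>t. f x) = (\<lambda>x\<in>t. 0)" by (intro restrict_ext) simp
    then show ?case by (simp only: const)
  next
    case (hpoly_step l d g k f)
    then have "(\<lambda>x\<in>t. f x) = (\<lambda>x\<in>t. l x * g x + k x)" by (intro restrict_ext) simp
    then show ?case using add[OF mult[OF lin[OF hpoly_step.hyps(1)] hpoly_step.IH(1)] hpoly_step.IH(2)] by (simp only:)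
  qed
  fix f assume f: "f \<in> {f \<in> extensional t. pol f}"
  then have "pol f" by simp
  then obtain n c where c: "\<And>i. hpoly i (c i)" "\<And>i x. i > n \<Longrightarrow> c i x = 0"
    "\<And>m x. m \<ge> n \<Longrightarrow> x \<in> t \<Longrightarrow> f x = (\<Sum>i\<le>m. c i x)"
    using polE[of f] by metis
  have "(\<lambda>x\<in>t. \<Sum>i\<le>m. c i x) \<in> ?G" for m
  proof (induction m)
    case (Suc m)
    from add[OF this hom[OF c(1)]] show ?case by (simp only: sum.atMost_Suc)
  next
    case 0
    have "(\<lambda>x\<in>t. \<Sum>i\<le>0. c i x) = (\<lambda>x\<in>t. c 0 x)" by simp
    then show ?case using hom[OF c(1)[of 0]] by (simp only:)
  qed
  moreover have "f = (\<lambda>x\<in>t. \<Sum>i\<le>n. c i x)"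
    using f c(3)[of n] by (auto simp: fun_eq_iff extensional_def)
  ultimately show "f \<in> ?G" by simp
qed

text \<open>Homogeneous parts of positive degree are combinations of linear forms, and the degree 0
  part is the value at the origin. Membership in this ideal thus becomes evaluation at 0.\<close>

lemma ideal_of_lin:
  "Idl\<^bsub>polynomial_ring\<^esub> {l \<in> extensional t. lin l} = {f \<in> extensional t. pol f \<and> f 0 = 0}"
proof -
  interpret P: cring polynomial_ring by (rule cring_polynomial_ring)
  let ?D = "{l \<in> extensional t. lin l}" and ?I = "{f \<in> extensional t. pol f \<and> f 0 = 0}"
  have D: "?D \<subseteq> carrier polynomial_ring" using pol_lin by auto
  have "ideal ?I polynomial_ring"
  proof (rule idealI[OF P.ring_axioms])
    show "subgroup ?I (add_monoid polynomial_ring)"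
    proof (rule P.add.subgroupI)
      show "\<ominus>\<^bsub>polynomial_ring\<^esub> f \<in> ?I" if "f \<in> ?I" for f
        using that by (auto simp: polynomial_ring_a_inv intro: pol_uminus)
    qed (use pol_const[of 0] in \<open>auto intro: pol_add intro!: exI[of _ "\<lambda>x\<in>t. 0"]\<close>)
  qed (auto intro: pol_mult)
  then have "Idl\<^bsub>polynomial_ring\<^esub> ?D \<subseteq> ?I"
    by (rule P.genideal_minimal) (auto intro: pol_lin lin_0)
  moreover have "?I \<subseteq> Idl\<^bsub>polynomial_ring\<^esub> ?D"
  proof
    let ?J = "Idl\<^bsub>polynomial_ring\<^esub> ?D"
    interpret J: ideal ?J polynomial_ring by (rule P.genideal_ideal[OF D])
    have add: "(\<lambda>x\<in>t. f x + g x) \<in> ?J" if "(\<lambda>x\<in>t. f x) \<in> ?J" "(\<lambda>x\<in>t. g x) \<in> ?J" for f g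
      using J.a_closed[OF that] by (simp cong: restrict_cong)
    have zero: "(\<lambda>x\<in>t. 0) \<in> ?J" using J.zero_closed by simp
    have mult: "(\<lambda>x\<in>t. l x * g x) \<in> ?J" if "lin l" "pol g" for l g
    proof -
      have "(\<lambda>x\<in>t. l x) \<in> ?D" using that by (auto simp: lin_def)
      then have "(\<lambda>x\<in>t. l x) \<in> ?J" using P.genideal_self[OF D] by blast
      from J.I_r_closed[OF this, of "\<lambda>x\<in>t. g x"] that show ?thesis by (simp cong: restrict_cong)
    qed
    have hom: "d > 0 \<Longrightarrow> (\<lambda>x\<in>t. f x) \<in> ?J" if "hpoly d f" for d f
      using that
    proof induction
      case (hpoly_zero f d)
      then have "(\<lambda>x\<in>t. f x) = (\<lambda>x\<in>t. 0)" by (intro restrict_ext) simp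
      then show ?case by (simp only: zero)
    next
      case (hpoly_step l d g k f)
      then have "(\<lambda>x\<in>t. f x) = (\<lambda>x\<in>t. l x * g x + k x)" by (intro restrict_ext) simp
      then show ?case
        using add[OF mult[OF hpoly_step.hyps(1) hpoly_imp_pol[OF hpoly_step.hyps(2)]] hpoly_step.IH(2)] by (simp only: zero_less_Suc)
    qed simp
    fix f assume f: "f \<in> ?I"
    then have "pol f" by simp
  then obtain n c where c: "\<And>i. hpoly i (c i)" "\<And>i x. i > n \<Longrightarrow> c i x = 0"
    "\<And>m x. m \<ge> n \<Longrightarrow> x \<in> t \<Longrightarrow> f x = (\<Sum>i\<le>m. c i x)"
      using polE[of f] by metis
    have c0: "c (Suc i) 0 = 0" for i using hpoly_scaling[OF c(1), of 0 "Suc i" 0] by simp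
    obtain a where a: "\<forall>x\<in>t. c 0 x = a" using hpoly_0D[OF c(1)] by blast
    have "f 0 = (\<Sum>i\<le>n. c i 0)" using c(3)[of n 0] by simp
    also have "\<dots> = c 0 0" using c0 by (cases n) (simp_all add: sum.atMost_Suc_shift del: sum.atMost_Suc)
    finally have "a = 0" using f a by simp
    then have "(\<lambda>x\<in>t. c i x) \<in> ?J" for i
      using a zero hom[OF c(1)] by (cases i) (auto cong: restrict_cong)
    then have "(\<lambda>x\<in>t. \<Sum>i\<le>m. c i x) \<in> ?J" for m
    proof (induction m)
      case 0
      have "(\<lambda>x\<in>t. \<Sum>i\<le>0. c i x) = (\<lambda>x\<in>t. c 0 x)" by simp
      then show ?case using 0[of 0] by (simp only:)
    next
      case (Suc m)
      from add[OF Suc.IH[OF Suc.prems] Suc.prems] show ?case by (simp only: sum.atMost_Suc)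
    qed
    moreover have "f = (\<lambda>x\<in>t. \<Sum>i\<le>n. c i x)"
      using f c(3)[of n] by (auto simp: fun_eq_iff extensional_def)
    ultimately show "f \<in> ?J" by simp
  qed
  ultimately show ?thesis by blast
qed

end

context reflection_group
begin

section \<open>The ring of GKM tuples and the star action\<close>

definition gkm_ring :: "('v \<Rightarrow> complex, 'g \<Rightarrow> 'v \<Rightarrow> complex) module" where
  "gkm_ring = tuple_algebra polynomial_ring (carrier W)
     \<lparr>carrier := {p \<in> carrier W \<rightarrow>\<^sub>E carrier polynomial_ring. gkm p}\<rparr>"

definition star_act :: "'g \<Rightarrow> ('g \<Rightarrow> 'v \<Rightarrow> complex) \<Rightarrow> 'g \<Rightarrow> 'v \<Rightarrow> complex" where
  "star_act w p = (\<lambda>v\<in>carrier W. p (v \<otimes> w))"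

abbreviation tup :: "('g \<Rightarrow> 'v \<Rightarrow> complex) \<Rightarrow> 'g \<Rightarrow> 'v \<Rightarrow> complex" where
  "tup p \<equiv> (\<lambda>v\<in>carrier W. \<lambda>x\<in>t. p v x)"

lemma tup_cong: "(\<And>v x. v \<in> carrier W \<Longrightarrow> x \<in> t \<Longrightarrow> p v x = q v x) \<Longrightarrow> tup p = tup q"
  by (intro restrict_ext) simp

lemma gkm_tup: "gkm p \<Longrightarrow> gkm (tup p)"
  by (erule gkm_cong) simp

lemma tup_in_gkm_ring: "gkm p \<Longrightarrow> tup p \<in> carrier gkm_ring"
  using gkm_tup[of p] by (simp add: gkm_ring_def gkm_def)

lemma gkm_ringD:
  assumes "p \<in> carrier gkm_ring"
  shows "gkm p" "p = tup p" "v \<in> carrier W \<Longrightarrow> pol (p v)" "v \<in> carrier W \<Longrightarrow> p v \<in> extensional t"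
  using assms by (auto simp: gkm_ring_def gkm_def PiE_iff fun_eq_iff extensional_def)

lemma gkm_ring_eqI:
  assumes "p \<in> carrier gkm_ring" "q \<in> carrier gkm_ring"
    "\<And>v x. v \<in> carrier W \<Longrightarrow> x \<in> t \<Longrightarrow> p v x = q v x"
  shows "p = q"
  using gkm_ringD(2)[OF assms(1)] gkm_ringD(2)[OF assms(2)] tup_cong[of p q] assms(3) by simp

lemma gkm_ring_ops:
  "p \<otimes>\<^bsub>gkm_ring\<^esub> q = tup (\<lambda>v x. p v x * q v x)" "p \<oplus>\<^bsub>gkm_ring\<^esub> q = tup (\<lambda>v x. p v x + q v x)"
  "\<one>\<^bsub>gkm_ring\<^esub> = tup (\<lambda>v x. 1)" "\<zero>\<^bsub>gkm_ring\<^esub> = tup (\<lambda>v x. 0)"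
  "f \<odot>\<^bsub>gkm_ring\<^esub> p = tup (\<lambda>v x. f x * p v x)"
  by (simp_all add: gkm_ring_def)

lemma cring_gkm_ring: "cring gkm_ring"
  and gkm_ring_a_inv: "p \<in> carrier gkm_ring \<Longrightarrow> \<ominus>\<^bsub>gkm_ring\<^esub> p = tup (\<lambda>v x. - p v x)"
proof -
  let ?C = "{p \<in> carrier W \<rightarrow>\<^sub>E carrier polynomial_ring. gkm p}"
  have C: "?C = carrier gkm_ring" by (simp add: gkm_ring_def)
  have neg: "(\<lambda>v\<in>carrier W. \<ominus>\<^bsub>polynomial_ring\<^esub> p v) = tup (\<lambda>v x. - p v x)" if "p \<in> ?C" for p
    using gkm_ringD(3,4)[OF that[unfolded C]] by (intro restrict_ext) (simp add: polynomial_ring_a_inv)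
  have *: "?C \<subseteq> carrier W \<rightarrow>\<^sub>E carrier polynomial_ring" by blast
  have 1: "(\<lambda>v\<in>carrier W. \<one>\<^bsub>polynomial_ring\<^esub>) \<in> ?C"
    using tup_in_gkm_ring[OF gkm_const[OF pol_const[of 1]]] unfolding C by simp
  have 2: "(\<lambda>v\<in>carrier W. \<ominus>\<^bsub>polynomial_ring\<^esub> p v) \<in> ?C" if p: "p \<in> ?C" for p
    using tup_in_gkm_ring[OF gkm_pol_mult[OF pol_const[of "-1"]], of p] gkm_ringD(1)[OF p[unfolded C]]
    unfolding neg[OF p] unfolding C by simp
  have 3: "(\<lambda>v\<in>carrier W. p v \<oplus>\<^bsub>polynomial_ring\<^esub> q v) \<in> ?C" if p: "p \<in> ?C" and q: "q \<in> ?C" for p q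
    using tup_in_gkm_ring[OF gkm_add, of p q] gkm_ringD(1)[OF p[unfolded C]] gkm_ringD(1)[OF q[unfolded C]]
    unfolding C by simp
  have 4: "(\<lambda>v\<in>carrier W. p v \<otimes>\<^bsub>polynomial_ring\<^esub> q v) \<in> ?C" if p: "p \<in> ?C" and q: "q \<in> ?C" for p q
    using tup_in_gkm_ring[OF gkm_mult, of p q] gkm_ringD(1)[OF p[unfolded C]] gkm_ringD(1)[OF q[unfolded C]]
    unfolding C by simp
  show "cring gkm_ring"
    unfolding gkm_ring_def by (rule cring_tuple_subalgebra(1)[OF cring_polynomial_ring * 1 2 3 4])
  show "\<ominus>\<^bsub>gkm_ring\<^esub> p = tup (\<lambda>v x. - p v x)" if p: "p \<in> carrier gkm_ring"
  proof -
    have p': "p \<in> ?C" using p unfolding C .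
    show ?thesis
      unfolding neg[OF p', symmetric] unfolding gkm_ring_def
      by (rule cring_tuple_subalgebra(2)[OF cring_polynomial_ring * 1 2 3 4 p'])
  qed
qed

section \<open>Coordinates with respect to the translates of the generator\<close>

definition generator :: "'g \<Rightarrow> 'v \<Rightarrow> complex" where
  "generator = (SOME e. is_generator e)"

lemma is_generator_generator: "is_generator generator"
  unfolding generator_def by (rule someI_ex[OF is_generator_exists])

definition combination :: "('g \<Rightarrow> 'v \<Rightarrow> complex) \<Rightarrow> 'g \<Rightarrow> 'v \<Rightarrow> complex" where
  "combination f v x = (\<Sum>w\<in>carrier W. f w x * generator (v \<otimes> w) x)"

text \<open>Coefficients are unique only as functions on the group and on \<open>t\<close>;
  \<open>tup\<close> makes the chosen ones extensional, as elements of \<open>tuple_algebra\<close>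
  have to be.\<close>

definition coord :: "('g \<Rightarrow> 'v \<Rightarrow> complex) \<Rightarrow> 'g \<Rightarrow> 'v \<Rightarrow> complex" where
  "coord p = tup (SOME f. (\<forall>w\<in>carrier W. pol (f w)) \<and> (\<forall>v\<in>carrier W. \<forall>x\<in>t. p v x = combination f v x))"

lemma gkm_generator: "gkm generator"
  using is_generator_generator by (simp add: is_generator_def)

lemma gkm_combination: "(\<And>w. w \<in> carrier W \<Longrightarrow> pol (f w)) \<Longrightarrow> gkm (combination f)"
  unfolding combination_def by (intro gkm_sum finite_W gkm_pol_mult gkm_star gkm_generator) auto

lemma combination_tup: "combination (tup f) v x = combination f v x" if "x \<in> t"
  using that by (simp add: combination_def)

lemma coord:
  assumes "gkm p"
  shows coord_pol: "w \<in> carrier W \<Longrightarrow> pol (coord p w)"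
    and coord_eq: "v \<in> carrier W \<Longrightarrow> x \<in> t \<Longrightarrow> p v x = combination (coord p) v x"
proof -
  define f where "f = (SOME f. (\<forall>w\<in>carrier W. pol (f w)) \<and> (\<forall>v\<in>carrier W. \<forall>x\<in>t. p v x = combination f v x))"
  have "\<exists>f. (\<forall>w\<in>carrier W. pol (f w)) \<and> (\<forall>v\<in>carrier W. \<forall>x\<in>t. p v x = combination f v x)"
    unfolding combination_def using is_generator_generator assms unfolding is_generator_def by blast
  from someI_ex[OF this, folded f_def] have f: "\<forall>w\<in>carrier W. pol (f w)"
    "\<forall>v\<in>carrier W. \<forall>x\<in>t. p v x = combination f v x" by blast+
  have c: "coord p = tup f" by (simp only: coord_def f_def)
  show "w \<in> carrier W \<Longrightarrow> pol (coord p w)" using f(1) by (simp add: c)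
  show "v \<in> carrier W \<Longrightarrow> x \<in> t \<Longrightarrow> p v x = combination (coord p) v x"
    using f(2) by (simp only: c combination_tup)
qed

lemma coord_tup: "tup (coord p) = coord p"
  unfolding coord_def by (rule tup_cong) simp

text \<open>The difference of two coefficient families represents zero, and the translates of the
  generator are independent. The rules for \<open>coord\<close> below follow by exhibiting
  coefficients.\<close>

lemma coord_unique:
  assumes "\<And>w. w \<in> carrier W \<Longrightarrow> pol (f w)"
    "\<And>v x. v \<in> carrier W \<Longrightarrow> x \<in> t \<Longrightarrow> p v x = combination f v x"
    and w: "w \<in> carrier W" "x \<in> t"
  shows "coord p w x = f w x"
proof -
  have p: "gkm p" by (rule gkm_cong[OF gkm_combination[OF assms(1)] assms(2)])
  define g where "g = (\<lambda>w x. coord p w x - f w x)"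
  have "\<forall>w\<in>carrier W. pol (g w)"
    unfolding g_def using coord_pol[OF p] assms(1) by (auto intro: pol_diff)
  moreover have "\<forall>v\<in>carrier W. \<forall>x\<in>t. (\<Sum>w\<in>carrier W. g w x * generator (v \<otimes> w) x) = 0"
    using coord_eq[OF p] assms(2) by (simp add: g_def combination_def left_diff_distrib sum_subtractf)
  ultimately have "g w x = 0" using is_generator_generator w unfolding is_generator_def by blast
  then show ?thesis by (simp add: g_def)
qed

lemma coord_add:
  assumes "gkm p" "gkm q" "w \<in> carrier W" "x \<in> t"
  shows "coord (tup (\<lambda>v x. p v x + q v x)) w x = coord p w x + coord q w x"
  by (rule coord_unique)
     (use assms coord_pol coord_eq in \<open>auto intro: pol_add simp: combination_def sum.distrib distrib_right\<close>)

lemma coord_smult: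
  assumes "pol f" "gkm p" "w \<in> carrier W" "x \<in> t"
  shows "coord (tup (\<lambda>v x. f x * p v x)) w x = f x * coord p w x"
  by (rule coord_unique)
     (use assms coord_pol in \<open>auto intro: pol_mult simp: coord_eq[OF assms(2)] combination_def sum_distrib_left mult.assoc\<close>)

text \<open>Translation by \<open>u\<close> replaces \<open>v \<otimes> w\<close> by
  \<open>v \<otimes> u \<otimes> w\<close> in the generator. Renaming \<open>u \<otimes> w\<close>
  as the summation index shifts the coefficients by the inverse of \<open>u\<close> on the left,
  which is the regular action.\<close>

lemma coord_star:
  assumes "u \<in> carrier W" "gkm p" "w \<in> carrier W" "x \<in> t"
  shows "coord (star_act u p) w x = coord p (inv u \<otimes> w) x"
proof (rule coord_unique[OF _ _ assms(3,4)])
  show "pol (coord p (inv u \<otimes> w))" if "w \<in> carrier W" for w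
    using assms that coord_pol by auto
  fix v x assume v: "v \<in> carrier W" "x \<in> t"
  have "star_act u p v x = combination (coord p) (v \<otimes> u) x"
    using assms v coord_eq by (simp add: star_act_def)
  also have "\<dots> = (\<Sum>w\<in>carrier W. coord p (inv u \<otimes> w) x * generator (v \<otimes> w) x)"
    using sum_translate[of "inv u" "\<lambda>w. coord p w x * generator (v \<otimes> u \<otimes> w) x"] assms(1) v
    by (simp add: combination_def m_assoc flip: m_assoc[of u "inv u"] cong: sum.cong)
  finally show "star_act u p v x = combination (\<lambda>w. coord p (inv u \<otimes> w)) v x"
    by (simp add: combination_def)
qed

lemma coord_combination:
  assumes "\<And>w. w \<in> carrier W \<Longrightarrow> pol (f w)" "w \<in> carrier W" "x \<in> t"
  shows "coord (tup (combination f)) w x = f w x"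
  by (rule coord_unique) (use assms in auto)

lemma star_act_closed:
  assumes "u \<in> carrier W" "p \<in> carrier gkm_ring" shows "star_act u p \<in> carrier gkm_ring"
proof -
  have "star_act u p = tup (\<lambda>v. p (v \<otimes> u))"
    using gkm_ringD(4)[OF assms(2)] assms(1) unfolding star_act_def
    by (intro restrict_ext) (auto simp: fun_eq_iff extensional_def)
  then show ?thesis using tup_in_gkm_ring[OF gkm_star[OF gkm_ringD(1)[OF assms(2)] assms(1)]] by simp
qed

theorem gkm_ring_regular: "is_regular_rep polynomial_ring W gkm_ring star_act"
  unfolding is_regular_rep_def
proof (intro conjI exI[of _ coord] ballI)
  interpret M: cring gkm_ring by (rule cring_gkm_ring)
  show "Group.group W" by unfold_locales
  show "finite (carrier W)" by (rule finite_W)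
  show "Module.module polynomial_ring gkm_ring"
  proof (rule moduleI[OF cring_polynomial_ring M.is_abelian_group])
    fix f p assume f: "f \<in> carrier polynomial_ring" and p: "p \<in> carrier gkm_ring"
    show "f \<odot>\<^bsub>gkm_ring\<^esub> p \<in> carrier gkm_ring"
      unfolding gkm_ring_ops using f gkm_ringD(1)[OF p] by (intro tup_in_gkm_ring gkm_pol_mult) auto
  next
    fix p assume p: "p \<in> carrier gkm_ring"
    show "\<one>\<^bsub>polynomial_ring\<^esub> \<odot>\<^bsub>gkm_ring\<^esub> p = p"
      by (subst (2) gkm_ringD(2)[OF p], unfold gkm_ring_ops, rule tup_cong) simp
  qed (unfold gkm_ring_ops, (rule tup_cong, simp add: algebra_simps)+)
  show "star_act u \<in> carrier gkm_ring \<rightarrow> carrier gkm_ring" if "u \<in> carrier W" for u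
    using star_act_closed[OF that] by blast
  \<comment> \<open>Forming combinations inverts \<open>coord\<close>: one composite expresses the
    existence of coordinates, the other their uniqueness.\<close>
  show "bij_betw coord (carrier gkm_ring) (carrier (tuple_algebra polynomial_ring (carrier W)))"
  proof (rule bij_betwI[where g = "\<lambda>f. tup (combination f)"])
    show "coord \<in> carrier gkm_ring \<rightarrow> carrier (tuple_algebra polynomial_ring (carrier W))"
    proof
      fix p assume p: "p \<in> carrier gkm_ring"
      have "tup (coord p) \<in> carrier (tuple_algebra polynomial_ring (carrier W))"
        using coord_pol[OF gkm_ringD(1)[OF p]] by simp
      then show "coord p \<in> carrier (tuple_algebra polynomial_ring (carrier W))" by (simp only: coord_tup)
    qed
    show "(\<lambda>f. tup (combination f)) \<in> carrier (tuple_algebra polynomial_ring (carrier W)) \<rightarrow> carrier gkm_ring"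
      by (intro Pi_I tup_in_gkm_ring gkm_combination) (auto simp: PiE_iff)
    show "tup (combination (coord p)) = p" if p: "p \<in> carrier gkm_ring" for p
      by (subst (2) gkm_ringD(2)[OF p], rule tup_cong)
         (use coord_eq[OF gkm_ringD(1)[OF p]] in simp)
    show "coord (tup (combination f)) = f"
      if f: "f \<in> carrier (tuple_algebra polynomial_ring (carrier W))" for f
    proof -
      have f': "f = tup f" using f by (auto simp: PiE_iff fun_eq_iff extensional_def)
      have "pol (f w)" if "w \<in> carrier W" for w using f that by auto
      then have "tup (coord (tup (combination f))) = tup f" by (intro tup_cong coord_combination) auto
      then show ?thesis by (simp only: coord_tup f'[symmetric])
    qed
  qed
  show "coord (p \<oplus>\<^bsub>gkm_ring\<^esub> q) = coord p \<oplus>\<^bsub>tuple_algebra polynomial_ring (carrier W)\<^esub> coord q"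
    if "p \<in> carrier gkm_ring" "q \<in> carrier gkm_ring" for p q
  proof -
    have "tup (coord (p \<oplus>\<^bsub>gkm_ring\<^esub> q)) = tup (\<lambda>v x. coord p v x + coord q v x)"
      unfolding gkm_ring_ops using that by (intro tup_cong coord_add gkm_ringD(1))
    then show ?thesis by (simp only: coord_tup tuple_algebra_simps polynomial_ring_simps)
  qed
  show "coord (f \<odot>\<^bsub>gkm_ring\<^esub> p) = f \<odot>\<^bsub>tuple_algebra polynomial_ring (carrier W)\<^esub> coord p"
    if "f \<in> carrier polynomial_ring" "p \<in> carrier gkm_ring" for f p
  proof -
    have "tup (coord (f \<odot>\<^bsub>gkm_ring\<^esub> p)) = tup (\<lambda>v x. f x * coord p v x)"
      unfolding gkm_ring_ops using that by (intro tup_cong coord_smult gkm_ringD(1)) auto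
    then show ?thesis by (simp only: coord_tup tuple_algebra_simps polynomial_ring_simps)
  qed
  show "coord (star_act u p) = regular_action W u (coord p)"
    if u: "u \<in> carrier W" and p: "p \<in> carrier gkm_ring" for u p
  proof -
    have "tup (coord (star_act u p)) = tup (\<lambda>w. tup (coord p) (inv u \<otimes> w))"
      using u by (intro tup_cong) (simp add: coord_star[OF u gkm_ringD(1)[OF p]])
    also have "\<dots> = (\<lambda>w\<in>carrier W. tup (coord p) (inv u \<otimes> w))"
      using u by (intro restrict_ext) (simp add: fun_eq_iff)
    finally show ?thesis by (simp only: coord_tup regular_action_def)
  qed
qed


section \<open>The quotient by the augmentation ideal\<close>

definition augmentation :: "('g \<Rightarrow> 'v \<Rightarrow> complex) set" where
  "augmentation = Idl\<^bsub>gkm_ring\<^esub>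
     {f \<odot>\<^bsub>gkm_ring\<^esub> p | f p. f \<in> Idl\<^bsub>polynomial_ring\<^esub> {l \<in> extensional t. lin l} \<and> p \<in> carrier gkm_ring}"

definition quotient_module :: "(complex, ('g \<Rightarrow> 'v \<Rightarrow> complex) set) module" where
  "quotient_module =
     (let Q = gkm_ring Quot augmentation in
      ring.extend Q
        (module.fields
          (\<lambda>c x. (augmentation +>\<^bsub>gkm_ring\<^esub> ((\<lambda>H\<in>t. c) \<odot>\<^bsub>gkm_ring\<^esub> \<one>\<^bsub>gkm_ring\<^esub>)) \<otimes>\<^bsub>Q\<^esub> x)))"

lemma gkm_ring_minus:
  assumes "p \<in> carrier gkm_ring" "q \<in> carrier gkm_ring"
  shows "p \<ominus>\<^bsub>gkm_ring\<^esub> q = tup (\<lambda>v x. p v x - q v x)"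
  using assms by (simp add: a_minus_def gkm_ring_a_inv gkm_ring_ops cong: restrict_cong)

text \<open>Multiplication by \<open>q\<close> is linear over the polynomial ring, so it acts on
  coordinates by a matrix of polynomials and preserves their vanishing at 0. Hence such tuples form
  an ideal of the ring and not only a submodule.\<close>

lemma coord_mult_zero:
  assumes p: "gkm p" "\<And>w. w \<in> carrier W \<Longrightarrow> coord p w 0 = 0" and q: "gkm q" and u: "u \<in> carrier W"
  shows "coord (tup (\<lambda>v x. q v x * p v x)) u 0 = 0"
proof -
  define g where "g = (\<lambda>w. coord (\<lambda>v x. q v x * generator (v \<otimes> w) x))"
  have qe: "gkm (\<lambda>v x. q v x * generator (v \<otimes> w) x)" if "w \<in> carrier W" for w
    by (intro gkm_mult q gkm_star gkm_generator that)
  have g: "w \<in> carrier W \<Longrightarrow> u \<in> carrier W \<Longrightarrow> pol (g w u)"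
    "w \<in> carrier W \<Longrightarrow> v \<in> carrier W \<Longrightarrow> x \<in> t \<Longrightarrow> q v x * generator (v \<otimes> w) x = combination (g w) v x" for w u v x
    unfolding g_def by (rule coord_pol[OF qe], assumption+, rule coord_eq[OF qe])
  have "coord (tup (\<lambda>v x. q v x * p v x)) u 0 = (\<Sum>w\<in>carrier W. coord p w 0 * g w u 0)"
  proof (rule coord_unique[where f = "\<lambda>u x. \<Sum>w\<in>carrier W. coord p w x * g w u x"])
    show "pol (\<lambda>x. \<Sum>w\<in>carrier W. coord p w x * g w u x)" if "u \<in> carrier W" for u
      by (intro pol_sum finite_W pol_mult coord_pol[OF p(1)] g(1) that)
    fix v x assume v: "v \<in> carrier W" "x \<in> t"
    have "q v x * p v x = (\<Sum>w\<in>carrier W. coord p w x * (q v x * generator (v \<otimes> w) x))"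
      using coord_eq[OF p(1) v] by (simp add: combination_def sum_distrib_left mult.left_commute)
    also have "\<dots> = (\<Sum>w\<in>carrier W. \<Sum>u\<in>carrier W. coord p w x * g w u x * generator (v \<otimes> u) x)"
      using g(2)[OF _ v] by (simp add: combination_def sum_distrib_left mult.assoc)
    also have "\<dots> = combination (\<lambda>u x. \<Sum>w\<in>carrier W. coord p w x * g w u x) v x"
      unfolding combination_def sum_distrib_right by (rule sum.swap)
    finally show "tup (\<lambda>v x. q v x * p v x) v x = combination (\<lambda>u x. \<Sum>w\<in>carrier W. coord p w x * g w u x) v x"
      using v by simp
  qed (use u in auto)
  with p(2) show ?thesis by simp
qed

text \<open>In coordinates the ideal consists of the families with entries in the maximal ideal at
  0. The right-hand side is an ideal containing the generators; conversely such a tuple is a sum of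
  products of a coordinate with a translate of the generator.\<close>

lemma augmentation_eq: "augmentation = {p \<in> carrier gkm_ring. \<forall>w\<in>carrier W. coord p w 0 = 0}"
  (is "_ = ?K")
proof
  interpret M: cring gkm_ring by (rule cring_gkm_ring)
  let ?m = "{f \<in> extensional t. pol f \<and> f 0 = 0}"
  let ?S = "{f \<odot>\<^bsub>gkm_ring\<^esub> p | f p. f \<in> ?m \<and> p \<in> carrier gkm_ring}"
  have J: "augmentation = Idl\<^bsub>gkm_ring\<^esub> ?S" by (simp only: augmentation_def ideal_of_lin)
  have S: "?S \<subseteq> carrier gkm_ring"
    using gkm_ringD(1) by (auto simp: gkm_ring_ops intro!: tup_in_gkm_ring gkm_pol_mult)
  have K_add: "tup (\<lambda>v x. p v x + q v x) \<in> ?K" if "p \<in> ?K" "q \<in> ?K" for p q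
    using that gkm_ringD(1) coord_add by (auto intro!: tup_in_gkm_ring gkm_add)
  have K_smult: "tup (\<lambda>v x. f x * p v x) \<in> ?K" if "pol f" "p \<in> ?K" for f p
    using that gkm_ringD(1) coord_smult by (auto intro!: tup_in_gkm_ring gkm_pol_mult)
  have K_mult: "tup (\<lambda>v x. q v x * p v x) \<in> ?K" if "p \<in> ?K" "q \<in> carrier gkm_ring" for p q
    using that gkm_ringD(1) coord_mult_zero by (auto intro!: tup_in_gkm_ring gkm_mult)
  have zero: "tup (\<lambda>v x. 0) \<in> ?K"
  proof -
    have "tup (\<lambda>v x. 0) \<in> carrier gkm_ring" by (intro tup_in_gkm_ring gkm_const pol_const)
    moreover have "coord (tup (\<lambda>v x. 0)) w 0 = 0" if "w \<in> carrier W" for w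
      using coord_smult[OF pol_const[of 0] gkm_generator that t_closed(1)] by simp
    ultimately show ?thesis by simp
  qed
  have "ideal ?K gkm_ring"
  proof (rule idealI[OF M.ring_axioms])
    show "subgroup ?K (add_monoid gkm_ring)"
    proof (rule M.add.subgroupI)
      show "\<ominus>\<^bsub>gkm_ring\<^esub> p \<in> ?K" if "p \<in> ?K" for p
        using K_smult[OF pol_const[of "-1"] that] that by (simp add: gkm_ring_a_inv)
      show "p \<oplus>\<^bsub>gkm_ring\<^esub> q \<in> ?K" if "p \<in> ?K" "q \<in> ?K" for p q
        unfolding gkm_ring_ops by (rule K_add[OF that])
      show "?K \<noteq> {}" using zero by (simp only: ex_in_conv[symmetric]) (rule exI)
    qed auto
    show "q \<otimes>\<^bsub>gkm_ring\<^esub> p \<in> ?K" if "p \<in> ?K" "q \<in> carrier gkm_ring" for p q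
      unfolding gkm_ring_ops by (rule K_mult[OF that])
    show "p \<otimes>\<^bsub>gkm_ring\<^esub> q \<in> ?K" if "p \<in> ?K" "q \<in> carrier gkm_ring" for p q
      using K_mult[OF that] unfolding gkm_ring_ops by (simp only: mult.commute)
  qed
  moreover have "?S \<subseteq> ?K"
  proof
    fix r assume "r \<in> ?S"
    then obtain f p where f: "pol f" "f 0 = 0" and p: "p \<in> carrier gkm_ring" and r: "r = f \<odot>\<^bsub>gkm_ring\<^esub> p" by auto
    have "r \<in> carrier gkm_ring"
      unfolding r gkm_ring_ops by (intro tup_in_gkm_ring gkm_pol_mult f gkm_ringD(1)[OF p])
    moreover have "coord r w 0 = 0" if "w \<in> carrier W" for w
      unfolding r gkm_ring_ops using coord_smult[OF f(1) gkm_ringD(1)[OF p] that t_closed(1)] f(2) by simp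
    ultimately show "r \<in> ?K" by simp
  qed
  ultimately show "augmentation \<subseteq> ?K" unfolding J by (rule M.genideal_minimal)
  show "?K \<subseteq> augmentation"
  proof
    fix p assume p: "p \<in> ?K"
    then have pg: "gkm p" using gkm_ringD(1) by blast
    interpret I: ideal "Idl\<^bsub>gkm_ring\<^esub> ?S" gkm_ring by (rule M.genideal_ideal[OF S])
    have "tup (\<lambda>v x. \<Sum>w\<in>A. coord p w x * generator (v \<otimes> w) x) \<in> Idl\<^bsub>gkm_ring\<^esub> ?S"
      if "A \<subseteq> carrier W" for A
      using finite_subset[OF that finite_W] that
    proof (induction A rule: finite_induct)
      case empty
      have "tup (\<lambda>v x. \<Sum>w\<in>{}. coord p w x * generator (v \<otimes> w) x) = tup (\<lambda>v x. 0)" by (rule tup_cong) simp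
      then show ?case using I.zero_closed by (simp only: gkm_ring_ops)
    next
      case (insert w A)
      then have w: "w \<in> carrier W" by auto
      have "(\<lambda>x\<in>t. coord p w x) \<odot>\<^bsub>gkm_ring\<^esub> tup (\<lambda>v. generator (v \<otimes> w)) \<in> ?S"
      proof -
        have "(\<lambda>x\<in>t. coord p w x) \<in> ?m" using coord_pol[OF pg w] p w by simp
        moreover have "tup (\<lambda>v. generator (v \<otimes> w)) \<in> carrier gkm_ring"
          by (intro tup_in_gkm_ring gkm_star gkm_generator w)
        ultimately show ?thesis by blast
      qed
      then have "(\<lambda>x\<in>t. coord p w x) \<odot>\<^bsub>gkm_ring\<^esub> tup (\<lambda>v. generator (v \<otimes> w)) \<in> Idl\<^bsub>gkm_ring\<^esub> ?S"
        using M.genideal_self[OF S] by blast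
      from I.a_closed[OF this insert.IH] insert.prems
      have "(\<lambda>x\<in>t. coord p w x) \<odot>\<^bsub>gkm_ring\<^esub> tup (\<lambda>v. generator (v \<otimes> w)) \<oplus>\<^bsub>gkm_ring\<^esub>
          tup (\<lambda>v x. \<Sum>w\<in>A. coord p w x * generator (v \<otimes> w) x) \<in> Idl\<^bsub>gkm_ring\<^esub> ?S" by blast
      moreover have "(\<lambda>x\<in>t. coord p w x) \<odot>\<^bsub>gkm_ring\<^esub> tup (\<lambda>v. generator (v \<otimes> w)) \<oplus>\<^bsub>gkm_ring\<^esub>
          tup (\<lambda>v x. \<Sum>w\<in>A. coord p w x * generator (v \<otimes> w) x) =
          tup (\<lambda>v x. \<Sum>w\<in>insert w A. coord p w x * generator (v \<otimes> w) x)"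
        unfolding gkm_ring_ops using insert by (intro tup_cong) simp
      ultimately show ?case by (simp only:)
    qed
    from this[OF order_refl] have "tup (combination (coord p)) \<in> Idl\<^bsub>gkm_ring\<^esub> ?S"
      by (simp only: combination_def)
    moreover have "tup (combination (coord p)) = p"
      using p by (subst (2) gkm_ringD(2)[of p], blast, intro tup_cong) (use coord_eq[OF pg] in simp)
    ultimately show "p \<in> augmentation" by (simp only: J)
  qed
qed

text \<open>Evaluating coordinates at 0 has the augmentation ideal as kernel, and constant
  coefficients reach every complex family.\<close>

theorem quotient_module_regular:
  "is_regular_rep complex_ring W quotient_module (\<lambda>w. image (star_act w))"
proof -
  interpret M: cring gkm_ring by (rule cring_gkm_ring)
  let ?J = augmentation and ?Q = "gkm_ring Quot augmentation" and ?H = quotient_module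
  interpret J: ideal ?J gkm_ring
    unfolding augmentation_def
    using ideal_of_lin gkm_ringD(1)
    by (intro M.genideal_ideal) (auto simp: gkm_ring_ops intro!: tup_in_gkm_ring gkm_pol_mult)
  interpret Q: cring ?Q by (rule J.quotient_is_cring[OF cring_gkm_ring])
  define cl where "cl = (\<lambda>p. ?J +>\<^bsub>gkm_ring\<^esub> p)"
  define k where "k = (\<lambda>c::complex. (\<lambda>H\<in>t. c) \<odot>\<^bsub>gkm_ring\<^esub> \<one>\<^bsub>gkm_ring\<^esub>)"
  have H: "carrier ?H = carrier ?Q" "mult ?H = mult ?Q" "one ?H = one ?Q" "zero ?H = zero ?Q" "add ?H = add ?Q"
    "smult ?H = (\<lambda>c x. cl (k c) \<otimes>\<^bsub>?Q\<^esub> x)"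
    by (simp_all add: quotient_module_def Let_def ring.defs module.defs cl_def k_def)
  have QC: "carrier ?Q = cl ` carrier gkm_ring"
    by (auto simp: FactRing_def A_RCOSETS_def' cl_def)
  have cl_add: "cl p \<oplus>\<^bsub>?Q\<^esub> cl q = cl (p \<oplus>\<^bsub>gkm_ring\<^esub> q)" if "p \<in> carrier gkm_ring" "q \<in> carrier gkm_ring" for p q
    using J.a_rcos_sum[OF that] by (simp add: FactRing_def cl_def)
  have cl_mult: "cl p \<otimes>\<^bsub>?Q\<^esub> cl q = cl (p \<otimes>\<^bsub>gkm_ring\<^esub> q)" if "p \<in> carrier gkm_ring" "q \<in> carrier gkm_ring" for p q
    using J.rcoset_mult_add[OF that] by (simp add: FactRing_def cl_def)
  have k: "k c = tup (\<lambda>v x. c)" for c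
    unfolding k_def gkm_ring_ops by (rule tup_cong) simp
  have k_closed: "k c \<in> carrier gkm_ring" for c
    unfolding k by (intro tup_in_gkm_ring gkm_const pol_const)
  have k_mult: "k c \<otimes>\<^bsub>gkm_ring\<^esub> p = tup (\<lambda>v x. c * p v x)" for c p
    unfolding k gkm_ring_ops by (rule tup_cong) simp
  have H_smult: "c \<odot>\<^bsub>?H\<^esub> cl p = cl (tup (\<lambda>v x. c * p v x))" if "p \<in> carrier gkm_ring" for c p
    by (simp only: H cl_mult[OF k_closed that] k_mult)
  have scale_closed: "tup (\<lambda>v x. c * p v x) \<in> carrier gkm_ring" if "p \<in> carrier gkm_ring" for c p
    by (intro tup_in_gkm_ring gkm_pol_mult pol_const gkm_ringD(1)[OF that])
  have J_mem: "p \<in> ?J \<longleftrightarrow> p \<in> carrier gkm_ring \<and> (\<forall>w\<in>carrier W. coord p w 0 = 0)" for p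
    by (simp only: augmentation_eq mem_Collect_eq)
  have cl_eq: "cl p = cl q \<longleftrightarrow> (\<forall>w\<in>carrier W. coord p w 0 = coord q w 0)"
    if p: "p \<in> carrier gkm_ring" and q: "q \<in> carrier gkm_ring" for p q
  proof -
    have "coord (p \<ominus>\<^bsub>gkm_ring\<^esub> q) w 0 = coord p w 0 - coord q w 0" if "w \<in> carrier W" for w
    proof -
      have "p \<ominus>\<^bsub>gkm_ring\<^esub> q = tup (\<lambda>v x. p v x + tup (\<lambda>v x. (-1) * q v x) v x)"
        unfolding gkm_ring_minus[OF p q] by (rule tup_cong) simp
      then show ?thesis
        using coord_add[OF gkm_ringD(1)[OF p] gkm_ringD(1)[OF scale_closed[OF q, of "-1"]] that t_closed(1)]
          coord_smult[OF pol_const[of "-1"] gkm_ringD(1)[OF q] that t_closed(1)] by simp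
    qed
    then have "p \<ominus>\<^bsub>gkm_ring\<^esub> q \<in> ?J \<longleftrightarrow> (\<forall>w\<in>carrier W. coord p w 0 = coord q w 0)"
      using M.minus_closed[OF p q] by (simp add: J_mem)
    then show ?thesis using M.quotient_eq_iff_same_a_r_cos[OF J.is_ideal p q] by (simp add: cl_def)
  qed
  define ev where "ev = (\<lambda>p. \<lambda>w\<in>carrier W. coord p w 0)"
  \<comment> \<open>\<open>ev\<close> is constant on each coset, so the choice of the representative
    is harmless.\<close>
  define \<phi> where "\<phi> = (\<lambda>x. ev (SOME p. p \<in> carrier gkm_ring \<and> cl p = x))"
  have ev_eq: "ev p = ev q \<longleftrightarrow> cl p = cl q" if "p \<in> carrier gkm_ring" "q \<in> carrier gkm_ring" for p q
    unfolding cl_eq[OF that] ev_def by (auto simp: fun_eq_iff restrict_def)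
  have \<phi>: "\<phi> (cl p) = ev p" if p: "p \<in> carrier gkm_ring" for p
  proof -
    have "\<exists>q. q \<in> carrier gkm_ring \<and> cl q = cl p" using p by blast
    from someI_ex[OF this] show ?thesis unfolding \<phi>_def using ev_eq p by blast
  qed
  have module: "Module.module complex_ring ?H"
  proof (rule moduleI[OF cring_complex_ring])
    show "abelian_group ?H"
    proof (rule abelian_groupI; unfold H)
      show "\<exists>y\<in>carrier ?Q. y \<oplus>\<^bsub>?Q\<^esub> x = \<zero>\<^bsub>?Q\<^esub>" if "x \<in> carrier ?Q" for x
        using Q.l_neg[OF that] Q.a_inv_closed[OF that] by blast
    qed (simp_all add: Q.a_ac)
  next
    fix c x assume "x \<in> carrier ?H"
    then show "c \<odot>\<^bsub>?H\<^esub> x \<in> carrier ?H"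
      using scale_closed by (auto simp: H(1) QC H_smult)
  next
    fix a b x assume "x \<in> carrier ?H"
    then obtain p where p: "p \<in> carrier gkm_ring" "x = cl p" by (auto simp: H(1) QC)
    show "(a \<oplus>\<^bsub>complex_ring\<^esub> b) \<odot>\<^bsub>?H\<^esub> x = a \<odot>\<^bsub>?H\<^esub> x \<oplus>\<^bsub>?H\<^esub> b \<odot>\<^bsub>?H\<^esub> x"
      unfolding p(2) H_smult[OF p(1)] H(5) cl_add[OF scale_closed[OF p(1)] scale_closed[OF p(1)]] gkm_ring_ops
      by (intro arg_cong[where f = cl] tup_cong) (simp add: algebra_simps)
    have "a \<odot>\<^bsub>?H\<^esub> (b \<odot>\<^bsub>?H\<^esub> x) = cl (tup (\<lambda>v x. a * tup (\<lambda>v x. b * p v x) v x))"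
      unfolding p(2) by (simp only: H_smult p(1) scale_closed)
    also have "\<dots> = (a \<otimes>\<^bsub>complex_ring\<^esub> b) \<odot>\<^bsub>?H\<^esub> x"
      unfolding p(2) H_smult[OF p(1)] by (intro arg_cong[where f = cl] tup_cong) (simp add: algebra_simps)
    finally show "(a \<otimes>\<^bsub>complex_ring\<^esub> b) \<odot>\<^bsub>?H\<^esub> x = a \<odot>\<^bsub>?H\<^esub> (b \<odot>\<^bsub>?H\<^esub> x)" by (rule sym)
  next
    fix a x y assume "x \<in> carrier ?H" "y \<in> carrier ?H"
    then obtain p q where p: "p \<in> carrier gkm_ring" "x = cl p" and q: "q \<in> carrier gkm_ring" "y = cl q"
      by (auto simp: H(1) QC)
    show "a \<odot>\<^bsub>?H\<^esub> (x \<oplus>\<^bsub>?H\<^esub> y) = a \<odot>\<^bsub>?H\<^esub> x \<oplus>\<^bsub>?H\<^esub> a \<odot>\<^bsub>?H\<^esub> y"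
      unfolding p(2) q(2) H(5) cl_add[OF p(1) q(1)] H_smult[OF p(1)] H_smult[OF q(1)] H_smult[OF M.a_closed[OF p(1) q(1)]]
        cl_add[OF scale_closed[OF p(1)] scale_closed[OF q(1)]]
      unfolding gkm_ring_ops
      by (intro arg_cong[where f = cl] tup_cong) (simp add: algebra_simps)
  next
    fix x assume "x \<in> carrier ?H"
    then obtain p where p: "p \<in> carrier gkm_ring" "x = cl p" by (auto simp: H(1) QC)
    have "tup (\<lambda>v x. 1 * p v x) = p" using gkm_ringD(2)[OF p(1)] by simp
    then show "\<one>\<^bsub>complex_ring\<^esub> \<odot>\<^bsub>?H\<^esub> x = x"
      unfolding p(2) H_smult[OF p(1)] by (simp only: complex_ring_simps)
  qed
  have star_cl: "star_act u ` cl p = cl (star_act u p)" if u: "u \<in> carrier W" and p: "p \<in> carrier gkm_ring" for u p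
  proof -
    have star_add: "star_act u (j \<oplus>\<^bsub>gkm_ring\<^esub> p) = star_act u j \<oplus>\<^bsub>gkm_ring\<^esub> star_act u p"
      if "u \<in> carrier W" for u j p
      unfolding gkm_ring_ops using that by (auto simp: star_act_def intro!: restrict_ext)
    have star_J: "star_act u j \<in> ?J" if "j \<in> ?J" "u \<in> carrier W" for j u
      using that star_act_closed coord_star gkm_ringD(1) by (auto simp: J_mem)
    have star_star: "star_act u (star_act (inv u) j) = j" if "j \<in> carrier gkm_ring" for j
    proof (rule gkm_ring_eqI)
      show "star_act u (star_act (inv u) j) \<in> carrier gkm_ring"
        by (intro star_act_closed u inv_closed that)
      show "star_act u (star_act (inv u) j) v x = j v x" if "v \<in> carrier W" for v x
        using u that by (simp add: star_act_def m_assoc)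
    qed (rule that)
    have cl: "cl p = (\<lambda>j. j \<oplus>\<^bsub>gkm_ring\<^esub> p) ` ?J" for p
      by (auto simp: cl_def a_r_coset_def')
    \<comment> \<open>Equality and not just inclusion is needed, because the induced map takes the
      image of a coset as a set.\<close>
    have "star_act u ` ?J = ?J"
    proof (intro equalityI subsetI)
      fix j assume j: "j \<in> ?J"
      then have "star_act (inv u) j \<in> ?J" using star_J u by simp
      moreover have "j = star_act u (star_act (inv u) j)" using star_star j J_mem by simp
      ultimately show "j \<in> star_act u ` ?J" by blast
    qed (use star_J u in blast)
    moreover have "star_act u ` cl p = (\<lambda>j. j \<oplus>\<^bsub>gkm_ring\<^esub> star_act u p) ` (star_act u ` ?J)"
      unfolding cl image_image by (intro image_cong refl star_add u)
    ultimately show ?thesis by (simp only: cl)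
  qed
  show ?thesis
    unfolding is_regular_rep_def
  proof (intro conjI exI[of _ \<phi>] ballI)
    show "Group.group W" by unfold_locales
    show "finite (carrier W)" by (rule finite_W)
    show "Module.module complex_ring ?H" by (rule module)
    show "image (star_act u) \<in> carrier ?H \<rightarrow> carrier ?H" if "u \<in> carrier W" for u
      using star_cl[OF that] star_act_closed[OF that] by (auto simp: H(1) QC)
    show "bij_betw \<phi> (carrier ?H) (carrier (tuple_algebra complex_ring (carrier W)))"
      unfolding bij_betw_def
    proof
      show "inj_on \<phi> (carrier ?H)" by (rule inj_onI) (auto simp: H(1) QC \<phi> ev_eq)
      show "\<phi> ` carrier ?H = carrier (tuple_algebra complex_ring (carrier W))"
      proof
        show "\<phi> ` carrier ?H \<subseteq> carrier (tuple_algebra complex_ring (carrier W))"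
          by (auto simp: H(1) QC \<phi> ev_def)
        show "carrier (tuple_algebra complex_ring (carrier W)) \<subseteq> \<phi> ` carrier ?H"
        proof
          fix g assume g: "g \<in> carrier (tuple_algebra complex_ring (carrier W))"
          define p where "p = tup (combination (\<lambda>w x. g w))"
          have p: "p \<in> carrier gkm_ring" unfolding p_def by (intro tup_in_gkm_ring gkm_combination pol_const)
          have "coord p w 0 = g w" if "w \<in> carrier W" for w
            unfolding p_def using coord_combination[of "\<lambda>w x. g w", OF pol_const that t_closed(1)] .
          then have "ev p = g" using g by (auto simp: ev_def fun_eq_iff PiE_iff extensional_def)
          then have "\<phi> (cl p) = g" using \<phi>[OF p] by simp
          then show "g \<in> \<phi> ` carrier ?H" using p by (auto simp: H(1) QC)
        qed
      qed
    qed
  next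
    fix x y assume "x \<in> carrier ?H" "y \<in> carrier ?H"
    then obtain p q where p: "p \<in> carrier gkm_ring" "x = cl p" and q: "q \<in> carrier gkm_ring" "y = cl q"
      by (auto simp: H(1) QC)
    show "\<phi> (x \<oplus>\<^bsub>?H\<^esub> y) = \<phi> x \<oplus>\<^bsub>tuple_algebra complex_ring (carrier W)\<^esub> \<phi> y"
      unfolding p(2) q(2) H(5) cl_add[OF p(1) q(1)] \<phi>[OF p(1)] \<phi>[OF q(1)] \<phi>[OF M.a_closed[OF p(1) q(1)]]
      unfolding ev_def tuple_algebra_simps gkm_ring_ops
      using coord_add[OF gkm_ringD(1)[OF p(1)] gkm_ringD(1)[OF q(1)] _ t_closed(1)]
      by (intro restrict_ext) simp
  next
    fix c x assume "x \<in> carrier ?H"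
    then obtain p where p: "p \<in> carrier gkm_ring" "x = cl p" by (auto simp: H(1) QC)
    show "\<phi> (c \<odot>\<^bsub>?H\<^esub> x) = c \<odot>\<^bsub>tuple_algebra complex_ring (carrier W)\<^esub> \<phi> x"
      unfolding p(2) H_smult[OF p(1)] \<phi>[OF p(1)] \<phi>[OF scale_closed[OF p(1)]]
      unfolding ev_def tuple_algebra_simps
      using coord_smult[OF pol_const[of c] gkm_ringD(1)[OF p(1)] _ t_closed(1)]
      by (intro restrict_ext) simp
  next
    fix u x assume u: "u \<in> carrier W" and "x \<in> carrier ?H"
    then obtain p where p: "p \<in> carrier gkm_ring" "x = cl p" by (auto simp: H(1) QC)
    show "\<phi> (star_act u ` x) = regular_action W u (\<phi> x)"
      unfolding p(2) star_cl[OF u p(1)] \<phi>[OF p(1)] \<phi>[OF star_act_closed[OF u p(1)]] regular_action_def ev_def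
      using coord_star[OF u gkm_ringD(1)[OF p(1)] _ t_closed(1)] u
      by (intro restrict_ext) simp
  qed
qed

end

section \<open>Polynomials on matrices and Lie algebras\<close>

lemma matrix_scale_nth [simp]: "matrix_scale c X $ i $ j = c * X $ i $ j"
  by (simp add: matrix_scale_def)

lemma matrix_scale_mult:
  "matrix_scale c X ** Y = matrix_scale c (X ** Y)" "X ** matrix_scale c Y = matrix_scale c (X ** Y)"
  by (simp_all add: vec_eq_iff matrix_matrix_mult_def sum_distrib_left algebra_simps)

lemma matrix_add_rdistrib: "(A + B) ** C = A ** C + B ** (C :: complex^'n^'n)"
  by (simp add: vec_eq_iff matrix_matrix_mult_def sum.distrib algebra_simps)

lemma vector_space_matrix_scale: "vector_space (matrix_scale :: complex \<Rightarrow> complex^'n^'n \<Rightarrow> complex^'n^'n)"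
  by unfold_locales (simp_all add: vec_eq_iff algebra_simps)

lemma matrix_polynomials_alt:
  "matrix_polynomials = generate_ring (tuple_algebra complex_ring UNIV)
     ({\<lambda>A. c | c. True} \<union> {\<lambda>A. A $ i $ j | i j. True})"
  unfolding matrix_polynomials_def generated_algebra_def restrict_UNIV ..

lemma matrix_polynomials_const: "(\<lambda>A. c) \<in> matrix_polynomials"
  and matrix_polynomials_entry: "(\<lambda>A. A $ i $ j) \<in> matrix_polynomials"
  unfolding matrix_polynomials_alt by (rule generate_ring.incl; blast)+

lemma matrix_polynomials_add:
  "f \<in> matrix_polynomials \<Longrightarrow> g \<in> matrix_polynomials \<Longrightarrow> (\<lambda>A. f A + g A) \<in> matrix_polynomials"
  unfolding matrix_polynomials_alt
  by (drule (1) generate_ring.eng_add) (simp only: tuple_algebra_simps complex_ring_simps restrict_UNIV)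

lemma matrix_polynomials_mult:
  "f \<in> matrix_polynomials \<Longrightarrow> g \<in> matrix_polynomials \<Longrightarrow> (\<lambda>A. f A * g A) \<in> matrix_polynomials"
  unfolding matrix_polynomials_alt
  by (drule (1) generate_ring.eng_mult) (simp only: tuple_algebra_simps complex_ring_simps restrict_UNIV)

lemma matrix_polynomials_induct [consumes 1, case_names const entry add mult]:
  assumes f: "f \<in> matrix_polynomials" and const: "\<And>c. P (\<lambda>A. c)" and entry: "\<And>i j. P (\<lambda>A. A $ i $ j)"
    and add: "\<And>f g. f \<in> matrix_polynomials \<Longrightarrow> g \<in> matrix_polynomials \<Longrightarrow> P f \<Longrightarrow> P g \<Longrightarrow> P (\<lambda>A. f A + g A)"
    and mult: "\<And>f g. f \<in> matrix_polynomials \<Longrightarrow> g \<in> matrix_polynomials \<Longrightarrow> P f \<Longrightarrow> P g \<Longrightarrow> P (\<lambda>A. f A * g A)"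
  shows "P f"
proof -
  have "f \<in> matrix_polynomials \<and> P f"
    using f unfolding matrix_polynomials_alt
  proof induction
    case (a_inv f)
    have f: "f \<in> matrix_polynomials" "P f"
      using a_inv by (auto simp: matrix_polynomials_alt)
    have "\<ominus>\<^bsub>tuple_algebra complex_ring UNIV\<^esub> f = (\<lambda>A. (-1) * f A)"
      by (subst tuple_algebra_a_inv[OF cring_complex_ring]) auto
    then show ?case
      using mult[OF matrix_polynomials_const f(1) const f(2), of "-1"] matrix_polynomials_mult[OF matrix_polynomials_const f(1), of "-1"]
      by (simp add: matrix_polynomials_alt)
  next
    case (eng_add f g)
    then show ?case using add[of f g] matrix_polynomials_add[of f g]
      by (simp add: matrix_polynomials_alt)
  next
    case (eng_mult f g)
    then show ?case using mult[of f g] matrix_polynomials_mult[of f g]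
      by (simp add: matrix_polynomials_alt)
  next
    case one
    then show ?case using const[of 1] matrix_polynomials_const[of 1]
      by (simp add: matrix_polynomials_alt)
  next
    case (incl f)
    then consider c where "f = (\<lambda>A. c)" | i j where "f = (\<lambda>A. A $ i $ j)" by auto
    then show ?case
      using const entry matrix_polynomials_const matrix_polynomials_entry
      by cases (simp_all add: matrix_polynomials_alt)
  qed
  then show ?thesis ..
qed

lemma matrix_polynomials_mult_const: "f \<in> matrix_polynomials \<Longrightarrow> (\<lambda>A. c * f A) \<in> matrix_polynomials"
  by (rule matrix_polynomials_mult[OF matrix_polynomials_const])

lemma matrix_polynomials_diff: "f \<in> matrix_polynomials \<Longrightarrow> g \<in> matrix_polynomials \<Longrightarrow> (\<lambda>A. f A - g A) \<in> matrix_polynomials"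
  using matrix_polynomials_add[OF _ matrix_polynomials_mult_const, of f g "-1"] by simp

lemma matrix_polynomials_sum:
  "finite I \<Longrightarrow> (\<And>i. i \<in> I \<Longrightarrow> f i \<in> matrix_polynomials) \<Longrightarrow> (\<lambda>A. \<Sum>i\<in>I. f i A) \<in> matrix_polynomials"
  by (induction I rule: finite_induct) (auto intro: matrix_polynomials_const matrix_polynomials_add)

lemma matrix_polynomials_conj: "(\<lambda>A. (M ** A ** N) $ i $ j) \<in> matrix_polynomials"
  unfolding matrix_matrix_mult_def sum_distrib_right sum_distrib_left
  by (simp add: sum_distrib_right)
     (intro matrix_polynomials_sum finite matrix_polynomials_mult matrix_polynomials_const matrix_polynomials_entry)

lemma matrix_polynomials_compose_conj:
  "f \<in> matrix_polynomials \<Longrightarrow> (\<lambda>A. f (M ** A ** N)) \<in> matrix_polynomials"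
  by (induction rule: matrix_polynomials_induct)
     (auto intro: matrix_polynomials_const matrix_polynomials_conj matrix_polynomials_add matrix_polynomials_mult)

text \<open>The derivative at the identity is linear in the direction, by the sum and product rules
  along the generation of polynomials. This is what makes the tangent space a subspace.\<close>

lemma matrix_polynomials_derivative:
  assumes "f \<in> matrix_polynomials"
  shows "\<exists>L. (\<forall>X. ((\<lambda>z. f (mat 1 + matrix_scale z X)) has_field_derivative L X) (at 0)) \<and>
    (\<forall>X Y. L (X + Y) = L X + L Y) \<and> (\<forall>c X. L (matrix_scale c X) = c * L X)"
  using assms
proof (induction rule: matrix_polynomials_induct)
  case (const c)
  then show ?case by (intro exI[of _ "\<lambda>X. 0"]) auto
next
  case (entry i j)
  have "((\<lambda>z. (mat 1 + matrix_scale z X) $ i $ j) has_field_derivative X $ i $ j) (at 0)" for X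
    by (auto intro!: derivative_eq_intros)
  then show ?case by (intro exI[of _ "\<lambda>X. X $ i $ j"]) auto
next
  case (add f g)
  then obtain L L' where L: "\<And>X. ((\<lambda>z. f (mat 1 + matrix_scale z X)) has_field_derivative L X) (at 0)"
      "\<And>X Y. L (X + Y) = L X + L Y" "\<And>c X. L (matrix_scale c X) = c * L X"
    and L': "\<And>X. ((\<lambda>z. g (mat 1 + matrix_scale z X)) has_field_derivative L' X) (at 0)"
      "\<And>X Y. L' (X + Y) = L' X + L' Y" "\<And>c X. L' (matrix_scale c X) = c * L' X" by blast
  show ?case
    by (intro exI[of _ "\<lambda>X. L X + L' X"] conjI allI, rule DERIV_add[OF L(1) L'(1)])
       (simp_all add: L(2,3) L'(2,3) algebra_simps)
next
  case (mult f g)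
  then obtain L L' where L: "\<And>X. ((\<lambda>z. f (mat 1 + matrix_scale z X)) has_field_derivative L X) (at 0)"
      "\<And>X Y. L (X + Y) = L X + L Y" "\<And>c X. L (matrix_scale c X) = c * L X"
    and L': "\<And>X. ((\<lambda>z. g (mat 1 + matrix_scale z X)) has_field_derivative L' X) (at 0)"
      "\<And>X Y. L' (X + Y) = L' X + L' Y" "\<And>c X. L' (matrix_scale c X) = c * L' X" by blast
  have 0: "matrix_scale 0 X = 0" for X :: "complex^'a^'a" by (simp add: vec_eq_iff)
  have "((\<lambda>z. f (mat 1 + matrix_scale z X) * g (mat 1 + matrix_scale z X)) has_field_derivative
      L X * g (mat 1) + L' X * f (mat 1)) (at 0)" for X
    using DERIV_mult[OF L(1)[of X] L'(1)[of X]] by (simp add: 0)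
  then show ?case
    by (intro exI[of _ "\<lambda>X. L X * g (mat 1) + L' X * f (mat 1)"] conjI allI, blast)
       (simp_all add: L(2,3) L'(2,3) algebra_simps)
qed

lemma lie_algebra_subspace:
  fixes G :: "(complex^'n^'n) set"
  shows "module.subspace matrix_scale (lie_algebra G)"
proof -
  interpret vector_space matrix_scale by (rule vector_space_matrix_scale)
  define L where "L = (\<lambda>f X. deriv (\<lambda>z. f (mat 1 + matrix_scale z (X :: complex^'n^'n)) :: complex) 0)"
  have L: "((\<lambda>z. f (mat 1 + matrix_scale z X)) has_field_derivative 0) (at 0) \<longleftrightarrow> L f X = 0"
    "L f (X + Y) = L f X + L f Y" "L f (matrix_scale c X) = c * L f X"
    if f: "f \<in> matrix_polynomials" for f :: "complex^'n^'n \<Rightarrow> complex" and X Y c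
  proof -
    obtain M where M: "\<forall>X. ((\<lambda>z. f (mat 1 + matrix_scale z X)) has_field_derivative M X) (at 0)"
      "\<forall>X Y. M (X + Y) = M X + M Y" "\<forall>c X. M (matrix_scale c X) = c * M X"
      using matrix_polynomials_derivative[OF f] by blast
    have LM: "L f X = M X" for X unfolding L_def by (rule DERIV_imp_deriv) (rule M(1)[rule_format])
    show "((\<lambda>z. f (mat 1 + matrix_scale z X)) has_field_derivative 0) (at 0) \<longleftrightarrow> L f X = 0"
    proof
      assume "((\<lambda>z. f (mat 1 + matrix_scale z X)) has_field_derivative 0) (at 0)"
      from DERIV_unique[OF M(1)[rule_format] this] show "L f X = 0" by (simp only: LM)
    next
      assume "L f X = 0"
      then show "((\<lambda>z. f (mat 1 + matrix_scale z X)) has_field_derivative 0) (at 0)"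
        using M(1)[rule_format, of X] by (simp only: LM)
    qed
    show "L f (X + Y) = L f X + L f Y" "L f (matrix_scale c X) = c * L f X" unfolding LM using M(2,3) by blast+
  qed
  have eq: "lie_algebra G = {X. \<forall>f\<in>matrix_polynomials. (\<forall>A\<in>G. f A = 0) \<longrightarrow> L f X = 0}"
    unfolding lie_algebra_def using L(1) by blast
  have "L f 0 = 0" if "f \<in> matrix_polynomials" for f using L(2)[OF that, of 0 0] by simp
  then show ?thesis unfolding eq subspace_def by (auto simp: L(2,3))
qed

text \<open>For linear \<open>f\<close> the derivative of \<open>z \<mapsto> f(1 + zX)\<close> is
  \<open>f(X)\<close>. Linear equations valid on the group are thus inherited by its Lie
  algebra.\<close>

lemma lie_algebra_linear:
  assumes "X \<in> lie_algebra G" "f \<in> matrix_polynomials" "\<And>A. A \<in> G \<Longrightarrow> f A = 0"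
    and "\<And>A B. f (A + B) = f A + f B" "\<And>c A. f (matrix_scale c A) = c * f A"
  shows "f X = 0"
proof -
  have "((\<lambda>z. f (mat 1 + matrix_scale z X)) has_field_derivative 0) (at 0)"
    using assms by (auto simp: lie_algebra_def)
  then have "((\<lambda>z. f (mat 1) + z * f X) has_field_derivative 0) (at 0)" using assms by simp
  moreover have "((\<lambda>z. f (mat 1) + z * f X) has_field_derivative f X) (at 0)"
    by (auto intro!: derivative_eq_intros)
  ultimately show ?thesis using DERIV_unique by blast
qed

text \<open>Composition with conjugation maps polynomials vanishing on \<open>G\<close> to such
  polynomials, and conjugation is linear and fixes the identity.\<close>

lemma lie_algebra_conj:
  fixes G :: "(complex^'n^'n) set"
  assumes "X \<in> lie_algebra G" "M ** N = mat 1" "\<And>A. A \<in> G \<Longrightarrow> M ** A ** N \<in> G"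
  shows "M ** X ** N \<in> lie_algebra G"
  unfolding lie_algebra_def
proof (intro CollectI ballI impI)
  fix f :: "complex^'n^'n \<Rightarrow> complex" assume f: "f \<in> matrix_polynomials" "\<forall>A\<in>G. f A = 0"
  have "((\<lambda>z. f (M ** (mat 1 + matrix_scale z X) ** N)) has_field_derivative 0) (at 0)"
    using assms(1) matrix_polynomials_compose_conj[OF f(1), of M N] f(2) assms(3) by (auto simp: lie_algebra_def)
  moreover have "M ** (mat 1 + matrix_scale z X) ** N = mat 1 + matrix_scale z (M ** X ** N)" for z
    by (simp add: matrix_add_ldistrib matrix_add_rdistrib matrix_scale_mult assms(2))
  ultimately show "((\<lambda>z. f (mat 1 + matrix_scale z (M ** X ** N))) has_field_derivative 0) (at 0)" by simp
qed

section \<open>Matrix groups\<close>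

lemma matrix_inv_mult [simp]:
  assumes "invertible A" shows "A ** matrix_inv A = mat 1" "matrix_inv A ** A = mat 1"
  using someI_ex[OF assms[unfolded invertible_def]] by (auto simp: matrix_inv_def)

lemma matrix_inv_unique:
  assumes "A ** B = mat 1" "B ** A = mat 1" shows "matrix_inv A = B"
proof -
  have "invertible A" using assms by (auto simp: invertible_def)
  then have "matrix_inv A = matrix_inv A ** (A ** B)" by (simp add: assms)
  also have "\<dots> = B" using \<open>invertible A\<close> by (simp add: matrix_mul_assoc)
  finally show ?thesis .
qed

lemma invertible_matrix_inv [simp]: "invertible A \<Longrightarrow> invertible (matrix_inv A)"
  using matrix_inv_mult[of A] unfolding invertible_def by blast

lemma matrix_inv_matrix_mult:
  fixes A B :: "complex^'n^'n"
  assumes "invertible A" "invertible B" shows "matrix_inv (A ** B) = matrix_inv B ** matrix_inv A"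
proof (rule matrix_inv_unique)
  have "A ** B ** (matrix_inv B ** matrix_inv A) = A ** (B ** matrix_inv B) ** matrix_inv A"
    by (simp only: matrix_mul_assoc)
  then show "A ** B ** (matrix_inv B ** matrix_inv A) = mat 1" using assms by simp
  have "matrix_inv B ** matrix_inv A ** (A ** B) = matrix_inv B ** (matrix_inv A ** A) ** B"
    by (simp only: matrix_mul_assoc)
  then show "matrix_inv B ** matrix_inv A ** (A ** B) = mat 1" using assms by simp
qed

lemma GL_simps [simp]: "carrier GL = {A. invertible A}" "A \<otimes>\<^bsub>GL\<^esub> B = A ** B" "\<one>\<^bsub>GL\<^esub> = mat 1"
  by (simp_all add: GL_def)

lemma group_GL: "Group.group (GL :: (complex^'n^'n) monoid)"
proof (rule groupI)
  show "\<exists>y\<in>carrier GL. y \<otimes>\<^bsub>GL\<^esub> x = \<one>\<^bsub>GL\<^esub>" if "x \<in> carrier GL" for x :: "complex^'n^'n"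
    using that by (intro bexI[of _ "matrix_inv x"]) auto
  show "\<one>\<^bsub>GL\<^esub> \<in> carrier GL" by (auto simp: invertible_def intro: exI[of _ "mat 1"])
qed (auto intro: invertible_mult simp: matrix_mul_assoc)

lemma GL_inv: "invertible A \<Longrightarrow> inv\<^bsub>GL\<^esub> A = matrix_inv (A :: complex^'n^'n)"
  using group.inv_equality[OF group_GL, of "matrix_inv A" A] by simp

section \<open>The normalizer of the torus and its cosets\<close>

locale group_with_torus =
  fixes G T :: "(complex^'n^'n) set"
  assumes subgroup_G: "subgroup G GL" and subgroup_T: "subgroup T GL" and T_subset: "T \<subseteq> G"
begin

abbreviation N where "N \<equiv> normalizer (matrix_group G) T"
abbreviation W where "W \<equiv> weyl_group G T"

lemma group_G: "Group.group (matrix_group G)"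
  using subgroup.subgroup_is_group[OF subgroup_G group_GL] .

lemma invertible_G: "A \<in> G \<Longrightarrow> invertible A"
  using subgroup.subset[OF subgroup_G] by auto

lemma G_inv: "A \<in> G \<Longrightarrow> inv\<^bsub>matrix_group G\<^esub> A = matrix_inv A"
  using group.m_inv_consistent[OF group_GL subgroup_G] GL_inv[OF invertible_G] by simp

lemma matrix_inv_G: "A \<in> G \<Longrightarrow> matrix_inv A \<in> G"
  using group.inv_closed[OF group_G, of A] G_inv by simp

lemma mult_G: "A \<in> G \<Longrightarrow> B \<in> G \<Longrightarrow> A ** B \<in> G"
  using subgroup.m_closed[OF subgroup_G] by simp

lemma subgroup_T_G: "subgroup T (matrix_group G)"
  using group.subgroup_incl[OF group_GL subgroup_T subgroup_G T_subset] .

lemma subgroup_N: "subgroup N (matrix_group G)"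
  using group.normalizer_imp_subgroup[OF group_G] subgroup.subset[OF subgroup_T_G] by simp

lemma normal_T: "T \<lhd> (matrix_group G\<lparr>carrier := N\<rparr>)"
  using group.subgroup_in_normalizer[OF group_G subgroup_T_G] .

lemma group_W: "Group.group W"
  using normal.factorgroup_is_group[OF normal_T] by (simp add: weyl_group_def)

lemma N_G: "n \<in> N \<Longrightarrow> n \<in> G"
  using subgroup.subset[OF subgroup_N] by auto

lemma N_conj:
  assumes "n \<in> N" "A \<in> T" shows "n ** A ** matrix_inv n \<in> T"
proof -
  have "n <#\<^bsub>matrix_group G\<^esub> T #>\<^bsub>matrix_group G\<^esub> (inv\<^bsub>matrix_group G\<^esub> n) = T"
    using assms(1) T_subset unfolding normalizer_def stabilizer_def by auto
  then have "n <#\<^bsub>matrix_group G\<^esub> T #>\<^bsub>matrix_group G\<^esub> matrix_inv n = T"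
    using G_inv[OF N_G[OF assms(1)]] by simp
  moreover have "n ** A ** matrix_inv n \<in> n <#\<^bsub>matrix_group G\<^esub> T #>\<^bsub>matrix_group G\<^esub> matrix_inv n"
    using assms(2) by (auto simp: l_coset_def r_coset_def)
  ultimately show ?thesis by simp
qed

lemma N_inv: "n \<in> N \<Longrightarrow> matrix_inv n \<in> N"
  using subgroup.m_inv_closed[OF subgroup_N] G_inv[OF N_G] by metis

lemma weyl_carrier: "carrier W = {{A ** n | A. A \<in> T} | n. n \<in> N}"
  unfolding weyl_group_def FactGroup_def RCOSETS_def r_coset_def by auto

lemma weyl_mult: "v \<otimes>\<^bsub>W\<^esub> w = {A ** B | A B. A \<in> v \<and> B \<in> w}"
  unfolding weyl_group_def FactGroup_def set_mult_def by auto

lemma weyl_one: "\<one>\<^bsub>W\<^esub> = T"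
  unfolding weyl_group_def FactGroup_def by simp

lemma weyl_mem_N:
  assumes "w \<in> carrier W" "n \<in> w" shows "n \<in> N"
proof -
  obtain m A where "m \<in> N" "A \<in> T" "n = A ** m" using assms by (auto simp: weyl_carrier)
  moreover have "A \<in> N" using \<open>A \<in> T\<close> normal_imp_subgroup[OF normal_T] subgroup.subset by fastforce
  ultimately show ?thesis using subgroup.m_closed[OF subgroup_N] by simp
qed

lemma weyl_nonempty: "w \<in> carrier W \<Longrightarrow> \<exists>n. n \<in> w"
  using subgroup.one_closed[OF subgroup_T] by (auto simp: weyl_carrier)

lemma weyl_mem_unique:
  assumes "w \<in> carrier W" "n \<in> w" "m \<in> w" shows "\<exists>A\<in>T. m = A ** n"
proof -
  obtain k A B where k: "k \<in> N" "A \<in> T" "B \<in> T" "n = A ** k" "m = B ** k" using assms by (auto simp: weyl_carrier)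
  have "invertible A" using k T_subset invertible_G by auto
  then have "B ** matrix_inv A ** n = m"
    unfolding k by (metis matrix_inv_mult(2) matrix_mul_assoc matrix_mul_lid)
  moreover have "B ** matrix_inv A \<in> T"
    using subgroup.m_closed[OF subgroup_T k(3)] subgroup.m_inv_closed[OF subgroup_T k(2)] GL_inv[OF \<open>invertible A\<close>] by simp
  ultimately show ?thesis by metis
qed

end

section \<open>Tori act diagonalizably\<close>

lemma poly_eq_off_zero:
  fixes p q :: "complex poly"
  assumes "\<And>z. z \<noteq> 0 \<Longrightarrow> poly p z = poly q z" shows "p = q"
proof -
  have "poly ([:0, 1:] * (p - q)) z = 0" for z using assms[of z] by (cases "z = 0") auto
  then have "[:0, 1:] * (p - q) = 0" using poly_all_0_iff_0 by blast
  then show ?thesis by simp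
qed

section \<open>Cocharacters of the coordinate torus\<close>

definition cochar :: "'n \<Rightarrow> complex \<Rightarrow> complex^'n^'n" where
  "cochar i z = (\<chi> k l. if k = l then (if k = i then z else 1) else 0)"

lemma cochar_mem: "z \<noteq> 0 \<Longrightarrow> i \<in> I \<Longrightarrow> cochar i z \<in> coordinate_torus I"
  by (auto simp: cochar_def coordinate_torus_def)

lemma coordinate_torus_mult:
  assumes "A \<in> coordinate_torus I" "B \<in> coordinate_torus J"
  shows "(A ** B) $ k $ l = (if k = l then A $ k $ k * B $ k $ k else 0)"
proof -
  have "(A ** B) $ k $ l = (\<Sum>j\<in>UNIV. A $ k $ j * B $ j $ l)" by (simp add: matrix_matrix_mult_def)
  also have "\<dots> = (\<Sum>j\<in>UNIV. if j = k then A $ k $ k * B $ k $ l else 0)"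
    using assms by (intro sum.cong refl) (auto simp: coordinate_torus_def)
  also have "\<dots> = A $ k $ k * B $ k $ l" by simp
  finally show ?thesis using assms(2) by (auto simp: coordinate_torus_def)
qed

lemma coordinate_torus_commute:
  assumes "A \<in> coordinate_torus I" "B \<in> coordinate_torus J"
  shows "A ** B = B ** A"
  by (simp only: vec_eq_iff coordinate_torus_mult[OF assms] coordinate_torus_mult[OF assms(2,1)] mult.commute)
     simp

lemma cochar_mult:
  assumes "z \<noteq> 0" "z' \<noteq> 0"
  shows "cochar i z ** cochar i z' = cochar i (z * z')"
proof -
  have "(cochar i z ** cochar i z') $ k $ l = cochar i (z * z') $ k $ l" for k l
    unfolding coordinate_torus_mult[OF cochar_mem[OF assms(1), of i UNIV, OF UNIV_I]
        cochar_mem[OF assms(2), of i UNIV, OF UNIV_I]]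
    by (simp add: cochar_def)
  then show ?thesis by (simp add: vec_eq_iff)
qed

text \<open>Regular functions have powers of the determinant as denominators; on a cocharacter these
  become powers of \<open>z\<close>.\<close>

lemma det_cochar: "det (cochar i z) = z"
proof -
  have "det (cochar i z) = (\<Prod>k\<in>UNIV. cochar i z $ k $ k)"
    by (rule det_diagonal) (simp add: cochar_def)
  also have "\<dots> = (\<Prod>k\<in>UNIV. if k = i then z else 1)" by (simp add: cochar_def)
  finally show ?thesis by simp
qed

lemma matrix_polynomials_cochar:
  "f \<in> matrix_polynomials \<Longrightarrow> \<exists>q. \<forall>z. f (cochar i z) = poly q z"
proof (induction rule: matrix_polynomials_induct)
  case (const c)
  show ?case by (rule exI[of _ "[:c:]"]) simp
next
  case (entry k l)
  show ?case
    by (rule exI[of _ "if k = l then (if k = i then [:0, 1:] else 1) else 0"]) (simp add: cochar_def)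
next
  case (add f g)
  then show ?case by (metis poly_add)
next
  case (mult f g)
  then show ?case by (metis poly_mult)
qed

lemma coordinate_torus_insert:
  assumes "A \<in> coordinate_torus (insert i J)" "i \<notin> J"
  obtains B z where "B \<in> coordinate_torus J" "z \<noteq> 0" "A = B ** cochar i z"
proof -
  define B where "B = (\<chi> k l. if k = l then (if k = i then 1 else A $ k $ k) else 0)"
  have B: "B \<in> coordinate_torus J"
    using assms by (auto simp: B_def coordinate_torus_def)
  have z: "A $ i $ i \<noteq> 0" using assms by (auto simp: coordinate_torus_def)
  have off: "k \<noteq> l \<Longrightarrow> A $ k $ l = 0" for k l using assms(1) by (simp add: coordinate_torus_def)
  have "A $ k $ l = (B ** cochar i (A $ i $ i)) $ k $ l" for k l
    unfolding coordinate_torus_mult[OF B cochar_mem[OF z, of i UNIV, OF UNIV_I]]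
    using off[of k l] by (simp add: B_def cochar_def)
  then have "A = B ** cochar i (A $ i $ i)" unfolding vec_eq_iff by blast
  with B z that show ?thesis by blast
qed

text \<open>A one-parameter group is \<open>z\<^sup>-\<^sup>m (M\<^sub>0 + z M\<^sub>1 + \<dots> + z\<^sup>d M\<^sub>d)\<close>, and comparing coefficients shows that
  the image of each \<open>M\<^sub>r\<close> consists of eigenvectors.\<close>

lemma one_parameter_group:
  fixes \<gamma> :: "complex \<Rightarrow> complex^'n^'n"
  assumes poly: "\<And>k l. \<exists>q m. \<forall>z. z \<noteq> 0 \<longrightarrow> \<gamma> z $ k $ l = poly q z / z ^ m"
    and mult: "\<And>z z'. z \<noteq> 0 \<Longrightarrow> z' \<noteq> 0 \<Longrightarrow> \<gamma> z ** \<gamma> z' = \<gamma> (z * z')" and one: "\<gamma> 1 = mat 1"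
  shows "\<exists>(M :: nat \<Rightarrow> complex^'n^'n) d. (\<Sum>r\<le>d. M r) = mat 1 \<and>
    (\<forall>r z u. z \<noteq> 0 \<longrightarrow> (\<exists>c. \<gamma> z *v (M r *v u) = c *s (M r *v u))) \<and>
    (\<forall>r A. (\<forall>z. z \<noteq> 0 \<longrightarrow> A ** \<gamma> z = \<gamma> z ** A) \<longrightarrow> A ** M r = M r ** A)"
proof -
  obtain q0 m0 where q0: "\<And>k l z. z \<noteq> 0 \<Longrightarrow> \<gamma> z $ k $ l = poly (q0 k l) z / z ^ m0 k l"
    using poly by metis
  \<comment> \<open>Any common exponent for the denominators would do, and the sum of all of them is
    one.\<close>
  define m where "m = (\<Sum>k\<in>UNIV. \<Sum>l\<in>UNIV. m0 k l)"
  have m: "m0 k l \<le> m" for k l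
  proof -
    have "m0 k l \<le> (\<Sum>l\<in>UNIV. m0 k l)" by (rule member_le_sum) auto
    also have "\<dots> \<le> m" unfolding m_def by (rule member_le_sum[of k UNIV "\<lambda>k. \<Sum>l\<in>UNIV. m0 k l"]) auto
    finally show ?thesis .
  qed
  define q where "q = (\<lambda>k l. q0 k l * [:0, 1:] ^ (m - m0 k l))"
  have q: "z ^ m * \<gamma> z $ k $ l = poly (q k l) z" if "z \<noteq> 0" for z k l
  proof -
    have "z ^ m = z ^ m0 k l * z ^ (m - m0 k l)" using m[of k l] by (simp flip: power_add)
    then show ?thesis using q0[OF that, of k l] that by (simp add: q_def)
  qed
  define M where "M = (\<lambda>r. \<chi> k l. Polynomial.coeff (q k l) r)"
  define d where "d = Max (range (\<lambda>(k, l). Polynomial.degree (q k l)))"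
  have d: "Polynomial.degree (q k l) \<le> d" for k l
    unfolding d_def by (rule Max_ge) (auto intro: image_eqI[of _ _ "(k, l)"])
  have M_sum: "(\<Sum>r\<le>d. M r) = mat 1"
  proof -
    have "(\<Sum>r\<le>d. M r) $ k $ l = mat 1 $ k $ l" for k l
    proof -
      have "(\<Sum>r\<le>d. M r) $ k $ l = (\<Sum>r\<le>d. Polynomial.coeff (q k l) r * 1 ^ r)" by (simp add: M_def)
      also have "\<dots> = poly (q k l) 1"
        unfolding poly_altdef using d[of k l]
        by (intro sum.mono_neutral_right) (auto intro: Polynomial.coeff_eq_0)
      also have "\<dots> = mat 1 $ k $ l" using q[of 1 k l] one by simp
      finally show ?thesis .
    qed
    then show ?thesis by (simp add: vec_eq_iff)
  qed
  \<comment> \<open>For fixed \<open>z\<close> the identity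
    \<open>\<gamma> z ** \<gamma> z' = \<gamma> (z * z')\<close> becomes one between polynomials in
    \<open>z'\<close>, and the claim is its coefficient of degree \<open>r\<close>.\<close>
  have eig: "matrix_scale (z ^ m) (\<gamma> z) ** M r = matrix_scale (z ^ r) (M r)" if z: "z \<noteq> 0" for z r
  proof -
    have "(\<Sum>j\<in>UNIV. Polynomial.smult (z ^ m * \<gamma> z $ k $ j) (q j l)) = pcompose (q k l) [:0, z:]" for k l
    proof (rule poly_eq_off_zero)
      fix z' :: complex assume z': "z' \<noteq> 0"
      have "poly (\<Sum>j\<in>UNIV. Polynomial.smult (z ^ m * \<gamma> z $ k $ j) (q j l)) z' =
          (\<Sum>j\<in>UNIV. z ^ m * z' ^ m * (\<gamma> z $ k $ j * \<gamma> z' $ j $ l))"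
        by (simp add: poly_sum flip: q[OF z']) (simp add: algebra_simps)
      also have "\<dots> = z ^ m * z' ^ m * (\<gamma> z ** \<gamma> z') $ k $ l"
        by (simp add: matrix_matrix_mult_def sum_distrib_left)
      also have "\<dots> = (z * z') ^ m * \<gamma> (z * z') $ k $ l" using z z' by (simp add: mult power_mult_distrib)
      also have "\<dots> = poly (q k l) (z * z')" using z z' by (intro q) simp
      finally show "poly (\<Sum>j\<in>UNIV. Polynomial.smult (z ^ m * \<gamma> z $ k $ j) (q j l)) z' = poly (pcompose (q k l) [:0, z:]) z'"
        by (simp add: poly_pcompose mult.commute)
    qed
    then have "Polynomial.coeff (\<Sum>j\<in>UNIV. Polynomial.smult (z ^ m * \<gamma> z $ k $ j) (q j l)) r = z ^ r * Polynomial.coeff (q k l) r" for k l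
      by (simp only: coeff_pcompose_linear)
    then show ?thesis by (simp add: vec_eq_iff matrix_matrix_mult_def M_def Polynomial.coeff_sum)
  qed
  \<comment> \<open>Commuting with all \<open>\<gamma> z\<close> is an identity of polynomials off
    0, hence holds for each coefficient.\<close>
  have comm: "A ** M r = M r ** A" if A: "\<And>z. z \<noteq> 0 \<Longrightarrow> A ** \<gamma> z = \<gamma> z ** A" for A r
  proof -
    have "(\<Sum>j\<in>UNIV. Polynomial.smult (A $ k $ j) (q j l)) = (\<Sum>j\<in>UNIV. Polynomial.smult (A $ j $ l) (q k j))" for k l
    proof (rule poly_eq_off_zero)
      fix z :: complex assume z: "z \<noteq> 0"
      have "z ^ m * (A ** \<gamma> z) $ k $ l = z ^ m * (\<gamma> z ** A) $ k $ l" using A[OF z] by simp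
      then show "poly (\<Sum>j\<in>UNIV. Polynomial.smult (A $ k $ j) (q j l)) z = poly (\<Sum>j\<in>UNIV. Polynomial.smult (A $ j $ l) (q k j)) z"
        by (simp add: poly_sum matrix_matrix_mult_def sum_distrib_left flip: q[OF z]) (simp add: algebra_simps)
    qed
    then have "Polynomial.coeff (\<Sum>j\<in>UNIV. Polynomial.smult (A $ k $ j) (q j l)) r = Polynomial.coeff (\<Sum>j\<in>UNIV. Polynomial.smult (A $ j $ l) (q k j)) r" for k l
      by (simp only:)
    then show ?thesis by (simp add: vec_eq_iff matrix_matrix_mult_def M_def Polynomial.coeff_sum mult.commute)
  qed
  have "\<exists>c. \<gamma> z *v (M r *v u) = c *s (M r *v u)" if z: "z \<noteq> 0" for z r u
  proof
    have "matrix_scale (z ^ m) (\<gamma> z ** M r) = matrix_scale (z ^ r) (M r)" using eig[OF z] by (simp add: matrix_scale_mult)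
    then have "z ^ m * (\<gamma> z ** M r) $ k $ l = z ^ r * M r $ k $ l" for k l by (metis matrix_scale_nth)
    then have "(\<gamma> z ** M r) = matrix_scale (z ^ r / z ^ m) (M r)" using z by (simp add: vec_eq_iff field_simps)
    then have "\<gamma> z *v (M r *v u) = matrix_scale (z ^ r / z ^ m) (M r) *v u" by (simp add: matrix_vector_mul_assoc)
    also have "\<dots> = (z ^ r / z ^ m) *s (M r *v u)"
      by (simp add: vec_eq_iff matrix_vector_mult_def sum_distrib_left mult.assoc)
    finally show "\<gamma> z *v (M r *v u) = (z ^ r / z ^ m) *s (M r *v u)" .
  qed
  with M_sum comm show ?thesis by blast
qed

text \<open>Common eigenvectors are refined one coordinate of the torus at a time. The matrices
  \<open>M r\<close> of the new one-parameter group commute with the part already treated, so they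
  preserve its eigenvectors, and every vector is the sum of its images under them.\<close>

lemma torus_eigenvectors:
  fixes T :: "(complex^'n^'n) set"
  assumes "torus T"
  shows torus_commute: "A \<in> T \<Longrightarrow> B \<in> T \<Longrightarrow> A ** B = B ** A"
    and torus_eigenvectors_span: "vec.span {u. \<forall>A\<in>T. \<exists>c. A *v u = c *s u} = UNIV"
proof -
  obtain I \<phi> where iso: "algebraic_group_iso T (coordinate_torus (I :: 'n set)) \<phi>" and T: "subgroup T GL"
    using assms by (auto simp: torus_def linear_algebraic_group_def)
  define \<psi> where "\<psi> = inv_into T \<phi>"
  have bij: "bij_betw \<phi> T (coordinate_torus I)" and \<phi>: "\<And>A B. A \<in> T \<Longrightarrow> B \<in> T \<Longrightarrow> \<phi> (A ** B) = \<phi> A ** \<phi> B"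
    using iso by (auto simp: algebraic_group_iso_def iso_def hom_def)
  have reg: "regular_map (coordinate_torus I) \<psi>" using iso by (simp add: algebraic_group_iso_def \<psi>_def)
  have \<psi>T: "\<psi> x \<in> T" "\<phi> (\<psi> x) = x" if "x \<in> coordinate_torus I" for x
    using bij that by (auto simp: \<psi>_def bij_betw_def f_inv_into_f inv_into_into)
  have \<psi>_mult: "\<psi> (x ** y) = \<psi> x ** \<psi> y" if "x \<in> coordinate_torus I" "y \<in> coordinate_torus I" for x y
  proof -
    have "\<psi> x ** \<psi> y \<in> T" using \<psi>T that subgroup.m_closed[OF T] by simp
    moreover have "\<phi> (\<psi> x ** \<psi> y) = x ** y" using \<phi> \<psi>T that by simp
    ultimately show ?thesis using bij unfolding \<psi>_def bij_betw_def by (metis inv_into_f_f)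
  qed
  have T_eq: "T = \<psi> ` coordinate_torus I"
    using bij unfolding \<psi>_def by (metis bij_betw_def bij_betw_inv_into)
  have comm: "\<psi> x ** \<psi> y = \<psi> y ** \<psi> x" if "x \<in> coordinate_torus I" "y \<in> coordinate_torus I" for x y
    using \<psi>_mult that coordinate_torus_commute by metis
  show "A ** B = B ** A" if "A \<in> T" "B \<in> T" using that comm by (auto simp: T_eq)
  have one_mem: "mat 1 \<in> coordinate_torus J" for J :: "'n set" by (simp add: coordinate_torus_def mat_def)
  have \<psi>1: "\<psi> (mat 1) = mat 1"
  proof -
    have 1: "mat 1 \<in> T" using subgroup.one_closed[OF T] by simp
    define x where "x = \<phi> (mat 1)"
    have "x \<in> coordinate_torus I" "\<psi> x = mat 1"
      using 1 bij by (auto simp: x_def \<psi>_def bij_betw_def)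
    then show ?thesis using \<psi>_mult[of x "mat 1"] one_mem by simp
  qed
  have sub: "A \<in> coordinate_torus I" if "A \<in> coordinate_torus J" "J \<subseteq> I" for A and J :: "'n set"
    using that unfolding coordinate_torus_def
    by (auto split: if_splits)
  define S where "S = (\<lambda>J. {u. \<forall>x\<in>coordinate_torus J. \<exists>c. \<psi> x *v u = c *s u})"
  have "vec.span (S J) = UNIV" if "J \<subseteq> I" for J
    using finite[of J] that
  proof (induction J rule: finite_induct)
    case empty
    have 1: "x = mat 1" if "x \<in> coordinate_torus {}" for x :: "complex^'n^'n"
      using that by (auto simp: coordinate_torus_def mat_def vec_eq_iff)
    then have "\<psi> x *v u = 1 *s u" if "x \<in> coordinate_torus {}" for x u
      unfolding 1[OF that] \<psi>1 by simp
    then have "S {} = UNIV" unfolding S_def by blast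
    then show ?case by simp
  next
    case (insert i J)
    define \<gamma> where "\<gamma> = (\<lambda>z. \<psi> (cochar i z))"
    have cm: "z \<noteq> 0 \<Longrightarrow> cochar i z \<in> coordinate_torus I" for z
      using cochar_mem insert by blast
    have g1: "\<exists>q m. \<forall>z. z \<noteq> 0 \<longrightarrow> \<gamma> z $ k $ l = poly q z / z ^ m" for k l
    proof -
      obtain g m where g: "g \<in> matrix_polynomials" "\<forall>A\<in>coordinate_torus I. \<psi> A $ k $ l = g A / det A ^ m"
        using reg unfolding regular_map_def regular_function_def by blast
      obtain q where "\<forall>z. g (cochar i z) = poly q z"
        using matrix_polynomials_cochar[OF g(1)] by blast
      then show ?thesis using g(2) cm by (intro exI[of _ q] exI[of _ m]) (simp add: \<gamma>_def det_cochar)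
    qed
    have g2: "\<gamma> z ** \<gamma> z' = \<gamma> (z * z')" if "z \<noteq> 0" "z' \<noteq> 0" for z z'
      using \<psi>_mult[OF cm cm] that by (simp add: \<gamma>_def cochar_mult)
    have g3: "\<gamma> 1 = mat 1"
    proof -
      have "cochar i 1 = mat 1" by (simp add: cochar_def mat_def vec_eq_iff)
      then show ?thesis by (simp add: \<gamma>_def \<psi>1)
    qed
    have "\<exists>(M :: nat \<Rightarrow> complex^'n^'n) d. (\<Sum>r\<le>d. M r) = mat 1 \<and>
      (\<forall>r z u. z \<noteq> 0 \<longrightarrow> (\<exists>c. \<gamma> z *v (M r *v u) = c *s (M r *v u))) \<and>
      (\<forall>r A. (\<forall>z. z \<noteq> 0 \<longrightarrow> A ** \<gamma> z = \<gamma> z ** A) \<longrightarrow> A ** M r = M r ** A)"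
      by (rule one_parameter_group[of \<gamma>]; fact g1 g2 g3)
    then obtain M and d :: nat where M: "(\<Sum>r\<le>d. M r) = mat 1"
      "\<And>r z u. z \<noteq> 0 \<Longrightarrow> \<exists>c. \<gamma> z *v (M r *v u) = c *s (M r *v u)"
      "\<And>r A. (\<And>z. z \<noteq> 0 \<Longrightarrow> A ** \<gamma> z = \<gamma> z ** A) \<Longrightarrow> A ** M r = M r ** A"
      by blast
    have MS: "M r *v u \<in> S (insert i J)" if u: "u \<in> S J" for r u
      unfolding S_def
    proof (intro CollectI ballI)
      fix A assume "A \<in> coordinate_torus (insert i J)"
      then obtain B z where B: "B \<in> coordinate_torus J" "z \<noteq> 0" "A = B ** cochar i z"
        using coordinate_torus_insert insert.hyps by metis
      have BI: "B \<in> coordinate_torus I" using sub B insert.prems by blast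
      obtain b where b: "\<psi> B *v u = b *s u" using u B by (auto simp: S_def)
      obtain c where c: "\<gamma> z *v (M r *v u) = c *s (M r *v u)" using M(2) B by blast
      have BM: "\<psi> B ** M r = M r ** \<psi> B" by (rule M(3)) (simp add: \<gamma>_def comm BI cm)
      have "\<psi> A *v (M r *v u) = \<psi> B *v (\<gamma> z *v (M r *v u))"
        using \<psi>_mult[OF BI cm[OF B(2)]] by (simp add: B(3) \<gamma>_def matrix_vector_mul_assoc matrix_mul_assoc)
      also have "\<dots> = c *s ((\<psi> B ** M r) *v u)"
        by (simp only: c vec.scale flip: matrix_vector_mul_assoc)
      also have "\<dots> = c *s (M r *v (\<psi> B *v u))" by (simp add: BM matrix_vector_mul_assoc)
      also have "\<dots> = (c * b) *s (M r *v u)" by (simp add: b vec.scale vector_smult_assoc)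
      finally show "\<exists>c. \<psi> A *v (M r *v u) = c *s (M r *v u)" by blast
    qed
    have "u \<in> vec.span (S (insert i J))" if "u \<in> S J" for u
    proof -
      have "u = (\<Sum>r\<le>d. M r) *v u" by (simp add: M(1))
      also have "\<dots> = (\<Sum>r\<le>d. M r *v u)"
        by (induction d) (simp_all add: matrix_vector_mult_add_rdistrib)
      finally show ?thesis using MS[OF that] by (metis vec.span_base vec.span_sum)
    qed
    then have "vec.span (S J) \<subseteq> vec.span (S (insert i J))"
      by (intro vec.span_minimal vec.subspace_span) blast
    then show ?case using insert by auto
  qed
  from this[OF order_refl] show "vec.span {u. \<forall>A\<in>T. \<exists>c. A *v u = c *s u} = UNIV"
    by (simp add: S_def T_eq)
qed

section \<open>Passing from the torus to its Lie algebra\<close>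

lemma lie_algebra_commute:
  assumes X: "X \<in> lie_algebra T" and B: "\<And>A. A \<in> T \<Longrightarrow> A ** B = B ** A"
  shows "X ** B = B ** X"
proof -
  have "(X ** B) $ i $ j - (B ** X) $ i $ j = 0" for i j
  proof (rule lie_algebra_linear[OF X, of "\<lambda>X. (X ** B) $ i $ j - (B ** X) $ i $ j"])
    show "(\<lambda>X. (X ** B) $ i $ j - (B ** X) $ i $ j) \<in> matrix_polynomials"
      using matrix_polynomials_diff[OF matrix_polynomials_conj[of "mat 1" B i j] matrix_polynomials_conj[of B "mat 1" i j]]
      by simp
  qed (simp_all add: B matrix_add_ldistrib matrix_add_rdistrib matrix_scale_mult algebra_simps)
  then show ?thesis by (simp add: vec_eq_iff)
qed

text \<open>For fixed \<open>u\<close> with a nonzero entry \<open>u\<^sub>k\<close>, being an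
  eigenvector is a system of linear equations in the matrix,
  \<open>(Xu)\<^sub>j u\<^sub>k = (Xu)\<^sub>k u\<^sub>j\<close>.\<close>

lemma lie_algebra_eigenvector:
  fixes u :: "complex^'n"
  assumes X: "X \<in> lie_algebra T" and u: "\<And>A. A \<in> T \<Longrightarrow> \<exists>c. A *v u = c *s u"
  shows "\<exists>c. X *v u = c *s u"
proof (cases "u = 0")
  case False
  then obtain k where k: "u $ k \<noteq> 0" by (auto simp: vec_eq_iff)
  have "(X *v u) $ j * u $ k - (X *v u) $ k * u $ j = 0" for j
  proof (rule lie_algebra_linear[OF X, of "\<lambda>X. (X *v u) $ j * u $ k - (X *v u) $ k * u $ j"])
    show "(\<lambda>X. (X *v u) $ j * u $ k - (X *v u) $ k * u $ j) \<in> matrix_polynomials"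
      unfolding matrix_vector_mult_def vec_lambda_beta
      by (intro matrix_polynomials_diff matrix_polynomials_mult matrix_polynomials_sum finite
          matrix_polynomials_const matrix_polynomials_entry)
    show "(A *v u) $ j * u $ k - (A *v u) $ k * u $ j = 0" if "A \<in> T" for A
      using u[OF that] by auto
  qed (simp_all add: matrix_vector_mult_def sum_distrib_left sum_distrib_right sum.distrib algebra_simps)
  then have "X *v u = ((X *v u) $ k / u $ k) *s u" using k by (simp add: vec_eq_iff field_simps)
  then show ?thesis by blast
qed (use exI[of _ 0] in auto)

section \<open>The action of the Weyl group\<close>

lemma dual_iff:
  "dual (lie_algebra T) = {l \<in> extensional (lie_algebra T). complex_subspace.lin matrix_scale (lie_algebra T) l}"
proof -
  interpret complex_subspace matrix_scale "lie_algebra T"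
    by (intro complex_subspace.intro vector_space_matrix_scale complex_subspace_axioms.intro lie_algebra_subspace)
  show ?thesis by (auto simp: dual_def lin_def)
qed

locale torus_setup = group_with_torus G T for G T :: "(complex^'n^'n) set" +
  assumes torus: "torus T"
begin

sublocale t: complex_subspace matrix_scale "lie_algebra T"
  by (intro complex_subspace.intro vector_space_matrix_scale complex_subspace_axioms.intro lie_algebra_subspace)

abbreviation \<tt> where "\<tt> \<equiv> lie_algebra T"

sublocale W: Group.group W by (rule group_W)

definition act :: "(complex^'n^'n) set \<Rightarrow> complex^'n^'n \<Rightarrow> complex^'n^'n" where
  "act w H = (SOME n. n \<in> w) ** H ** matrix_inv (SOME n. n \<in> w)"

lemma conj_closed: "n \<in> N \<Longrightarrow> H \<in> \<tt> \<Longrightarrow> n ** H ** matrix_inv n \<in> \<tt>"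
  using lie_algebra_conj[of H T n "matrix_inv n"] N_conj invertible_G N_G by simp

lemma T_commute: "A \<in> T \<Longrightarrow> H \<in> \<tt> \<Longrightarrow> A ** H = H ** A"
  using lie_algebra_commute[of H T A] torus_commute[OF torus] by metis

text \<open>Two representatives differ by a factor in \<open>T\<close>, which commutes with
  \<open>Lie T\<close> because the torus is commutative.\<close>

lemma act_eq:
  assumes w: "w \<in> carrier W" "n \<in> w" and H: "H \<in> \<tt>"
  shows "act w H = n ** H ** matrix_inv n"
proof -
  define m where "m = (SOME n. n \<in> w)"
  have "m \<in> w" unfolding m_def using w(2) by (rule someI)
  then obtain A where A: "A \<in> T" "m = A ** n" using weyl_mem_unique w by blast
  have n: "n \<in> N" using weyl_mem_N w by blast
  have iA: "invertible A" using A(1) T_subset invertible_G by auto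
  have i: "invertible n" using n N_G invertible_G by blast
  have "act w H = A ** n ** H ** (matrix_inv n ** matrix_inv A)"
    unfolding act_def m_def[symmetric] A(2) by (simp add: matrix_inv_matrix_mult iA i)
  also have "\<dots> = A ** (n ** H ** matrix_inv n) ** matrix_inv A" by (simp add: matrix_mul_assoc)
  also have "\<dots> = (n ** H ** matrix_inv n) ** (A ** matrix_inv A)"
    unfolding T_commute[OF A(1) conj_closed[OF n H]] by (simp add: matrix_mul_assoc)
  finally show ?thesis using iA by simp
qed

lemma act_closed: "w \<in> carrier W \<Longrightarrow> H \<in> \<tt> \<Longrightarrow> act w H \<in> \<tt>"
  using weyl_nonempty[of w] act_eq[of w] weyl_mem_N[of w] conj_closed by metis

lemma act_add: "act w (H + K) = act w H + act w K"
  by (simp add: act_def matrix_add_ldistrib matrix_add_rdistrib)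

lemma act_scale: "act w (matrix_scale c H) = matrix_scale c (act w H)"
  by (simp add: act_def matrix_scale_mult)

lemma act_mult:
  assumes "v \<in> carrier W" "w \<in> carrier W" "H \<in> \<tt>"
  shows "act (v \<otimes>\<^bsub>W\<^esub> w) H = act v (act w H)"
proof -
  obtain m n where mn: "m \<in> v" "n \<in> w" using weyl_nonempty assms by metis
  have i: "invertible m" "invertible n"
    using weyl_mem_N[OF assms(1) mn(1)] weyl_mem_N[OF assms(2) mn(2)] N_G invertible_G by blast+
  have "m ** n \<in> v \<otimes>\<^bsub>W\<^esub> w" using mn by (auto simp: weyl_mult)
  then have "act (v \<otimes>\<^bsub>W\<^esub> w) H = m ** n ** H ** (matrix_inv n ** matrix_inv m)"
    using act_eq[OF W.m_closed[OF assms(1,2)] _ assms(3)] i by (simp add: matrix_inv_matrix_mult)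
  also have "\<dots> = m ** (n ** H ** matrix_inv n) ** matrix_inv m" by (simp add: matrix_mul_assoc)
  finally show ?thesis
    using act_eq[OF assms(2) mn(2) assms(3)] act_eq[OF assms(1) mn(1) act_closed[OF assms(2,3)]] by simp
qed

lemma act_one: "H \<in> \<tt> \<Longrightarrow> act \<one>\<^bsub>W\<^esub> H = H"
proof -
  assume H: "H \<in> \<tt>"
  have "mat 1 \<in> \<one>\<^bsub>W\<^esub>" using subgroup.one_closed[OF subgroup_T] by (simp add: weyl_one)
  moreover have "matrix_inv (mat 1 :: complex^'n^'n) = mat 1" by (rule matrix_inv_unique) simp_all
  ultimately show ?thesis using act_eq[OF W.one_closed _ H, of "mat 1"] by simp
qed

lemma act_inv:
  assumes w: "w \<in> carrier W" "n \<in> w" and H: "H \<in> \<tt>"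
  shows "act (inv\<^bsub>W\<^esub> w) H = matrix_inv n ** H ** n"
proof -
  have n: "n \<in> N" using weyl_mem_N w by blast
  then have i: "invertible n" using N_G invertible_G by blast
  define K where "K = matrix_inv n ** H ** n"
  have "matrix_inv (matrix_inv n) = n" using i by (intro matrix_inv_unique) simp_all
  then have K: "K \<in> \<tt>" using conj_closed[OF N_inv[OF n] H] by (simp add: K_def)
  have "act w K = (n ** matrix_inv n) ** H ** (n ** matrix_inv n)"
    unfolding act_eq[OF w K] unfolding K_def by (simp only: matrix_mul_assoc)
  then have "act w K = H" using i by simp
  then show ?thesis
    using act_mult[of "inv\<^bsub>W\<^esub> w" w K] act_one[OF K] w(1) K by (simp add: K_def)
qed

lemma act_inv_cancel: "w \<in> carrier W \<Longrightarrow> H \<in> \<tt> \<Longrightarrow> act (inv\<^bsub>W\<^esub> w) (act w H) = H"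
  "w \<in> carrier W \<Longrightarrow> H \<in> \<tt> \<Longrightarrow> act w (act (inv\<^bsub>W\<^esub> w) H) = H"
  using act_mult[of "inv\<^bsub>W\<^esub> w" w H] act_mult[of w "inv\<^bsub>W\<^esub> w" H] act_one[of H] by simp_all

lemma weyl_action_eq:
  assumes "w \<in> carrier W" shows "weyl_action T w l = (\<lambda>H\<in>\<tt>. l (act (inv\<^bsub>W\<^esub> w) H))"
proof -
  have "(SOME n. n \<in> w) \<in> w" using weyl_nonempty[OF assms] by (rule someI_ex)
  from act_inv[OF assms this] show ?thesis
    unfolding weyl_action_def Let_def by (intro restrict_ext) simp
qed

lemma reflection_inv:
  assumes w: "w \<in> carrier W" and \<alpha>: "t.lin \<alpha>" and h: "h \<in> \<tt>" "\<alpha> h = 2"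
    and refl: "\<And>H. H \<in> \<tt> \<Longrightarrow> act w H = H - matrix_scale (\<alpha> H) h" and H: "H \<in> \<tt>"
  shows "act (inv\<^bsub>W\<^esub> w) H = H - matrix_scale (\<alpha> H) h"
proof -
  define y where "y = act (inv\<^bsub>W\<^esub> w) H"
  have y: "y \<in> \<tt>" unfolding y_def using w H act_closed by simp
  have Hy: "H = y - matrix_scale (\<alpha> y) h"
    using act_inv_cancel(2)[OF w H] refl[OF y] by (simp add: y_def)
  have "\<alpha> (y - matrix_scale (\<alpha> y) h) = - \<alpha> y"
    using t.lin_diff[OF \<alpha> y, of "matrix_scale (\<alpha> y) h"] t.lin_scale[OF \<alpha> h(1)] h t.t_closed(3)[OF h(1)] by simp
  then have "\<alpha> H = - \<alpha> y" by (simp only: Hy[symmetric])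
  then have "matrix_scale (\<alpha> H) h = - matrix_scale (\<alpha> y) h" by (simp add: vec_eq_iff)
  then have "y = H - matrix_scale (\<alpha> H) h" by (metis Hy diff_add_cancel diff_minus_eq_add)
  then show ?thesis by (simp add: y_def)
qed

text \<open>Matrix entries restrict to functionals that separate the points of \<open>Lie T\<close>,
  so a formula on the dual determines the action on \<open>Lie T\<close>. The dual action involves
  the inverse of \<open>w\<close>, which \<open>reflection_inv\<close> removes.\<close>

lemma acts_as_reflection_iff:
  assumes w: "w \<in> carrier W" and \<alpha>: "t.lin \<alpha>"
  shows "acts_as_reflection T \<alpha> w \<longleftrightarrow>
    (\<exists>h\<in>\<tt>. \<alpha> h = 2 \<and> (\<forall>H\<in>\<tt>. act w H = H - matrix_scale (\<alpha> H) h))"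
proof
  assume "acts_as_reflection T \<alpha> w"
  then obtain h where h: "h \<in> \<tt>" "\<alpha> h = 2"
    "\<And>l. l \<in> dual \<tt> \<Longrightarrow> weyl_action T w l = (\<lambda>H\<in>\<tt>. l H - l h * \<alpha> H)"
    unfolding acts_as_reflection_def by blast
  have "act (inv\<^bsub>W\<^esub> w) H = H - matrix_scale (\<alpha> H) h" if H: "H \<in> \<tt>" for H
  proof -
    have "act (inv\<^bsub>W\<^esub> w) H $ i $ j = (H - matrix_scale (\<alpha> H) h) $ i $ j" for i j
    proof -
      have "(\<lambda>H\<in>\<tt>. H $ i $ j) \<in> dual \<tt>" by (auto simp: dual_def)
      from h(3)[OF this] have "weyl_action T w (\<lambda>H\<in>\<tt>. H $ i $ j) H = H $ i $ j - h $ i $ j * \<alpha> H"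
        using H h(1) by simp
      then show ?thesis using H w act_closed[of "inv\<^bsub>W\<^esub> w" H] by (simp add: weyl_action_eq mult.commute)
    qed
    then show ?thesis unfolding vec_eq_iff by blast
  qed
  from reflection_inv[OF W.inv_closed[OF w] \<alpha> h(1,2) this]
  show "\<exists>h\<in>\<tt>. \<alpha> h = 2 \<and> (\<forall>H\<in>\<tt>. act w H = H - matrix_scale (\<alpha> H) h)"
    using h(1,2) w by auto
next
  assume "\<exists>h\<in>\<tt>. \<alpha> h = 2 \<and> (\<forall>H\<in>\<tt>. act w H = H - matrix_scale (\<alpha> H) h)"
  then obtain h where h: "h \<in> \<tt>" "\<alpha> h = 2" "\<And>H. H \<in> \<tt> \<Longrightarrow> act w H = H - matrix_scale (\<alpha> H) h" by blast
  have "weyl_action T w l = (\<lambda>H\<in>\<tt>. l H - l h * \<alpha> H)" if "l \<in> dual \<tt>" for l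
    unfolding weyl_action_eq[OF w]
  proof (rule restrict_ext)
    fix H assume H: "H \<in> \<tt>"
    have l: "t.lin l" using that by (simp add: dual_iff)
    have "act (inv\<^bsub>W\<^esub> w) H = H - matrix_scale (\<alpha> H) h"
      by (rule reflection_inv[OF w \<alpha> h(1,2) _ H]) (rule h(3))
    then show "l (act (inv\<^bsub>W\<^esub> w) H) = l H - l h * \<alpha> H"
      using t.lin_diff[OF l H t.t_closed(3)[OF h(1)], of "\<alpha> H"] t.lin_scale[OF l h(1), of "\<alpha> H"]
      by (simp add: mult.commute)
  qed
  with h(1,2) show "acts_as_reflection T \<alpha> w" unfolding acts_as_reflection_def by blast
qed

text \<open>\<open>W\<close> permutes the finitely many weights of \<open>Lie T\<close> on the ambient space.\<close>

lemma finite_weyl_group: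
  assumes faithful: "\<And>w. w \<in> carrier W \<Longrightarrow> (\<And>H. H \<in> \<tt> \<Longrightarrow> act w H = H) \<Longrightarrow> w = \<one>\<^bsub>W\<^esub>"
  shows "finite (carrier W)"
proof -
  define E where "E = {u :: complex^'n. \<forall>H\<in>\<tt>. \<exists>c. H *v u = c *s u}"
  have "{u. \<forall>A\<in>T. \<exists>c. A *v u = c *s u} \<subseteq> E"
    unfolding E_def using lie_algebra_eigenvector by blast
  then have E: "vec.span E = UNIV"
    using torus_eigenvectors_span[OF torus] vec.span_mono by blast
  obtain B where B: "B \<subseteq> E" "vec.independent B" "E \<subseteq> vec.span B"
    using vec.maximal_independent_subset by blast
  have fB: "finite B" using vec.finiteI_independent[OF B(2)] .
  have "vec.span E \<subseteq> vec.span B" by (rule vec.span_minimal[OF B(3) vec.subspace_span])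
  then have "x \<in> vec.span B" for x using E by blast
  then have "x \<in> range (\<lambda>c. \<Sum>b\<in>B. c b *s b)" for x using vec.span_finite[OF fB] by blast
  then have span: "\<exists>c. x = (\<Sum>b\<in>B. c b *s b)" for x by blast
  define wt where "wt = (\<lambda>u H. SOME c. H *v u = c *s (u :: complex^'n))"
  have wt: "H *v u = wt u H *s u" if "u \<in> E" "H \<in> \<tt>" for u H
  proof -
    have "\<exists>c. H *v u = c *s u" using that by (simp add: E_def)
    then show ?thesis unfolding wt_def by (rule someI_ex)
  qed
  \<comment> \<open>Expanding \<open>u\<close> in the eigenbasis and comparing coefficients shows
    that each basis vector occurring in \<open>u\<close> has the same weight as
    \<open>u\<close>.\<close>
  have key: "\<exists>b\<in>B. \<forall>H\<in>\<tt>. f H = wt b H"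
    if u: "u \<noteq> 0" and f: "\<And>H. H \<in> \<tt> \<Longrightarrow> H *v u = f H *s u" for u f
  proof -
    obtain c where c: "u = (\<Sum>b\<in>B. c b *s b)" using span by blast
    have "\<exists>b\<in>B. c b \<noteq> 0"
    proof (rule ccontr)
      assume "\<not> ?thesis"
      then have "(\<Sum>b\<in>B. c b *s b) = 0" by (intro sum.neutral) simp
      with c u show False by (simp only:)
    qed
    then obtain b where b: "b \<in> B" "c b \<noteq> 0" by blast
    have "f H = wt b H" if H: "H \<in> \<tt>" for H
    proof -
      have "H *v u = (\<Sum>b\<in>B. H *v (c b *s b))" by (subst c) (rule vec.sum)
      also have "\<dots> = (\<Sum>b\<in>B. (c b * wt b H) *s b)"
        by (intro sum.cong refl) (use wt B(1) H in \<open>auto simp: vec.scale vector_smult_assoc\<close>)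
      finally have "(\<Sum>b\<in>B. (c b * wt b H) *s b) = f H *s u" using f[OF H] by metis
      also have "\<dots> = (\<Sum>b\<in>B. (f H * c b) *s b)"
        unfolding c by (simp add: vec.scale_sum_right vector_smult_assoc)
      finally have "(\<Sum>b\<in>B. (c b * wt b H - f H * c b) *s b) = 0"
        by (simp add: vector_sub_rdistrib sum_subtractf)
      from vec.independentD[OF B(2) fB order_refl this b(1)] show ?thesis using b(2) by (simp add: mult.commute)
    qed
    with b show ?thesis by blast
  qed
  \<comment> \<open>A representative \<open>n\<close> of \<open>w\<close> maps \<open>b\<close> to
    an eigenvector with the transformed weight, to which \<open>key\<close> applies.\<close>
  have "\<exists>b'\<in>B. \<forall>H\<in>\<tt>. wt b (act (inv\<^bsub>W\<^esub> w) H) = wt b' H" if w: "w \<in> carrier W" and b: "b \<in> B" for w b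
  proof -
    obtain n where n: "n \<in> w" using weyl_nonempty w by blast
    have i: "invertible n" using weyl_mem_N[OF w n] N_G invertible_G by blast
    have "b \<noteq> 0" using b B(2) vec.dependent_zero by blast
    then have "n *v b \<noteq> 0" using i
      by (metis matrix_inv_mult(2) matrix_vector_mul_assoc matrix_vector_mul_lid vec.zero)
    moreover have "H *v (n *v b) = wt b (act (inv\<^bsub>W\<^esub> w) H) *s (n *v b)" if H: "H \<in> \<tt>" for H
    proof -
      have a: "act (inv\<^bsub>W\<^esub> w) H \<in> \<tt>" using act_closed W.inv_closed[OF w] H by blast
      have "n ** act (inv\<^bsub>W\<^esub> w) H = (n ** matrix_inv n) ** H ** n"
        unfolding act_inv[OF w n H] by (simp only: matrix_mul_assoc)
      then have "H *v (n *v b) = n *v (act (inv\<^bsub>W\<^esub> w) H *v b)"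
        using i by (simp add: matrix_vector_mul_assoc)
      also have "\<dots> = n *v (wt b (act (inv\<^bsub>W\<^esub> w) H) *s b)" using wt[OF _ a] b B(1) by auto
      finally show ?thesis by (simp only: vec.scale)
    qed
    ultimately show ?thesis by (rule key)
  qed
  then obtain F where F: "\<And>w b. w \<in> carrier W \<Longrightarrow> b \<in> B \<Longrightarrow> F w b \<in> B"
    "\<And>w b H. w \<in> carrier W \<Longrightarrow> b \<in> B \<Longrightarrow> H \<in> \<tt> \<Longrightarrow> wt b (act (inv\<^bsub>W\<^esub> w) H) = wt (F w b) H"
    by metis
  \<comment> \<open>The weights on a basis determine the matrices of \<open>Lie T\<close>, so equal
    maps of \<open>B\<close> come from elements with equal action, and faithfulness identifies
    these.\<close>
  have "inj_on (\<lambda>w. \<lambda>b\<in>B. F w b) (carrier W)"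
  proof (rule inj_onI)
    fix v w assume v: "v \<in> carrier W" and w: "w \<in> carrier W" and eq: "(\<lambda>b\<in>B. F v b) = (\<lambda>b\<in>B. F w b)"
    have Feq: "F v b = F w b" if "b \<in> B" for b using fun_cong[OF eq, of b] that by simp
    have "act (inv\<^bsub>W\<^esub> v) H = act (inv\<^bsub>W\<^esub> w) H" if H: "H \<in> \<tt>" for H
    proof -
      have a: "act (inv\<^bsub>W\<^esub> v) H \<in> \<tt>" "act (inv\<^bsub>W\<^esub> w) H \<in> \<tt>" using act_closed W.inv_closed v w H by blast+
      have b: "act (inv\<^bsub>W\<^esub> v) H *v b = act (inv\<^bsub>W\<^esub> w) H *v b" if "b \<in> B" for b
        using wt[OF subsetD[OF B(1) that] a(1)] wt[OF subsetD[OF B(1) that] a(2)]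
          F(2)[OF v that H] F(2)[OF w that H] Feq[OF that] by simp
      have "act (inv\<^bsub>W\<^esub> v) H *v x = act (inv\<^bsub>W\<^esub> w) H *v x" for x
      proof -
        obtain c where c: "x = (\<Sum>b\<in>B. c b *s b)" using span by blast
        show ?thesis unfolding c vec.sum vec.scale using b by simp
      qed
      then show ?thesis by (simp add: matrix_eq)
    qed
    then have "act (w \<otimes>\<^bsub>W\<^esub> inv\<^bsub>W\<^esub> v) H = H" if "H \<in> \<tt>" for H
      using that v w by (simp add: act_mult act_inv_cancel)
    then have "w \<otimes>\<^bsub>W\<^esub> inv\<^bsub>W\<^esub> v = \<one>\<^bsub>W\<^esub>" using faithful v w by simp
    then show "v = w" using W.inv_equality[of w "inv\<^bsub>W\<^esub> v"] v w by simp
  qed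
  moreover have "(\<lambda>w. \<lambda>b\<in>B. F w b) ` carrier W \<subseteq> B \<rightarrow>\<^sub>E B" using F(1) by auto
  then have "finite ((\<lambda>w. \<lambda>b\<in>B. F w b) ` carrier W)" using fB by (meson finite_PiE finite_subset)
  ultimately show ?thesis by (rule finite_imageD[rotated])
qed

text \<open>If \<open>X\<close> is a root vector for \<alpha> and \<open>n\<close> represents
  \<open>v\<close>, then \<open>n ** X ** matrix_inv n\<close> is a root vector for the transformed
  functional.\<close>

lemma roots_stable:
  assumes \<alpha>: "\<alpha> \<in> roots G T" and v: "v \<in> carrier W"
  shows "(\<lambda>H\<in>\<tt>. \<alpha> (act (inv\<^bsub>W\<^esub> v) H)) \<in> roots G T"
proof -
  obtain H0 X where H0: "H0 \<in> \<tt>" "\<alpha> H0 \<noteq> 0" and X: "X \<in> lie_algebra G" "X \<noteq> 0"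
    "\<And>H. H \<in> \<tt> \<Longrightarrow> H ** X - X ** H = matrix_scale (\<alpha> H) X" and lin: "t.lin \<alpha>"
    using \<alpha> by (auto simp: roots_def dual_iff)
  obtain n where n: "n \<in> v" using weyl_nonempty v by blast
  have nG: "n \<in> G" using weyl_mem_N[OF v n] N_G by blast
  then have i: "invertible n" using invertible_G by blast
  have iv: "inv\<^bsub>W\<^esub> v \<in> carrier W" using v by simp
  have "t.lin (\<lambda>H. \<alpha> (act (inv\<^bsub>W\<^esub> v) H))"
    by (rule t.lin_compose[OF lin act_closed[OF iv] act_add act_scale])
  then have "(\<lambda>H\<in>\<tt>. \<alpha> (act (inv\<^bsub>W\<^esub> v) H)) \<in> dual \<tt>" by (simp add: dual_iff t.lin_def)
  moreover have "\<exists>H\<in>\<tt>. (\<lambda>H\<in>\<tt>. \<alpha> (act (inv\<^bsub>W\<^esub> v) H)) H \<noteq> 0"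
    using H0 act_closed[OF v H0(1)] act_inv_cancel(1)[OF v H0(1)] by (intro bexI[of _ "act v H0"]) simp_all
  moreover have "n ** X ** matrix_inv n \<in> lie_algebra G"
    using nG i by (intro lie_algebra_conj X) (simp_all add: mult_G matrix_inv_G)
  moreover have "n ** X ** matrix_inv n \<noteq> 0"
  proof
    assume *: "n ** X ** matrix_inv n = 0"
    have "X = (matrix_inv n ** n) ** X ** (matrix_inv n ** n)" using i by simp
    also have "\<dots> = matrix_inv n ** (n ** X ** matrix_inv n) ** n" by (simp only: matrix_mul_assoc)
    also have "\<dots> = 0" unfolding * by (simp add: vec_eq_iff matrix_matrix_mult_def)
    finally show False using X(2) by blast
  qed
  moreover have "H ** (n ** X ** matrix_inv n) - (n ** X ** matrix_inv n) ** H =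
      matrix_scale (\<alpha> (act (inv\<^bsub>W\<^esub> v) H)) (n ** X ** matrix_inv n)" if H: "H \<in> \<tt>" for H
  proof -
    define K where "K = matrix_inv n ** H ** n"
    have K: "act (inv\<^bsub>W\<^esub> v) H = K" unfolding K_def by (rule act_inv[OF v n H])
    have Kt: "K \<in> \<tt>" unfolding K[symmetric] using act_closed[OF iv H] .
    have 1: "n ** (K ** X) ** matrix_inv n = H ** (n ** X ** matrix_inv n)"
    proof -
      have "n ** (K ** X) ** matrix_inv n = (n ** matrix_inv n) ** H ** n ** X ** matrix_inv n"
        unfolding K_def by (simp only: matrix_mul_assoc)
      then show ?thesis using i by (simp add: matrix_mul_assoc)
    qed
    have 2: "n ** (X ** K) ** matrix_inv n = (n ** X ** matrix_inv n) ** H"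
    proof -
      have "n ** (X ** K) ** matrix_inv n = n ** X ** matrix_inv n ** H ** (n ** matrix_inv n)"
        unfolding K_def by (simp only: matrix_mul_assoc)
      then show ?thesis using i by simp
    qed
    have "K ** X = X ** K + matrix_scale (\<alpha> K) X" using X(3)[OF Kt] by (simp add: diff_eq_eq add.commute)
    then have "n ** (K ** X) ** matrix_inv n = n ** (X ** K) ** matrix_inv n + matrix_scale (\<alpha> K) (n ** X ** matrix_inv n)"
      by (simp add: matrix_add_ldistrib matrix_add_rdistrib matrix_scale_mult)
    then show ?thesis unfolding 1 2 K by simp
  qed
  ultimately show ?thesis
    unfolding roots_def by simp (rule bexI[of _ "n ** X ** matrix_inv n"]; simp)
qed

end

theorem theorem4p5:
  fixes G B T :: "(complex^'n^'n) set"
  assumes G: "reductive_group G" "zariski_connected G"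
    and B: "borel_subgroup G B"
    and T: "maximal_torus G T" "T \<subseteq> B"
    and positive: "roots G T = roots B T \<union> (\<lambda>\<alpha>. \<lambda>H\<in>lie_algebra T. - \<alpha> H) ` roots B T"
    and reflections: "\<forall>\<alpha>\<in>roots B T.
          \<exists>!w. w \<in> carrier (weyl_group G T) \<and> acts_as_reflection T \<alpha> w"
    and generated: "generate (weyl_group G T) (root_reflection G T ` roots B T)
          = carrier (weyl_group G T)"
  shows "is_regular_rep (HT_pt T) (weyl_group G T) (HT_flag G B T) (star G T) \<and>
         is_regular_rep complex_ring (weyl_group G T) (H_flag G B T) (induced_star G T)"
proof -
  interpret torus_setup G T
    by (intro torus_setup.intro group_with_torus.intro torus_setup_axioms.intro)
       (use G T in \<open>auto simp: reductive_group_def linear_algebraic_group_def maximal_torus_def torus_def\<close>)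
  define P where "P = roots B T"
  define s where "s = root_reflection G T"
  have lin: "t.lin \<alpha>" "\<alpha> \<in> extensional \<tt>" if "\<alpha> \<in> P" for \<alpha>
    using that by (auto simp: P_def roots_def dual_iff)
  have s: "s \<alpha> \<in> carrier W" "acts_as_reflection T \<alpha> (s \<alpha>)" if "\<alpha> \<in> P" for \<alpha>
  proof -
    have "\<exists>!w. w \<in> carrier W \<and> acts_as_reflection T \<alpha> w" using reflections that by (simp add: P_def)
    from theI'[OF this] show "s \<alpha> \<in> carrier W" "acts_as_reflection T \<alpha> (s \<alpha>)"
      by (simp_all add: s_def root_reflection_def)
  qed
  have s_unique: "w = s \<alpha>"
    if "\<alpha> \<in> P" "w \<in> carrier W" "h \<in> \<tt>" "\<alpha> h = 2" "\<And>H. H \<in> \<tt> \<Longrightarrow> act w H = H - matrix_scale (\<alpha> H) h" for \<alpha> w h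
  proof -
    have "acts_as_reflection T \<alpha> w" using acts_as_reflection_iff[OF that(2) lin(1)[OF that(1)]] that(3-5) by blast
    moreover have "\<exists>!w. w \<in> carrier W \<and> acts_as_reflection T \<alpha> w" using reflections that(1) by (simp add: P_def)
    ultimately show ?thesis using s[OF that(1)] that(2) by blast
  qed
  define h where "h = (\<lambda>\<alpha>. SOME h. h \<in> \<tt> \<and> \<alpha> h = 2 \<and> (\<forall>H\<in>\<tt>. act (s \<alpha>) H = H - matrix_scale (\<alpha> H) h))"
  have h: "h \<alpha> \<in> \<tt>" "\<alpha> (h \<alpha>) = 2" "\<And>H. H \<in> \<tt> \<Longrightarrow> act (s \<alpha>) H = H - matrix_scale (\<alpha> H) (h \<alpha>)" if "\<alpha> \<in> P" for \<alpha>
  proof -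
    have "\<exists>h. h \<in> \<tt> \<and> \<alpha> h = 2 \<and> (\<forall>H\<in>\<tt>. act (s \<alpha>) H = H - matrix_scale (\<alpha> H) h)"
      using acts_as_reflection_iff[OF s(1)[OF that] lin(1)[OF that]] s(2)[OF that] by blast
    then have "h \<alpha> \<in> \<tt> \<and> \<alpha> (h \<alpha>) = 2 \<and> (\<forall>H\<in>\<tt>. act (s \<alpha>) H = H - matrix_scale (\<alpha> H) (h \<alpha>))"
      unfolding h_def by (rule someI_ex)
    then show "h \<alpha> \<in> \<tt>" "\<alpha> (h \<alpha>) = 2"
      "\<And>H. H \<in> \<tt> \<Longrightarrow> act (s \<alpha>) H = H - matrix_scale (\<alpha> H) (h \<alpha>)" by blast+
  qed
  have gen: "generate W (s ` P) = carrier W" using generated by (simp add: P_def s_def)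
  \<comment> \<open>If \<open>w\<close> acts trivially, then \<open>w \<otimes> s \<alpha>\<close>
    and \<open>s \<alpha>\<close> act as the same reflection, and uniqueness cancels
    \<open>s \<alpha>\<close>. Without roots the group is generated by the empty set.\<close>
  have faithful: "w = \<one>\<^bsub>W\<^esub>" if w: "w \<in> carrier W" "\<And>H. H \<in> \<tt> \<Longrightarrow> act w H = H" for w
  proof (cases "P = {}")
    case True
    then have "carrier W = {\<one>\<^bsub>W\<^esub>}" using gen W.generate_empty by simp
    then show ?thesis using w by blast
  next
    case False
    then obtain \<alpha> where \<alpha>: "\<alpha> \<in> P" by blast
    have "w \<otimes>\<^bsub>W\<^esub> s \<alpha> = s \<alpha>"
    proof (rule s_unique[OF \<alpha> _ h(1,2)[OF \<alpha>]])
      fix H assume H: "H \<in> \<tt>"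
      have "act (w \<otimes>\<^bsub>W\<^esub> s \<alpha>) H = act (s \<alpha>) H"
        using act_mult[OF w(1) s(1)[OF \<alpha>] H] w(2)[OF act_closed[OF s(1)[OF \<alpha>] H]] by simp
      then show "act (w \<otimes>\<^bsub>W\<^esub> s \<alpha>) H = H - matrix_scale (\<alpha> H) (h \<alpha>)" using h(3)[OF \<alpha> H] by simp
    qed (use w s \<alpha> in simp)
    then show ?thesis using w s(1)[OF \<alpha>] W.r_cancel_one by simp
  qed
  have fin: "finite (carrier W)" by (rule finite_weyl_group[OF faithful])
  \<comment> \<open>Equal reflections give
    \<open>\<alpha>(H) h\<^sub>\<alpha> = \<beta>(H) h\<^sub>\<beta>\<close>; applying \<alpha>,
    whose value at its own coroot is 2, yields the factor.\<close>
  have proportional: "\<exists>c. \<forall>H\<in>\<tt>. \<alpha> H = c * \<beta> H" if "\<alpha> \<in> P" "\<beta> \<in> P" "s \<alpha> = s \<beta>" for \<alpha> \<beta>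
  proof -
    have "\<alpha> H = (\<alpha> (h \<beta>) / 2) * \<beta> H" if H: "H \<in> \<tt>" for H
    proof -
      have "H - matrix_scale (\<alpha> H) (h \<alpha>) = H - matrix_scale (\<beta> H) (h \<beta>)"
        using h(3)[OF \<open>\<alpha> \<in> P\<close> H] h(3)[OF \<open>\<beta> \<in> P\<close> H] \<open>s \<alpha> = s \<beta>\<close> by simp
      then have "matrix_scale (\<alpha> H) (h \<alpha>) = matrix_scale (\<beta> H) (h \<beta>)" by simp
      from arg_cong[OF this, of \<alpha>] have "\<alpha> H * \<alpha> (h \<alpha>) = \<beta> H * \<alpha> (h \<beta>)"
        using t.lin_scale[OF lin(1)[OF \<open>\<alpha> \<in> P\<close>] h(1)[OF \<open>\<alpha> \<in> P\<close>]]
          t.lin_scale[OF lin(1)[OF \<open>\<alpha> \<in> P\<close>] h(1)[OF \<open>\<beta> \<in> P\<close>]] by simp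
      then show ?thesis using h(2)[OF \<open>\<alpha> \<in> P\<close>] by (simp add: field_simps)
    qed
    then show ?thesis by blast
  qed
  \<comment> \<open>Proportional roots have the same reflection; keep one root for each reflection.\<close>
  define R where "R = (\<lambda>w. SOME \<alpha>. \<alpha> \<in> P \<and> s \<alpha> = w) ` (s ` P)"
  have pick: "(SOME \<beta>. \<beta> \<in> P \<and> s \<beta> = s \<alpha>) \<in> P \<and> s (SOME \<beta>. \<beta> \<in> P \<and> s \<beta> = s \<alpha>) = s \<alpha>" if "\<alpha> \<in> P" for \<alpha>
    by (rule someI_ex[of "\<lambda>\<beta>. \<beta> \<in> P \<and> s \<beta> = s \<alpha>"]) (use that in blast)
  have RP: "\<beta> \<in> P" if "\<beta> \<in> R" for \<beta> using that pick by (auto simp: R_def)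
  have PR: "\<exists>\<beta>\<in>R. s \<beta> = s \<alpha>" if "\<alpha> \<in> P" for \<alpha>
    using pick[OF that] that by (auto simp: R_def)
  have "s ` P \<subseteq> carrier W" using s(1) by blast
  from finite_subset[OF this fin] have finR: "finite R" unfolding R_def by (rule finite_imageI)
  have sR: "s ` R = s ` P"
  proof
    show "s ` R \<subseteq> s ` P" using RP by blast
    show "s ` P \<subseteq> s ` R" using PR by (metis image_eqI image_subsetI)
  qed
  interpret reflection_group matrix_scale \<tt> W act R s h
  proof unfold_locales
    show "finite (carrier W)" by (rule fin)
    show "finite R" by (rule finR)
    show "generate W (s ` R) = carrier W" using gen sR by simp
    show "\<exists>\<beta>\<in>R. \<exists>c. \<forall>H\<in>\<tt>. \<alpha> (act (inv\<^bsub>W\<^esub> v) H) = c * \<beta> H" if "\<alpha> \<in> R" and v: "v \<in> carrier W" for \<alpha> v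
    proof -
      have "\<alpha> \<in> roots G T" using RP[OF that(1)] positive by (simp add: P_def)
      \<comment> \<open>The transformed root is positive up to sign. The sign and the passage to the
        chosen root of the same reflection are absorbed into the scalar.\<close>
      from roots_stable[OF this v] positive consider "(\<lambda>H\<in>\<tt>. \<alpha> (act (inv\<^bsub>W\<^esub> v) H)) \<in> P"
        | \<beta> where "\<beta> \<in> P" "(\<lambda>H\<in>\<tt>. \<alpha> (act (inv\<^bsub>W\<^esub> v) H)) = (\<lambda>H\<in>\<tt>. - \<beta> H)" by (auto simp: P_def)
      then obtain \<beta> c where b: "\<beta> \<in> P" "\<And>H. H \<in> \<tt> \<Longrightarrow> \<alpha> (act (inv\<^bsub>W\<^esub> v) H) = c * \<beta> H"
      proof cases
        case 1
        show ?thesis by (rule that[OF 1, of 1]) simp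
      next
        case (2 \<beta>)
        have "\<alpha> (act (inv\<^bsub>W\<^esub> v) H) = - 1 * \<beta> H" if "H \<in> \<tt>" for H using fun_cong[OF 2(2), of H] that by simp
        with 2(1) that show ?thesis by blast
      qed
      obtain \<gamma> where g: "\<gamma> \<in> R" "s \<gamma> = s \<beta>" using PR[OF b(1)] by blast
      obtain d where "\<forall>H\<in>\<tt>. \<beta> H = d * \<gamma> H" using proportional[OF b(1) RP[OF g(1)] g(2)[symmetric]] by blast
      then have "\<forall>H\<in>\<tt>. \<alpha> (act (inv\<^bsub>W\<^esub> v) H) = (c * d) * \<gamma> H" using b(2) by simp
      with g(1) show ?thesis by blast
    qed
    show "w = s \<alpha>" if "\<alpha> \<in> R" "w \<in> carrier W" "k \<in> \<tt>" "\<alpha> k = 2"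
      "\<And>H. H \<in> \<tt> \<Longrightarrow> act w H = H - matrix_scale (\<alpha> H) k" for \<alpha> w k
      by (rule s_unique[OF RP[OF that(1)] that(2-5)])
    show "act w H \<in> \<tt>" if "w \<in> carrier W" "H \<in> \<tt>" for w H by (rule act_closed[OF that])
    show "act w (H + K) = act w H + act w K" for w H K by (rule act_add)
    show "act w (matrix_scale c H) = matrix_scale c (act w H)" for w c H by (rule act_scale)
    show "act (v \<otimes>\<^bsub>W\<^esub> w) H = act v (act w H)" if "v \<in> carrier W" "w \<in> carrier W" "H \<in> \<tt>" for v w H
      by (rule act_mult[OF that])
    show "act \<one>\<^bsub>W\<^esub> H = H" if "H \<in> \<tt>" for H by (rule act_one[OF that])
    fix \<alpha> assume "\<alpha> \<in> R"
    then have \<alpha>: "\<alpha> \<in> P" by (rule RP)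
    show "t.lin \<alpha>" "s \<alpha> \<in> carrier W" "h \<alpha> \<in> \<tt>" "\<alpha> (h \<alpha>) = 2"
      using lin(1)[OF \<alpha>] s(1)[OF \<alpha>] h(1,2)[OF \<alpha>] by blast+
    show "act (s \<alpha>) H = H - matrix_scale (\<alpha> H) (h \<alpha>)" if "H \<in> \<tt>" for H by (rule h(3)[OF \<alpha> that])
  qed
  have PT: "HT_pt T = t.polynomial_ring"
    by (simp only: HT_pt_def t.polynomial_ring_def dual_iff t.generated_algebra_eq)
  \<comment> \<open>Membership in the principal ideal becomes equality on the hyperplane; the
    division needs a point where the root has value 1, and half the coroot provides it.\<close>
  have divisible: "f \<ominus>\<^bsub>t.polynomial_ring\<^esub> g \<in> PIdl\<^bsub>t.polynomial_ring\<^esub> \<alpha> \<longleftrightarrow> (\<forall>H\<in>\<tt>. \<alpha> H = 0 \<longrightarrow> g H = f H)"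
    if f: "f \<in> carrier t.polynomial_ring" and g: "g \<in> carrier t.polynomial_ring" and \<alpha>: "\<alpha> \<in> P" for f g \<alpha>
  proof -
    have pf: "t.pol f" "t.pol g" "g \<in> extensional \<tt>" using f g by simp_all
    have minus: "f \<ominus>\<^bsub>t.polynomial_ring\<^esub> g = (\<lambda>H\<in>\<tt>. f H - g H)"
      unfolding a_minus_def t.polynomial_ring_a_inv[OF pf(3,2)] t.polynomial_ring_simps
      by (rule restrict_ext) simp
    show ?thesis
    proof
      assume "f \<ominus>\<^bsub>t.polynomial_ring\<^esub> g \<in> PIdl\<^bsub>t.polynomial_ring\<^esub> \<alpha>"
      then obtain r where r: "(\<lambda>H\<in>\<tt>. f H - g H) = (\<lambda>H\<in>\<tt>. r H * \<alpha> H)"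
        unfolding minus cgenideal_def t.polynomial_ring_simps by blast
      have "f H - g H = r H * \<alpha> H" if "H \<in> \<tt>" for H using fun_cong[OF r, of H] that by simp
      then have "f H - g H = 0" if "H \<in> \<tt>" "\<alpha> H = 0" for H using that by (simp only: mult_zero_right)
      then show "\<forall>H\<in>\<tt>. \<alpha> H = 0 \<longrightarrow> g H = f H" by (metis eq_iff_diff_eq_0)
    next
      assume ker: "\<forall>H\<in>\<tt>. \<alpha> H = 0 \<longrightarrow> g H = f H"
      have half: "matrix_scale (1/2) (h \<alpha>) \<in> \<tt>" "\<alpha> (matrix_scale (1/2) (h \<alpha>)) = 1"
        using h[OF \<alpha>] t.lin_scale[OF lin(1)[OF \<alpha>] h(1)[OF \<alpha>], of "1/2"] t.t_closed(3) by simp_all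
      have "f H - g H = 0" if "H \<in> \<tt>" "\<alpha> H = 0" for H using ker that by simp
      from t.pol_divisible[OF t.pol_diff[OF pf(1,2)] lin(1)[OF \<alpha>] half this]
      obtain r where r: "t.pol r" "\<forall>H\<in>\<tt>. f H - g H = \<alpha> H * r H" by blast
      have "(\<lambda>H\<in>\<tt>. f H - g H) = (\<lambda>H\<in>\<tt>. (\<lambda>H\<in>\<tt>. r H) H * \<alpha> H)"
        using r(2) by (intro restrict_ext) simp
      moreover have "(\<lambda>H\<in>\<tt>. r H) \<in> {f \<in> extensional \<tt>. t.pol f}"
        using r(1) by (intro CollectI conjI restrict_extensional) (simp only: t.pol_restrict)
      ultimately show "f \<ominus>\<^bsub>t.polynomial_ring\<^esub> g \<in> PIdl\<^bsub>t.polynomial_ring\<^esub> \<alpha>"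
        unfolding minus cgenideal_def t.polynomial_ring_simps by blast
    qed
  qed
  have carrier_eq: "{p \<in> carrier W \<rightarrow>\<^sub>E carrier t.polynomial_ring. \<forall>v\<in>carrier W. \<forall>\<alpha>\<in>P.
        p v \<ominus>\<^bsub>t.polynomial_ring\<^esub> p (s \<alpha> \<otimes>\<^bsub>W\<^esub> v) \<in> PIdl\<^bsub>t.polynomial_ring\<^esub> \<alpha>} =
      {p \<in> carrier W \<rightarrow>\<^sub>E carrier t.polynomial_ring. gkm p}"
  proof (rule Collect_cong, rule conj_cong[OF refl])
    fix p assume p: "p \<in> carrier W \<rightarrow>\<^sub>E carrier t.polynomial_ring"
    have 1: "(p v \<ominus>\<^bsub>t.polynomial_ring\<^esub> p (s \<alpha> \<otimes>\<^bsub>W\<^esub> v) \<in> PIdl\<^bsub>t.polynomial_ring\<^esub> \<alpha>) \<longleftrightarrow>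
        (\<forall>H\<in>\<tt>. \<alpha> H = 0 \<longrightarrow> p (s \<alpha> \<otimes>\<^bsub>W\<^esub> v) H = p v H)" if "v \<in> carrier W" "\<alpha> \<in> P" for v \<alpha>
      using that s p by (intro divisible) auto
    \<comment> \<open>A root and the chosen root with the same reflection are proportional and so
      have the same zero set; every congruence for \<open>P\<close> already occurs among those for
      \<open>R\<close>.\<close>
    have 2: "(\<forall>\<alpha>\<in>P. \<forall>H\<in>\<tt>. \<alpha> H = 0 \<longrightarrow> p (s \<alpha> \<otimes>\<^bsub>W\<^esub> v) H = p v H) \<longleftrightarrow>
        (\<forall>\<alpha>\<in>R. \<forall>H\<in>\<tt>. \<alpha> H = 0 \<longrightarrow> p (s \<alpha> \<otimes>\<^bsub>W\<^esub> v) H = p v H)" for v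
    proof (intro iffI ballI impI)
      fix \<alpha> H assume *: "\<forall>\<alpha>\<in>R. \<forall>H\<in>\<tt>. \<alpha> H = 0 \<longrightarrow> p (s \<alpha> \<otimes>\<^bsub>W\<^esub> v) H = p v H"
        and a: "\<alpha> \<in> P" "H \<in> \<tt>" "\<alpha> H = 0"
      obtain \<beta> where b: "\<beta> \<in> R" "s \<beta> = s \<alpha>" using PR[OF a(1)] by blast
      obtain c where "\<forall>H\<in>\<tt>. \<beta> H = c * \<alpha> H" using proportional[OF RP[OF b(1)] a(1) b(2)] by blast
      then have "\<beta> H = 0" using a by simp
      then have "p (s \<beta> \<otimes>\<^bsub>W\<^esub> v) H = p v H" using * b(1) a(2) by blast
      then show "p (s \<alpha> \<otimes>\<^bsub>W\<^esub> v) H = p v H" by (simp only: b(2))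
    qed (use RP in blast)
    have 3: "\<forall>v\<in>carrier W. t.pol (p v)" using p by auto
    show "(\<forall>v\<in>carrier W. \<forall>\<alpha>\<in>P. p v \<ominus>\<^bsub>t.polynomial_ring\<^esub> p (s \<alpha> \<otimes>\<^bsub>W\<^esub> v) \<in> PIdl\<^bsub>t.polynomial_ring\<^esub> \<alpha>) \<longleftrightarrow> gkm p"
      unfolding gkm_def using 3 by (simp add: 1 2)
  qed
  have FL: "HT_flag G B T = gkm_ring"
    unfolding HT_flag_def gkm_ring_def PT P_def[symmetric] s_def[symmetric] carrier_eq ..
  have ST: "star G T = star_act" by (intro ext) (simp add: star_def star_act_def)
  have IST: "induced_star G T = (\<lambda>w. image (star_act w))"
    by (intro ext) (simp add: induced_star_def ST)
  have J: "augmentation_ideal G B T = augmentation"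
    unfolding augmentation_ideal_def augmentation_def FL PT dual_iff ..
  have HF: "H_flag G B T = quotient_module"
    unfolding H_flag_def quotient_module_def FL J Let_def ..
  show ?thesis
    unfolding PT FL ST IST HF using gkm_ring_regular quotient_module_regular ..
qed

end
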